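(* Let $G$ be a compact Lie group and $X$ a $G$-space. Let $QEll^*_G(X):=K^*_{orb}(\Lambda(X/\!\!/G))$ be the quasi-elliptic cohomology of $X$. Then $$QEll^*_G(X)\;=\;\prod_{g\in G^{tors}_{conj}}K^*_{\Lambda_G(g)}(X^{g})\;=\;\Big(\prod_{g\in G^{tors}}K^*_{\Lambda_G(g)}(X^{g})\Big)^{G}.$$
   Context: $G^{tors}$ is the set of elements of finite order in $G$; $G^{tors}_{conj}$ is a set of representatives of the $G$-conjugacy classes in $G^{tors}$. For $g\in G$, $X^g$ is the fixed point space and $C_G(g)$ the centralizer. For $g\in G^{tors}$, $\Lambda_G(g):=(C_G(g)\times\mathbb{R})/\langle(g,-1)\rangle$; it acts on $X^g$ by $[h,t]\cdot x:=h\cdot x$. For $g,g'\in G^{tors}$ put $C_G(g,g')=\{\sigma\in G: g'\sigma=\sigma g\}$, and let $\Lambda_G(g,g')$ be the quotient of $C_G(g,g')\times\mathbb{R}/l\mathbb{Z}$ ($l$ the order of $g$) under the equivalence $(\sigma,t)\sim(\sigma g,t-1)=(g'\sigma,t-1)$. The groupoid $\Lambda(X/\!\!/G)$ has object space $\coprod_{g\in G^{tors}}X^g$ and morphism space $\coprod_{g,g'\in G^{tors}}\Lambda_G(g,g')\times X^g$; the morphism given by $[\sigma,t]\in\Lambda_G(g,g')$ and $x\in X^g$ goes from $x\in X^g$ to $\sigma x\in X^{g'}$, and composition is $[\sigma_1,t_1][\sigma_2,t_2]=[\sigma_1\sigma_2,t_1+t_2]$. $K^*_{H}(-)$ denotes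 equivariant complex K-theory and $K^*_{orb}$ denotes orbifold K-theory (K-theory of groupoids), which for the action groupoid $Y/\!\!/H$ of a compact Lie group $H$ is $K^*_H(Y)$. In the last expression, $G$ acts on $\prod_{g\in G^{tors}}K^*_{\Lambda_G(g)}(X^g)$ by conjugation, i.e. through the maps $X^g\to X^{hgh^{-1}}$, $x\mapsto hx$, and the group isomorphisms $\Lambda_G(g)\to\Lambda_G(hgh^{-1})$, $[u,t]\mapsto[huh^{-1},t]$, for $h\in G$; $(-)^G$ denotes invariants. *)

theory Defs
  imports "HOL-Analysis.Analysis" "HOL-Algebra.Product_Groups" "HOL-Algebra.Group_Action"
    "HOL-Algebra.Multiplicative_Group"
begin

section \<open>Compact Lie groups and their actions\<close>

text \<open>Functions of \<open>n\<close> real variables are functions on (subsets of) the space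
  \<^term>\<open>Euclidean_space n\<close> of sequences supported on the first \<open>n\<close> indices; in contrast to a
  type of class \<open>euclidean_space\<close> this admits \<open>n = 0\<close>, i.e. finite groups.\<close>

primrec Ck_fn :: "nat \<Rightarrow> nat \<Rightarrow> (nat \<Rightarrow> real) set \<Rightarrow> ((nat \<Rightarrow> real) \<Rightarrow> real) \<Rightarrow> bool" where
  "Ck_fn n 0 U f \<longleftrightarrow> continuous_map (subtopology (Euclidean_space n) U) euclideanreal f"
| "Ck_fn n (Suc k) U f \<longleftrightarrow>
     continuous_map (subtopology (Euclidean_space n) U) euclideanreal f \<and>
     (\<exists>D. \<forall>i<n. (\<forall>x\<in>U. ((\<lambda>t. f (x(i := t))) has_real_derivative D i x) (at (x i))) \<and>
                Ck_fn n k U (D i))"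

definition smooth_map :: "nat \<Rightarrow> nat \<Rightarrow> (nat \<Rightarrow> real) set \<Rightarrow> ((nat \<Rightarrow> real) \<Rightarrow> (nat \<Rightarrow> real)) \<Rightarrow> bool" where
  "smooth_map n m U f \<longleftrightarrow> openin (Euclidean_space n) U \<and> (\<forall>j<m. \<forall>k. Ck_fn n k U (\<lambda>x. f x j))"

definition smooth_atlas :: "nat \<Rightarrow> 'g topology \<Rightarrow> ('g set \<times> ('g \<Rightarrow> (nat \<Rightarrow> real))) set \<Rightarrow> bool" where
  "smooth_atlas n T \<A> \<longleftrightarrow>
     (\<Union>(U, c)\<in>\<A>. U) = topspace T \<and>
     (\<forall>(U, c)\<in>\<A>. openin T U \<and> openin (Euclidean_space n) (c ` U) \<and>
        homeomorphic_map (subtopology T U) (subtopology (Euclidean_space n) (c ` U)) c) \<and>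
     (\<forall>(U, c)\<in>\<A>. \<forall>(V, d)\<in>\<A>. smooth_map n n (c ` (U \<inter> V)) (\<lambda>x. d (inv_into U c x)))"

definition topological_group :: "('g, 'b) monoid_scheme \<Rightarrow> 'g topology \<Rightarrow> bool" where
  "topological_group G TG \<longleftrightarrow>
     group G \<and> topspace TG = carrier G \<and>
     continuous_map (prod_topology TG TG) TG (\<lambda>(x, y). x \<otimes>\<^bsub>G\<^esub> y) \<and>
     continuous_map TG TG (\<lambda>x. inv\<^bsub>G\<^esub> x)"

text \<open>A point of \<open>\<real>\<^sup>n \<times> \<real>\<^sup>n\<close> is encoded as a point \<open>z\<close> of \<open>\<real>\<^sup>n\<^sup>+\<^sup>n\<close>; its two components are
  \<open>fst_half n z\<close> and \<open>snd_half n z\<close>.\<close>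

definition fst_half :: "nat \<Rightarrow> (nat \<Rightarrow> real) \<Rightarrow> (nat \<Rightarrow> real)" where
  "fst_half n z = (\<lambda>i. if i < n then z i else 0)"

definition snd_half :: "nat \<Rightarrow> (nat \<Rightarrow> real) \<Rightarrow> (nat \<Rightarrow> real)" where
  "snd_half n z = (\<lambda>i. if i < n then z (n + i) else 0)"

definition lie_group :: "('g, 'b) monoid_scheme \<Rightarrow> 'g topology \<Rightarrow> bool" where
  "lie_group G TG \<longleftrightarrow>
     topological_group G TG \<and> Hausdorff_space TG \<and> second_countable TG \<and>
     (\<exists>n \<A>. smooth_atlas n TG \<A> \<and>
       (\<forall>(U, c)\<in>\<A>. \<forall>(V, d)\<in>\<A>. \<forall>(W, e)\<in>\<A>.
          smooth_map (n + n) n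
            {z \<in> topspace (Euclidean_space (n + n)). fst_half n z \<in> c ` U \<and> snd_half n z \<in> d ` V \<and>
               inv_into U c (fst_half n z) \<otimes>\<^bsub>G\<^esub> inv_into V d (snd_half n z) \<in> W}
            (\<lambda>z. e (inv_into U c (fst_half n z) \<otimes>\<^bsub>G\<^esub> inv_into V d (snd_half n z)))) \<and>
       (\<forall>(U, c)\<in>\<A>. \<forall>(V, d)\<in>\<A>.
          smooth_map n n {x \<in> c ` U. inv\<^bsub>G\<^esub> (inv_into U c x) \<in> V}
            (\<lambda>x. d (inv\<^bsub>G\<^esub> (inv_into U c x)))))"

definition compact_lie_group :: "('g, 'b) monoid_scheme \<Rightarrow> 'g topology \<Rightarrow> bool" where
  "compact_lie_group G TG \<longleftrightarrow> lie_group G TG \<and> compact_space TG"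

definition G_space :: "('g, 'b) monoid_scheme \<Rightarrow> 'g topology \<Rightarrow> 'x topology \<Rightarrow> ('g \<Rightarrow> 'x \<Rightarrow> 'x) \<Rightarrow> bool" where
  "G_space G TG TX \<phi> \<longleftrightarrow>
     group_action G (topspace TX) \<phi> \<and>
     continuous_map (prod_topology TG TX) TX (\<lambda>(g, x). \<phi> g x)"

definition fixed_points :: "'x topology \<Rightarrow> ('g \<Rightarrow> 'x \<Rightarrow> 'x) \<Rightarrow> 'g \<Rightarrow> 'x set" where
  "fixed_points TX \<phi> g = {x \<in> topspace TX. \<phi> g x = x}"

definition tors :: "('g, 'b) monoid_scheme \<Rightarrow> 'g set" where
  "tors G = {g \<in> carrier G. \<exists>l::nat. 0 < l \<and> g [^]\<^bsub>G\<^esub> l = \<one>\<^bsub>G\<^esub>}"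

definition conj_by :: "('g, 'b) monoid_scheme \<Rightarrow> 'g \<Rightarrow> 'g \<Rightarrow> 'g" where
  "conj_by G h g = h \<otimes>\<^bsub>G\<^esub> g \<otimes>\<^bsub>G\<^esub> inv\<^bsub>G\<^esub> h"

definition tors_conj_reps :: "('g, 'b) monoid_scheme \<Rightarrow> 'g set \<Rightarrow> bool" where
  "tors_conj_reps G R \<longleftrightarrow>
     R \<subseteq> tors G \<and> (\<forall>g\<in>tors G. \<exists>!r. r \<in> R \<and> (\<exists>h\<in>carrier G. r = conj_by G h g))"


section \<open>Vector bundles\<close>

definition quotient_topology :: "'a topology \<Rightarrow> ('a \<Rightarrow> 'b) \<Rightarrow> 'b topology" where
  "quotient_topology T q =
     topology (\<lambda>V. V \<subseteq> q ` topspace T \<and> openin T {x \<in> topspace T. q x \<in> V})"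

lemma openin_quotient_topology:
  "openin (quotient_topology T q) V \<longleftrightarrow> V \<subseteq> q ` topspace T \<and> openin T {x \<in> topspace T. q x \<in> V}"
proof -
  have 1: "{x \<in> topspace T. q x \<in> V \<inter> W} = {x \<in> topspace T. q x \<in> V} \<inter> {x \<in> topspace T. q x \<in> W}"
    for V W by auto
  have 2: "{x \<in> topspace T. q x \<in> \<Union>\<K>} = (\<Union>V\<in>\<K>. {x \<in> topspace T. q x \<in> V})" for \<K>
    by auto
  have "istopology (\<lambda>V. V \<subseteq> q ` topspace T \<and> openin T {x \<in> topspace T. q x \<in> V})"
    unfolding istopology_def 1 2 by blast
  then show ?thesis
    by (simp add: quotient_topology_def)
qed

lemma topspace_quotient_topology [simp]: "topspace (quotient_topology T q) = q ` topspace T"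
proof -
  have "{x \<in> topspace T. q x \<in> q ` topspace T} = topspace T"
    by auto
  then have "openin (quotient_topology T q) (q ` topspace T)"
    by (simp add: openin_quotient_topology)
  then show ?thesis
    by (meson openin_quotient_topology openin_subset openin_topspace subset_antisym)
qed

lemma quotient_map_quotient_topology: "quotient_map T (quotient_topology T q) q"
  by (auto simp: quotient_map_def openin_quotient_topology)

text \<open>The total space of a complex vector bundle over a space with points of type \<open>'o\<close> is a
  topological space of pairs \<open>(x, v)\<close>, the fibre over \<open>x\<close> being a linear subspace of the vector
  space of all complex sequences. The topology on the total space is part of the data and need
  not be induced by that of the sequences, so every complex vector bundle of finite rank is
  isomorphic to one of this form; fixing this form turns isomorphism classes of bundles into a
  set.\<close>

type_synonym cseq = "nat \<Rightarrow> complex"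

definition fibre :: "('o \<times> cseq) topology \<Rightarrow> 'o \<Rightarrow> cseq set" where
  "fibre E x = {v. (x, v) \<in> topspace E}"

definition csubspace :: "cseq set \<Rightarrow> bool" where
  "csubspace V \<longleftrightarrow> (\<lambda>i. 0) \<in> V \<and> (\<forall>u\<in>V. \<forall>v\<in>V. (\<lambda>i. u i + v i) \<in> V) \<and> (\<forall>a. \<forall>v\<in>V. (\<lambda>i. a * v i) \<in> V)"

definition clinear_on :: "cseq set \<Rightarrow> (cseq \<Rightarrow> cseq) \<Rightarrow> bool" where
  "clinear_on V f \<longleftrightarrow>
     (\<forall>u\<in>V. \<forall>v\<in>V. f (\<lambda>i. u i + v i) = (\<lambda>i. f u i + f v i)) \<and>
     (\<forall>a. \<forall>v\<in>V. f (\<lambda>i. a * v i) = (\<lambda>i. a * f v i))"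

definition Cn :: "nat \<Rightarrow> cseq set" where
  "Cn n = {v. \<forall>i\<ge>n. v i = 0}"

text \<open>The rank may vary from point to point.\<close>

definition vector_bundle :: "'o topology \<Rightarrow> ('o \<times> cseq) topology \<Rightarrow> bool" where
  "vector_bundle B E \<longleftrightarrow>
     continuous_map E B fst \<and>
     (\<forall>x\<in>topspace B. csubspace (fibre E x)) \<and>
     (\<forall>x\<in>topspace B. \<exists>U n f. openin B U \<and> x \<in> U \<and>
        (\<forall>y\<in>U. clinear_on (fibre E y) (f y)) \<and>
        homeomorphic_map (subtopology E {e. fst e \<in> U})
          (prod_topology (subtopology B U) (top_of_set (Cn n))) (\<lambda>(y, v). (y, f y v)))"


section \<open>K-theory of topological groupoids\<close>

text \<open>Inverses are determined by the composition and are not recorded.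
  \<open>cmp m k\<close> is ``first \<open>k\<close>, then \<open>m\<close>'', for \<open>src m = tgt k\<close>.\<close>

record ('o, 'm) tgroupoid =
  Ob :: "'o topology"
  Mor :: "'m topology"
  src :: "'m \<Rightarrow> 'o"
  tgt :: "'m \<Rightarrow> 'o"
  cmp :: "'m \<Rightarrow> 'm \<Rightarrow> 'm"
  idm :: "'o \<Rightarrow> 'm"

record ('o, 'm) gbundle =
  tot :: "('o \<times> cseq) topology"
  act :: "'m \<Rightarrow> cseq \<Rightarrow> cseq"

definition groupoid_bundle :: "('o, 'm) tgroupoid \<Rightarrow> ('o, 'm) gbundle \<Rightarrow> bool" where
  "groupoid_bundle \<G> E \<longleftrightarrow>
     vector_bundle (Ob \<G>) (tot E) \<and>
     (\<forall>m\<in>topspace (Mor \<G>). act E m ` fibre (tot E) (src \<G> m) \<subseteq> fibre (tot E) (tgt \<G> m) \<and>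
        clinear_on (fibre (tot E) (src \<G> m)) (act E m)) \<and>
     (\<forall>x\<in>topspace (Ob \<G>). \<forall>v\<in>fibre (tot E) x. act E (idm \<G> x) v = v) \<and>
     (\<forall>m\<in>topspace (Mor \<G>). \<forall>k\<in>topspace (Mor \<G>). src \<G> m = tgt \<G> k \<longrightarrow>
        (\<forall>v\<in>fibre (tot E) (src \<G> k). act E (cmp \<G> m k) v = act E m (act E k v))) \<and>
     continuous_map
       (subtopology (prod_topology (Mor \<G>) (tot E)) {(m, e). src \<G> m = fst e})
       (tot E) (\<lambda>(m, e). (tgt \<G> m, act E m (snd e)))"

definition gbundle_iso :: "('o, 'm) tgroupoid \<Rightarrow> ('o, 'm) gbundle \<Rightarrow> ('o, 'm) gbundle \<Rightarrow> bool" where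
  "gbundle_iso \<G> E F \<longleftrightarrow>
     (\<exists>f. homeomorphic_map (tot E) (tot F) (\<lambda>(x, v). (x, f x v)) \<and>
        (\<forall>x\<in>topspace (Ob \<G>). clinear_on (fibre (tot E) x) (f x)) \<and>
        (\<forall>m\<in>topspace (Mor \<G>). \<forall>v\<in>fibre (tot E) (src \<G> m).
           f (tgt \<G> m) (act E m v) = act F m (f (src \<G> m) v)))"

text \<open>In the direct sum, a pair \<open>(v, w)\<close> of vectors is encoded as the interleaved sequence
  \<open>v 0, w 0, v 1, w 1, \<dots>\<close>; the total space is the fibre product of the two total spaces.\<close>

definition evens :: "cseq \<Rightarrow> cseq" where
  "evens u = (\<lambda>i. u (2 * i))"

definition odds :: "cseq \<Rightarrow> cseq" where
  "odds u = (\<lambda>i. u (2 * i + 1))"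

definition interleave :: "cseq \<Rightarrow> cseq \<Rightarrow> cseq" where
  "interleave v w = (\<lambda>i. if even i then v (i div 2) else w (i div 2))"

definition gbundle_sum :: "('o, 'm) gbundle \<Rightarrow> ('o, 'm) gbundle \<Rightarrow> ('o, 'm) gbundle" where
  "gbundle_sum E F =
     \<lparr>tot = pullback_topology {(x, u). evens u \<in> fibre (tot E) x \<and> odds u \<in> fibre (tot F) x}
              (\<lambda>(x, u). ((x, evens u), (x, odds u))) (prod_topology (tot E) (tot F)),
      act = (\<lambda>m u. interleave (act E m (evens u)) (act F m (odds u)))\<rparr>"

definition zero_gbundle :: "('o, 'm) tgroupoid \<Rightarrow> ('o, 'm) gbundle" where
  "zero_gbundle \<G> =
     \<lparr>tot = prod_topology (Ob \<G>) (top_of_set {\<lambda>i. 0}), act = (\<lambda>m v. v)\<rparr>"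

text \<open>Formal differences \<open>E - F\<close> are represented by pairs \<open>(E, F)\<close>.\<close>

definition K_rel :: "('o, 'm) tgroupoid \<Rightarrow>
    ((('o, 'm) gbundle \<times> ('o, 'm) gbundle) \<times> (('o, 'm) gbundle \<times> ('o, 'm) gbundle)) set" where
  "K_rel \<G> = {((E, F), (E', F')).
     groupoid_bundle \<G> E \<and> groupoid_bundle \<G> F \<and> groupoid_bundle \<G> E' \<and> groupoid_bundle \<G> F' \<and>
     (\<exists>H. groupoid_bundle \<G> H \<and>
        gbundle_iso \<G> (gbundle_sum (gbundle_sum E F') H) (gbundle_sum (gbundle_sum E' F) H))}"

text \<open>The Grothendieck group of isomorphism classes of \<open>\<G>\<close>-vector bundles; as usual in
  \<open>HOL-Algebra\<close> the group operation is called \<open>mult\<close>, although it is written additively in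
  K-theory.\<close>

definition K_group :: "('o, 'm) tgroupoid \<Rightarrow> (('o, 'm) gbundle \<times> ('o, 'm) gbundle) set monoid" where
  "K_group \<G> =
     \<lparr>carrier = ({E. groupoid_bundle \<G> E} \<times> {E. groupoid_bundle \<G> E}) // K_rel \<G>,
      monoid.mult = (\<lambda>\<xi> \<eta>. \<Union>(E, F)\<in>\<xi>. \<Union>(E', F')\<in>\<eta>. K_rel \<G> `` {(gbundle_sum E E', gbundle_sum F F')}),
      one = K_rel \<G> `` {(zero_gbundle \<G>, zero_gbundle \<G>)}\<rparr>"

text \<open>A continuous functor is given by its maps on objects and on morphisms.\<close>

type_synonym ('o, 'm, 'o', 'm') gfunctor = "('o \<Rightarrow> 'o') \<times> ('m \<Rightarrow> 'm')"

definition gbundle_pullback :: "('o, 'm) tgroupoid \<Rightarrow> ('o, 'm, 'o', 'm') gfunctor \<Rightarrow>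
    ('o', 'm') gbundle \<Rightarrow> ('o, 'm) gbundle" where
  "gbundle_pullback \<G> F E =
     \<lparr>tot = pullback_topology {(x, v). x \<in> topspace (Ob \<G>) \<and> v \<in> fibre (tot E) (fst F x)}
              (\<lambda>(x, v). (x, (fst F x, v))) (prod_topology (Ob \<G>) (tot E)),
      act = (\<lambda>m. act E (snd F m))\<rparr>"

text \<open>The homomorphism induced by a functor from \<open>\<G>\<close> to another groupoid.\<close>

definition K_group_map :: "('o, 'm) tgroupoid \<Rightarrow> ('o, 'm, 'o', 'm') gfunctor \<Rightarrow>
    (('o', 'm') gbundle \<times> ('o', 'm') gbundle) set \<Rightarrow> (('o, 'm) gbundle \<times> ('o, 'm) gbundle) set" where
  "K_group_map \<G> F \<xi> =
     (\<Union>(E, E')\<in>\<xi>. K_rel \<G> `` {(gbundle_pullback \<G> F E, gbundle_pullback \<G> F E')})"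

definition groupoid_times :: "('o, 'm) tgroupoid \<Rightarrow> 's topology \<Rightarrow> ('o \<times> 's, 'm \<times> 's) tgroupoid" where
  "groupoid_times \<G> S =
     \<lparr>Ob = prod_topology (Ob \<G>) S, Mor = prod_topology (Mor \<G>) S,
      src = map_prod (src \<G>) id, tgt = map_prod (tgt \<G>) id,
      cmp = (\<lambda>(m, s) (k, s'). (cmp \<G> m k, s)),
      idm = map_prod (idm \<G>) id\<rparr>"

definition nsphere_pt :: "nat \<Rightarrow> real" where
  "nsphere_pt = (\<lambda>i. if i = 0 then 1 else 0)"

text \<open>\<open>K\<^sup>-\<^sup>d(\<G>)\<close> is the kernel of the restriction \<open>K(\<G> \<times> S\<^sup>d) \<rightarrow> K(\<G>)\<close> to the base point of the
  sphere, for \<open>d \<ge> 0\<close>; in particular \<open>K\<^sup>0(\<G>)\<close> appears as the kernel of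
  \<open>K(\<G> \<times> S\<^sup>0) = K(\<G>) \<times> K(\<G>) \<rightarrow> K(\<G>)\<close>. Positive degrees are defined by two-periodicity:
  \<open>K\<^sup>d = K\<^sup>d\<^sup>-\<^sup>2\<^sup>d = K\<^sup>-\<^sup>d\<close>.\<close>

definition sphere_dim :: "int \<Rightarrow> nat" where
  "sphere_dim n = nat \<bar>n\<bar>"

definition K_orb :: "int \<Rightarrow> ('o, 'm) tgroupoid \<Rightarrow>
    (('o \<times> (nat \<Rightarrow> real), 'm \<times> (nat \<Rightarrow> real)) gbundle \<times>
     ('o \<times> (nat \<Rightarrow> real), 'm \<times> (nat \<Rightarrow> real)) gbundle) set monoid" where
  "K_orb n \<G> =
     (let K = K_group (groupoid_times \<G> (nsphere (sphere_dim n))) in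
      K\<lparr>carrier := kernel K (K_group \<G>)
                    (K_group_map \<G> (\<lambda>x. (x, nsphere_pt), \<lambda>m. (m, nsphere_pt)))\<rparr>)"

definition K_orb_map :: "int \<Rightarrow> ('o, 'm) tgroupoid \<Rightarrow> ('o, 'm, 'o', 'm') gfunctor \<Rightarrow>
    (('o' \<times> (nat \<Rightarrow> real), 'm' \<times> (nat \<Rightarrow> real)) gbundle \<times>
     ('o' \<times> (nat \<Rightarrow> real), 'm' \<times> (nat \<Rightarrow> real)) gbundle) set \<Rightarrow>
    (('o \<times> (nat \<Rightarrow> real), 'm \<times> (nat \<Rightarrow> real)) gbundle \<times>
     ('o \<times> (nat \<Rightarrow> real), 'm \<times> (nat \<Rightarrow> real)) gbundle) set" where
  "K_orb_map n \<G> F =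
     K_group_map (groupoid_times \<G> (nsphere (sphere_dim n))) (map_prod (fst F) id, map_prod (snd F) id)"


section \<open>Equivariant K-theory\<close>

definition action_groupoid :: "('h, 'b) monoid_scheme \<Rightarrow> 'h topology \<Rightarrow> 'y topology \<Rightarrow>
    ('h \<Rightarrow> 'y \<Rightarrow> 'y) \<Rightarrow> ('y, 'h \<times> 'y) tgroupoid" where
  "action_groupoid H TH Y a =
     \<lparr>Ob = Y, Mor = prod_topology TH Y,
      src = snd, tgt = (\<lambda>(h, y). a h y),
      cmp = (\<lambda>(h, y) (k, z). (h \<otimes>\<^bsub>H\<^esub> k, z)),
      idm = (\<lambda>y. (\<one>\<^bsub>H\<^esub>, y))\<rparr>"

abbreviation K_equiv where
  "K_equiv n H TH Y a \<equiv> K_orb n (action_groupoid H TH Y a)"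

text \<open>Bundles over the action groupoid are the same as \<open>H\<close>-equivariant vector bundles in the usual
  sense: \<open>H\<close> acts continuously on the total space, covering its action on the base, by maps that
  are linear on fibres.\<close>

definition equivariant_vector_bundle :: "('h, 'b) monoid_scheme \<Rightarrow> 'h topology \<Rightarrow> 'y topology \<Rightarrow>
    ('h \<Rightarrow> 'y \<Rightarrow> 'y) \<Rightarrow> ('y \<times> cseq) topology \<Rightarrow> ('h \<Rightarrow> 'y \<times> cseq \<Rightarrow> 'y \<times> cseq) \<Rightarrow> bool" where
  "equivariant_vector_bundle H TH Y a E \<rho> \<longleftrightarrow>
     vector_bundle Y E \<and>
     continuous_map (prod_topology TH E) E (\<lambda>(h, e). \<rho> h e) \<and>
     (\<forall>e\<in>topspace E. \<rho> \<one>\<^bsub>H\<^esub> e = e) \<and>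
     (\<forall>h\<in>carrier H. \<forall>k\<in>carrier H. \<forall>e\<in>topspace E. \<rho> (h \<otimes>\<^bsub>H\<^esub> k) e = \<rho> h (\<rho> k e)) \<and>
     (\<forall>h\<in>carrier H. \<forall>e\<in>topspace E. fst (\<rho> h e) = a h (fst e)) \<and>
     (\<forall>h\<in>carrier H. \<forall>y\<in>topspace Y. clinear_on (fibre E y) (\<lambda>v. snd (\<rho> h (y, v))))"

lemma groupoid_bundle_action_groupoid_iff:
  assumes TH: "topspace TH = carrier H"
    and closed: "\<And>h y. h \<in> carrier H \<Longrightarrow> y \<in> topspace Y \<Longrightarrow> a h y \<in> topspace Y"
    and one: "\<And>y. y \<in> topspace Y \<Longrightarrow> a \<one>\<^bsub>H\<^esub> y = y"
    and mult: "\<And>h k y. h \<in> carrier H \<Longrightarrow> k \<in> carrier H \<Longrightarrow> y \<in> topspace Y \<Longrightarrow>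
                 a (h \<otimes>\<^bsub>H\<^esub> k) y = a h (a k y)"
  shows "groupoid_bundle (action_groupoid H TH Y a) E \<longleftrightarrow>
         equivariant_vector_bundle H TH Y a (tot E) (\<lambda>h (y, v). (a h y, act E (h, y) v))"
    (is "?L \<longleftrightarrow> ?R")
proof (cases "vector_bundle Y (tot E)")
  case False
  then show ?thesis
    by (simp add: groupoid_bundle_def equivariant_vector_bundle_def action_groupoid_def)
next
  case True
  let ?T = "tot E"
  let ?Z = "subtopology (prod_topology (prod_topology TH Y) ?T) {(m, e). snd m = fst e}"
  define \<rho> where "\<rho> = (\<lambda>h (y, v). (a h y, act E (h, y) v))"
  have fstc: "continuous_map (tot E) Y fst"
    using True by (simp add: vector_bundle_def)
  have sub: "y \<in> topspace Y" if "(y, v) \<in> topspace (tot E)" for y v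
    using continuous_map_image_subset_topspace[OF fstc] that by force
  define Z where "Z = subtopology (prod_topology (prod_topology TH Y) (tot E)) {(m, e). snd m = fst e}"
  have topZ: "((h, y), (y', v)) \<in> topspace Z \<longleftrightarrow> h \<in> carrier H \<and> y = y' \<and> (y', v) \<in> topspace (tot E)"
    for h y y' v
    using sub TH by (auto simp: Z_def)
  have c1: "continuous_map (prod_topology TH (tot E)) Z (\<lambda>(h, e). ((h, fst e), e))"
    unfolding Z_def continuous_map_in_subtopology
    using continuous_map_compose[OF continuous_map_snd fstc]
    by (auto simp: case_prod_beta continuous_map_pairwise o_def
        intro: continuous_map_fst continuous_map_snd)
  have c2: "continuous_map Z (prod_topology TH (tot E)) (\<lambda>(m, e). (fst m, e))"
    unfolding Z_def
    by (rule continuous_map_from_subtopology)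
       (auto simp: case_prod_beta continuous_map_pairwise o_def continuous_map_snd
        intro: continuous_map_compose[OF continuous_map_fst continuous_map_fst, unfolded o_def])
  have cont: "continuous_map Z (tot E) (\<lambda>(m, e). (a (fst m) (snd m), act E m (snd e))) \<longleftrightarrow>
              continuous_map (prod_topology TH (tot E)) (tot E) (\<lambda>(h, e). \<rho> h e)" (is "?c \<longleftrightarrow> ?d")
  proof
    assume ?c
    from continuous_map_compose[OF c1 this] show ?d
      by (rule continuous_map_eq) (auto simp: \<rho>_def)
  next
    assume ?d
    from continuous_map_compose[OF c2 this] show ?c
      by (rule continuous_map_eq) (auto simp: \<rho>_def topZ)
  qed
  have L: "groupoid_bundle (action_groupoid H TH Y a) E \<longleftrightarrow>
     (\<forall>h\<in>carrier H. \<forall>y\<in>topspace Y. act E (h, y) ` fibre (tot E) y \<subseteq> fibre (tot E) (a h y) \<and>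
        clinear_on (fibre (tot E) y) (act E (h, y))) \<and>
     (\<forall>y\<in>topspace Y. \<forall>v\<in>fibre (tot E) y. act E (\<one>\<^bsub>H\<^esub>, y) v = v) \<and>
     (\<forall>h\<in>carrier H. \<forall>k\<in>carrier H. \<forall>y\<in>topspace Y. \<forall>v\<in>fibre (tot E) y.
        act E (h \<otimes>\<^bsub>H\<^esub> k, y) v = act E (h, a k y) (act E (k, y) v)) \<and>
     continuous_map (prod_topology TH (tot E)) (tot E) (\<lambda>(h, e). \<rho> h e)"
  proof -
    have "(\<forall>m\<in>carrier H \<times> topspace Y. \<forall>k\<in>carrier H \<times> topspace Y. snd m = a (fst k) (snd k) \<longrightarrow>
             (\<forall>v\<in>fibre (tot E) (snd k). act E (fst m \<otimes>\<^bsub>H\<^esub> fst k, snd k) v = act E m (act E k v))) \<longleftrightarrow>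
          (\<forall>h\<in>carrier H. \<forall>k\<in>carrier H. \<forall>y\<in>topspace Y. \<forall>v\<in>fibre (tot E) y.
             act E (h \<otimes>\<^bsub>H\<^esub> k, y) v = act E (h, a k y) (act E (k, y) v))"
      (is "?l \<longleftrightarrow> ?r")
    proof
      assume l: ?l
      show ?r
      proof (intro ballI)
        fix h k y v assume "h \<in> carrier H" "k \<in> carrier H" "y \<in> topspace Y" "v \<in> fibre (tot E) y"
        then show "act E (h \<otimes>\<^bsub>H\<^esub> k, y) v = act E (h, a k y) (act E (k, y) v)"
          using l[rule_format, of "(h, a k y)" "(k, y)" v] closed by simp
      qed
    next
      assume r: ?r
      show ?l
      proof (intro ballI impI)
        fix m k v assume "m \<in> carrier H \<times> topspace Y" "k \<in> carrier H \<times> topspace Y"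
          "snd m = a (fst k) (snd k)" "v \<in> fibre (tot E) (snd k)"
        then show "act E (fst m \<otimes>\<^bsub>H\<^esub> fst k, snd k) v = act E m (act E k v)"
          using r[rule_format, of "fst m" "fst k" "snd k" v] by (cases m, cases k) simp
      qed
    qed
    moreover have "(\<forall>m\<in>carrier H \<times> topspace Y. act E m ` fibre (tot E) (snd m) \<subseteq> fibre (tot E) (a (fst m) (snd m)) \<and>
             clinear_on (fibre (tot E) (snd m)) (act E m)) \<longleftrightarrow>
          (\<forall>h\<in>carrier H. \<forall>y\<in>topspace Y. act E (h, y) ` fibre (tot E) y \<subseteq> fibre (tot E) (a h y) \<and>
             clinear_on (fibre (tot E) y) (act E (h, y)))"
      by simp
    ultimately show ?thesis
      using True unfolding groupoid_bundle_def action_groupoid_def cont[unfolded Z_def, symmetric]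
      by (simp only: tgroupoid.simps topspace_prod_topology TH case_prod_beta simp_thms)
  qed
  have R: "equivariant_vector_bundle H TH Y a (tot E) \<rho> \<longleftrightarrow>
     (\<forall>h\<in>carrier H. \<forall>y\<in>topspace Y. clinear_on (fibre (tot E) y) (act E (h, y))) \<and>
     (\<forall>y\<in>topspace Y. \<forall>v\<in>fibre (tot E) y. act E (\<one>\<^bsub>H\<^esub>, y) v = v) \<and>
     (\<forall>h\<in>carrier H. \<forall>k\<in>carrier H. \<forall>y\<in>topspace Y. \<forall>v\<in>fibre (tot E) y.
        act E (h \<otimes>\<^bsub>H\<^esub> k, y) v = act E (h, a k y) (act E (k, y) v)) \<and>
     continuous_map (prod_topology TH (tot E)) (tot E) (\<lambda>(h, e). \<rho> h e)"
  proof -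
    have all: "(\<forall>e\<in>topspace (tot E). P e) \<longleftrightarrow> (\<forall>y\<in>topspace Y. \<forall>v\<in>fibre (tot E) y. P (y, v))" for P
      using sub by (force simp: fibre_def)
    have "(\<forall>h\<in>carrier H. \<forall>k\<in>carrier H. \<forall>e\<in>topspace (tot E). \<rho> (h \<otimes>\<^bsub>H\<^esub> k) e = \<rho> h (\<rho> k e)) \<longleftrightarrow>
          (\<forall>h\<in>carrier H. \<forall>k\<in>carrier H. \<forall>y\<in>topspace Y. \<forall>v\<in>fibre (tot E) y.
             act E (h \<otimes>\<^bsub>H\<^esub> k, y) v = act E (h, a k y) (act E (k, y) v))"
      unfolding all by (simp add: \<rho>_def mult)
    moreover have "(\<forall>e\<in>topspace (tot E). \<rho> \<one>\<^bsub>H\<^esub> e = e) \<longleftrightarrow>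
          (\<forall>y\<in>topspace Y. \<forall>v\<in>fibre (tot E) y. act E (\<one>\<^bsub>H\<^esub>, y) v = v)"
      unfolding all by (simp add: \<rho>_def one)
    moreover have "fst (\<rho> h e) = a h (fst e)" "(\<lambda>v. snd (\<rho> h (y, v))) = act E (h, y)" for h e y
      by (auto simp: \<rho>_def case_prod_beta)
    ultimately show ?thesis
      using True unfolding equivariant_vector_bundle_def by simp blast
  qed
  have "act E (h, y) v \<in> fibre (tot E) (a h y)"
    if "continuous_map (prod_topology TH (tot E)) (tot E) (\<lambda>(h, e). \<rho> h e)"
      "h \<in> carrier H" "v \<in> fibre (tot E) y" for h y v
    using continuous_map_image_subset_topspace[OF that(1)] that(2,3) TH
    by (force simp: fibre_def \<rho>_def)
  then show ?thesis
    unfolding L R[unfolded \<rho>_def] unfolding \<rho>_def by blast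
qed


section \<open>Quasi-elliptic cohomology\<close>

definition real_group :: "real monoid" where
  "real_group = \<lparr>carrier = UNIV, monoid.mult = (+), one = 0\<rparr>"

definition centralizer_group :: "('g, 'b) monoid_scheme \<Rightarrow> 'g \<Rightarrow> ('g, 'b) monoid_scheme" where
  "centralizer_group G g = G\<lparr>carrier := {h \<in> carrier G. h \<otimes>\<^bsub>G\<^esub> g = g \<otimes>\<^bsub>G\<^esub> h}\<rparr>"

definition Lambda_sub :: "('g, 'b) monoid_scheme \<Rightarrow> 'g \<Rightarrow> ('g \<times> real) set" where
  "Lambda_sub G g = generate (centralizer_group G g \<times>\<times> real_group) {(g, -1)}"

definition Lambda_group :: "('g, 'b) monoid_scheme \<Rightarrow> 'g \<Rightarrow> ('g \<times> real) set monoid" where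
  "Lambda_group G g = (centralizer_group G g \<times>\<times> real_group) Mod Lambda_sub G g"

definition Lambda_top :: "('g, 'b) monoid_scheme \<Rightarrow> 'g topology \<Rightarrow> 'g \<Rightarrow> ('g \<times> real) set topology" where
  "Lambda_top G TG g =
     quotient_topology
       (prod_topology (subtopology TG (carrier (centralizer_group G g))) euclideanreal)
       (\<lambda>p. Lambda_sub G g #>\<^bsub>centralizer_group G g \<times>\<times> real_group\<^esub> p)"

text \<open>\<open>[\<sigma>, t] \<cdot> x = \<sigma> \<cdot> x\<close>. On points fixed by \<open>g\<close> this does not depend on the representative,
  since \<open>\<sigma>\<close> is determined by its class up to a power of \<open>g\<close> on the right. The second component
  may be a real number or an element of \<open>\<real>/l\<int>\<close>.\<close>

definition class_act :: "('g \<Rightarrow> 'x \<Rightarrow> 'x) \<Rightarrow> ('g \<times> 't) set \<Rightarrow> 'x \<Rightarrow> 'x" where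
  "class_act \<phi> A x = \<phi> (fst (SOME p. p \<in> A)) x"

abbreviation Lambda_action_groupoid :: "('g, 'b) monoid_scheme \<Rightarrow> 'g topology \<Rightarrow> 'x topology \<Rightarrow>
    ('g \<Rightarrow> 'x \<Rightarrow> 'x) \<Rightarrow> 'g \<Rightarrow> ('x, ('g \<times> real) set \<times> 'x) tgroupoid" where
  "Lambda_action_groupoid G TG TX \<phi> g \<equiv>
     action_groupoid (Lambda_group G g) (Lambda_top G TG g)
       (subtopology TX (fixed_points TX \<phi> g)) (class_act \<phi>)"

abbreviation K_Lambda where
  "K_Lambda n G TG TX \<phi> g \<equiv>
     K_equiv n (Lambda_group G g) (Lambda_top G TG g)
       (subtopology TX (fixed_points TX \<phi> g)) (class_act \<phi>)"

definition transporter :: "('g, 'b) monoid_scheme \<Rightarrow> 'g \<Rightarrow> 'g \<Rightarrow> 'g set" where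
  "transporter G g g' = {\<sigma> \<in> carrier G. g' \<otimes>\<^bsub>G\<^esub> \<sigma> = \<sigma> \<otimes>\<^bsub>G\<^esub> g}"

text \<open>The coset \<open>t + l\<int>\<close>, and \<open>\<real>/l\<int>\<close> with its quotient topology.\<close>

definition circle_coset :: "nat \<Rightarrow> real \<Rightarrow> real set" where
  "circle_coset l t = {t + of_int k * of_nat l | k::int. True}"

definition circle_top :: "nat \<Rightarrow> real set topology" where
  "circle_top l = quotient_topology euclideanreal (circle_coset l)"

text \<open>The class of \<open>(\<sigma>, T)\<close>, with \<open>T \<in> \<real>/l\<int>\<close>, under the equivalence relation generated by
  \<open>(\<sigma>, T) \<sim> (\<sigma> g, T - 1)\<close>.\<close>

definition Lambda_class :: "('g, 'b) monoid_scheme \<Rightarrow> 'g \<Rightarrow> 'g \<times> real set \<Rightarrow> ('g \<times> real set) set" where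
  "Lambda_class G g = (\<lambda>(\<sigma>, T). {(\<sigma> \<otimes>\<^bsub>G\<^esub> g [^]\<^bsub>G\<^esub> k, (\<lambda>t. t - of_int k) ` T) | k::int. True})"

definition Lambda_mor_top :: "('g, 'b) monoid_scheme \<Rightarrow> 'g topology \<Rightarrow> 'g \<Rightarrow> 'g \<Rightarrow>
    ('g \<times> real set) set topology" where
  "Lambda_mor_top G TG g g' =
     quotient_topology
       (prod_topology (subtopology TG (transporter G g g')) (circle_top (group.ord G g)))
       (Lambda_class G g)"

text \<open>The composition \<open>[\<sigma>\<^sub>1, t\<^sub>1] [\<sigma>\<^sub>2, t\<^sub>2] = [\<sigma>\<^sub>1 \<sigma>\<^sub>2, t\<^sub>1 + t\<^sub>2]\<close>: for composable classes the set
  of all products of representatives is exactly one class.\<close>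

definition Lambda_comp :: "('g, 'b) monoid_scheme \<Rightarrow>
    ('g \<times> real set) set \<Rightarrow> ('g \<times> real set) set \<Rightarrow> ('g \<times> real set) set" where
  "Lambda_comp G A B =
     (\<lambda>((\<sigma>, S), (\<tau>, T)). (\<sigma> \<otimes>\<^bsub>G\<^esub> \<tau>, (\<lambda>(s, t). s + t) ` (S \<times> T))) ` (A \<times> B)"

definition Lambda_groupoid :: "('g, 'b) monoid_scheme \<Rightarrow> 'g topology \<Rightarrow> 'x topology \<Rightarrow>
    ('g \<Rightarrow> 'x \<Rightarrow> 'x) \<Rightarrow> ('g \<times> 'x, ('g \<times> 'g) \<times> (('g \<times> real set) set \<times> 'x)) tgroupoid" where
  "Lambda_groupoid G TG TX \<phi> =
     \<lparr>Ob = sum_topology (\<lambda>g. subtopology TX (fixed_points TX \<phi> g)) (tors G),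
      Mor = sum_topology
        (\<lambda>(g, g'). prod_topology (Lambda_mor_top G TG g g') (subtopology TX (fixed_points TX \<phi> g)))
        (tors G \<times> tors G),
      src = (\<lambda>((g, g'), (A, x)). (g, x)),
      tgt = (\<lambda>((g, g'), (A, x)). (g', class_act \<phi> A x)),
      cmp = (\<lambda>((g1, g2), (A, y)) ((g0, g1'), (B, x)). ((g0, g2), (Lambda_comp G A B, x))),
      idm = (\<lambda>(g, x). ((g, g), (Lambda_class G g (\<one>\<^bsub>G\<^esub>, circle_coset (group.ord G g) 0), x)))\<rparr>"

abbreviation QEll where
  "QEll n G TG TX \<phi> \<equiv> K_orb n (Lambda_groupoid G TG TX \<phi>)"

text \<open>The inclusion of \<open>X\<^sup>g // \<Lambda>\<^sub>G(g)\<close> into \<open>\<Lambda>(X // G)\<close>, which sends \<open>x\<close> to \<open>x \<in> X\<^sup>g\<close> and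
  \<open>[h, t] \<in> \<Lambda>\<^sub>G(g)\<close> to \<open>[h, t] \<in> \<Lambda>\<^sub>G(g, g)\<close>.\<close>

definition component_functor :: "('g, 'b) monoid_scheme \<Rightarrow> 'g \<Rightarrow>
    ('x, ('g \<times> real) set \<times> 'x, 'g \<times> 'x, ('g \<times> 'g) \<times> (('g \<times> real set) set \<times> 'x)) gfunctor" where
  "component_functor G g =
     ((\<lambda>x. (g, x)),
      (\<lambda>(A, x). ((g, g), ((\<lambda>(h, t). (h, circle_coset (group.ord G g) t)) ` A, x))))"

definition QEll_restrict where
  "QEll_restrict n G TG TX \<phi> g =
     K_orb_map n (Lambda_action_groupoid G TG TX \<phi> g) (component_functor G g)"

text \<open>The functor from \<open>X\<^sup>g // \<Lambda>\<^sub>G(g)\<close> to \<open>X\<^sup>h\<^sup>g\<^sup>h\<^sup>' // \<Lambda>\<^sub>G(hgh')\<close>, where \<open>h'\<close> is the inverse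
  of \<open>h\<close>, given by \<open>x \<mapsto> hx\<close> and \<open>[u, t] \<mapsto> [huh', t]\<close>.\<close>

definition conj_functor :: "('g, 'b) monoid_scheme \<Rightarrow> ('g \<Rightarrow> 'x \<Rightarrow> 'x) \<Rightarrow> 'g \<Rightarrow>
    ('x, ('g \<times> real) set \<times> 'x, 'x, ('g \<times> real) set \<times> 'x) gfunctor" where
  "conj_functor G \<phi> h =
     (\<phi> h, (\<lambda>(A, x). ((\<lambda>(u, t). (conj_by G h u, t)) ` A, \<phi> h x)))"

text \<open>The left action of \<open>h\<close> on a family \<open>\<xi>\<close>: its component at \<open>k\<close> is the pullback of the component
  of \<open>\<xi>\<close> at \<open>h'kh\<close> along conjugation by \<open>h'\<close>, the inverse of \<open>h\<close>.\<close>

definition K_family_act where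
  "K_family_act n G TG TX \<phi> h \<xi> =
     (\<lambda>k\<in>tors G. K_orb_map n (Lambda_action_groupoid G TG TX \<phi> k) (conj_functor G \<phi> (inv\<^bsub>G\<^esub> h))
        (\<xi> (conj_by G (inv\<^bsub>G\<^esub> h) k)))"

definition K_invariants where
  "K_invariants n G TG TX \<phi> =
     (let P = product_group (tors G) (K_Lambda n G TG TX \<phi>) in
      P\<lparr>carrier := {\<xi> \<in> carrier P. \<forall>h\<in>carrier G. K_family_act n G TG TX \<phi> h \<xi> = \<xi>}\<rparr>)"

end

theory Submission
  imports Defs
begin

text \<open>Choose for every torsion element \<open>g\<close> an element \<open>h\<^sub>g\<close> conjugating it to its representative
  \<open>r\<close>. Sending \<open>x \<in> X\<^sup>g\<close> to \<open>h\<^sub>g x\<close> and \<open>[\<sigma>, t] \<in> \<Lambda>\<^sub>G(g, k)\<close> to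
  \<open>[h\<^sub>k \<sigma> h\<^sub>g\<inverse>, t]\<close> retracts the part of \<open>\<Lambda>(X // G)\<close> over the conjugacy
  class of \<open>r\<close> onto \<open>X\<^sup>r // \<Lambda>\<^sub>G(r)\<close>; the arrows \<open>[h\<^sub>g, 0]\<close> make this an equivalence. The
  choices are compatible with the topology because the object space is a coproduct over \<open>g\<close>.
  Equivalent groupoids have the same K-theory, and K-theory turns a decomposition into open and
  closed pieces into a product, since bundles, isomorphisms and stabilising summands can be
  glued. Both facts are natural, hence pass to the kernels that define the groups in each degree.

  The arrows \<open>[h\<inverse>, 0]\<close> also identify the restriction to \<open>X\<^sup>k\<close> with the pullback along
  conjugation by \<open>h\<close> of the restriction to the fixed points of the conjugate of \<open>k\<close>, so restricted
  families are invariant.\<close>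

section \<open>Fibrewise maps and local trivialisations\<close>

text \<open>Two features of the definitions shape the argument. The total space of a bundle carries
  a topology of its own, so sums, pullbacks and glued bundles are handled through the continuous
  maps into and out of their total spaces. Because fibres are sets of complex sequences over given
  base points, pullback is strictly compatible with composition and with direct sums, and equalities
  of bundles replace coherence isomorphisms. On the other side, morphism spaces are products of
  quotients with fixed point spaces. A product of a quotient map with an identity need not be a
  quotient map; openness of the quotient maps, which comes from the shifts
  \<open>(\<sigma>, t) \<mapsto> (\<sigma> g\<^sup>k, t - k)\<close>, makes the target map
  continuous. The same shifts reconcile the two models of an arrow: in
  \<open>\<Lambda>\<^sub>G(g)\<close> the parameter is real, in
  \<open>\<Lambda>\<^sub>G(g, g')\<close> it is taken modulo the order \<open>l\<close> of
  \<open>g\<close>, but \<open>(\<sigma>, t)\<close> is already equivalent to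
  \<open>(\<sigma> g\<^sup>l, t - l) = (\<sigma>, t - l)\<close>.\<close>

lemma continuous_map_compose_eq:
  assumes "continuous_map X Y f" "continuous_map Y Z g" "\<And>x. x \<in> topspace X \<Longrightarrow> g (f x) = h x"
  shows "continuous_map X Z h"
  by (rule continuous_map_eq[OF continuous_map_compose[OF assms(1,2)]]) (simp add: assms(3))

lemma continuous_map_mem:
  "continuous_map X Y f \<Longrightarrow> x \<in> topspace X \<Longrightarrow> f x \<in> topspace Y"
  using continuous_map_image_subset_topspace by blast

text \<open>Two constructions of the same total space are compared in this way: the universal
  property of each side makes the identity map into it continuous.\<close>

lemma topology_eq_via_id:
  assumes 1: "continuous_map S T (\<lambda>x. x)" and 2: "continuous_map T S (\<lambda>x. x)"
  shows "S = T"
proof -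
  have "topspace S = topspace T"
    using continuous_map_mem[OF 1] continuous_map_mem[OF 2] by blast
  moreover have "openin S U" if "openin T U" for U
    using openin_continuous_map_preimage[OF 1 that] openin_subset[OF that] calculation
    by (metis (no_types, lifting) Collect_cong Collect_mem_eq subsetD)
  moreover have "openin T U" if "openin S U" for U
    using openin_continuous_map_preimage[OF 2 that] openin_subset[OF that] calculation
    by (metis (no_types, lifting) Collect_cong Collect_mem_eq subsetD)
  ultimately show ?thesis
    by (auto simp: topology_eq)
qed

lemma mem_fibre_iff: "v \<in> fibre E x \<longleftrightarrow> (x, v) \<in> topspace E"
  by (simp add: fibre_def)

text \<open>The inverse lies over the identity of the base because the map itself does, so it is
  again given by a family \<open>f'\<close> of maps between fibres.\<close>

lemma fibrewise_homeomorphic_mapE: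
  assumes "homeomorphic_map S T (\<lambda>(x, v). (x, f x v))"
  obtains f' where "continuous_map S T (\<lambda>(x, v). (x, f x v))"
    "continuous_map T S (\<lambda>(x, w). (x, f' x w))"
    "\<And>x v. (x, v) \<in> topspace S \<Longrightarrow> f' x (f x v) = v"
    "\<And>x w. (x, w) \<in> topspace T \<Longrightarrow> f x (f' x w) = w"
proof -
  obtain g where g: "homeomorphic_maps S T (\<lambda>(x, v). (x, f x v)) g"
    using assms homeomorphic_map_maps by blast
  define f' where "f' = (\<lambda>x w. snd (g (x, w)))"
  have gi: "(case g e of (x, v) \<Rightarrow> (x, f x v)) = e" if "e \<in> topspace T" for e
    using g that by (simp add: homeomorphic_maps_def)
  have "fst (g e) = fst e" if "e \<in> topspace T" for e
    using gi[OF that] by (cases "g e") auto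
  then have eq: "g (x, w) = (x, f' x w)" if "(x, w) \<in> topspace T" for x w
    using that by (simp add: f'_def prod_eq_iff)
  show thesis
  proof
    show "continuous_map S T (\<lambda>(x, v). (x, f x v))"
      using g by (simp add: homeomorphic_maps_def)
    show "continuous_map T S (\<lambda>(x, w). (x, f' x w))"
      using g eq by (auto simp: homeomorphic_maps_def intro: continuous_map_eq)
    show "f' x (f x v) = v" if "(x, v) \<in> topspace S" for x v
      using g that by (auto simp: homeomorphic_maps_def f'_def)
    show "f x (f' x w) = w" if "(x, w) \<in> topspace T" for x w
      using gi[OF that] eq[OF that] by simp
  qed
qed

lemma fibrewise_homeomorphic_mapI:
  assumes "continuous_map S T (\<lambda>(x, v). (x, f x v))"
    "continuous_map T S (\<lambda>(x, w). (x, f' x w))"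
    "\<And>x v. (x, v) \<in> topspace S \<Longrightarrow> f' x (f x v) = v"
    "\<And>x w. (x, w) \<in> topspace T \<Longrightarrow> f x (f' x w) = w"
  shows "homeomorphic_map S T (\<lambda>(x, v). (x, f x v))"
proof -
  have "homeomorphic_maps S T (\<lambda>(x, v). (x, f x v)) (\<lambda>(x, w). (x, f' x w))"
    using assms by (auto simp: homeomorphic_maps_def)
  then show ?thesis
    using homeomorphic_map_maps by blast
qed

text \<open>The inverse is recorded as a second family \<open>f'\<close>. In the forward direction
  only the vector component has to be continuous, since the base component is the bundle
  projection.\<close>

definition local_triv :: "'o topology \<Rightarrow> ('o \<times> cseq) topology \<Rightarrow> 'o set \<Rightarrow> nat \<Rightarrow>
    ('o \<Rightarrow> cseq \<Rightarrow> cseq) \<Rightarrow> ('o \<Rightarrow> cseq \<Rightarrow> cseq) \<Rightarrow> bool" where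
  "local_triv B E U n f f' \<longleftrightarrow>
     (\<forall>y\<in>U. clinear_on (fibre E y) (f y) \<and>
        (\<forall>v\<in>fibre E y. f y v \<in> Cn n \<and> f' y (f y v) = v) \<and>
        (\<forall>w\<in>Cn n. f' y w \<in> fibre E y \<and> f y (f' y w) = w)) \<and>
     continuous_map (subtopology E {e. fst e \<in> U}) euclidean (\<lambda>(y, v). f y v) \<and>
     continuous_map (prod_topology (subtopology B U) (top_of_set (Cn n))) E (\<lambda>(y, w). (y, f' y w))"

text \<open>Replaces the homeomorphism in the definition by two continuity statements, the form in
  which trivialisations are added, pulled back and glued.\<close>

lemma vector_bundle_iff:
  "vector_bundle B E \<longleftrightarrow> continuous_map E B fst \<and> (\<forall>x\<in>topspace B. csubspace (fibre E x)) \<and>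
     (\<forall>x\<in>topspace B. \<exists>U n f f'. openin B U \<and> x \<in> U \<and> local_triv B E U n f f')"
proof -
  define P where "P U n f \<longleftrightarrow> (\<forall>y\<in>U. clinear_on (fibre E y) (f y)) \<and>
        homeomorphic_map (subtopology E {e. fst e \<in> U})
          (prod_topology (subtopology B U) (top_of_set (Cn n))) (\<lambda>(y, v). (y, f y v))" for U n f
  have eq: "(\<exists>f. P U n f) \<longleftrightarrow> (\<exists>f f'. local_triv B E U n f f')" (is "?L \<longleftrightarrow> ?R")
    if fst: "continuous_map E B fst" and U: "openin B U" for U n
  proof
    have UB: "U \<subseteq> topspace B"
      by (rule openin_subset[OF U])
    {
      assume ?L
      then obtain f where lin: "\<forall>y\<in>U. clinear_on (fibre E y) (f y)"
        and h: "homeomorphic_map (subtopology E {e. fst e \<in> U})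
          (prod_topology (subtopology B U) (top_of_set (Cn n))) (\<lambda>(y, v). (y, f y v))"
        unfolding P_def by blast
      obtain f' where f': "continuous_map (subtopology E {e. fst e \<in> U})
          (prod_topology (subtopology B U) (top_of_set (Cn n))) (\<lambda>(x, v). (x, f x v))"
        "continuous_map (prod_topology (subtopology B U) (top_of_set (Cn n)))
          (subtopology E {e. fst e \<in> U}) (\<lambda>(x, w). (x, f' x w))"
        "\<And>x v. (x, v) \<in> topspace (subtopology E {e. fst e \<in> U}) \<Longrightarrow> f' x (f x v) = v"
        "\<And>x w. (x, w) \<in> topspace (prod_topology (subtopology B U) (top_of_set (Cn n))) \<Longrightarrow> f x (f' x w) = w"
        by (rule fibrewise_homeomorphic_mapE[OF h]) (rule that)
      have "local_triv B E U n f f'"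
        unfolding local_triv_def
      proof (intro conjI ballI)
        fix y assume y: "y \<in> U"
        show "clinear_on (fibre E y) (f y)" using lin y by blast
        show "f y v \<in> Cn n" if "v \<in> fibre E y" for v
          using continuous_map_mem[OF f'(1), of "(y, v)"] that y by (simp add: mem_fibre_iff)
        show "f' y (f y v) = v" if "v \<in> fibre E y" for v
          using f'(3) that y by (simp add: mem_fibre_iff)
        show "f' y w \<in> fibre E y" "f y (f' y w) = w" if "w \<in> Cn n" for w
          using continuous_map_mem[OF f'(2), of "(y, w)"] f'(4) that y UB
          by (auto simp: mem_fibre_iff)
      next
        show "continuous_map (subtopology E {e. fst e \<in> U}) euclidean (\<lambda>(y, v). f y v)"
          by (rule continuous_map_into_fulltopology, rule continuous_map_compose_eq[OF f'(1) continuous_map_snd])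
            auto
        show "continuous_map (prod_topology (subtopology B U) (top_of_set (Cn n))) E (\<lambda>(y, w). (y, f' y w))"
          using f'(2) by (rule continuous_map_into_fulltopology)
      qed
      then show ?R by blast
    next
      assume ?R
      then obtain f f' where t: "local_triv B E U n f f'" by blast
      have "homeomorphic_map (subtopology E {e. fst e \<in> U})
          (prod_topology (subtopology B U) (top_of_set (Cn n))) (\<lambda>(y, v). (y, f y v))"
      proof (rule fibrewise_homeomorphic_mapI)
        show "continuous_map (subtopology E {e. fst e \<in> U})
          (prod_topology (subtopology B U) (top_of_set (Cn n))) (\<lambda>(y, v). (y, f y v))"
          using t fst
          by (auto simp: local_triv_def continuous_map_pairwise continuous_map_in_subtopology o_def
              case_prod_unfold mem_fibre_iff intro: continuous_map_from_subtopology)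
        show "continuous_map (prod_topology (subtopology B U) (top_of_set (Cn n)))
          (subtopology E {e. fst e \<in> U}) (\<lambda>(x, w). (x, f' x w))"
          using t by (auto simp: local_triv_def continuous_map_in_subtopology)
      qed (use t in \<open>auto simp: local_triv_def mem_fibre_iff\<close>)
      then show ?L
        using t by (auto simp: local_triv_def P_def)
    }
  qed
  have "(\<exists>U n f. openin B U \<and> x \<in> U \<and> P U n f) \<longleftrightarrow>
      (\<exists>U n f f'. openin B U \<and> x \<in> U \<and> local_triv B E U n f f')" if "continuous_map E B fst" for x
    using eq[OF that] by metis
  then show ?thesis
    unfolding vector_bundle_def P_def[symmetric] by auto
qed

section \<open>Isomorphisms of bundles\<close>

lemma groupoid_bundleD:
  assumes "groupoid_bundle \<G> E"
  shows "vector_bundle (Ob \<G>) (tot E)"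
    and "continuous_map (tot E) (Ob \<G>) fst"
    and "\<And>x v. v \<in> fibre (tot E) x \<Longrightarrow> x \<in> topspace (Ob \<G>)"
    and "\<And>m v. m \<in> topspace (Mor \<G>) \<Longrightarrow> v \<in> fibre (tot E) (src \<G> m) \<Longrightarrow>
      act E m v \<in> fibre (tot E) (tgt \<G> m)"
    and "\<And>m. m \<in> topspace (Mor \<G>) \<Longrightarrow> clinear_on (fibre (tot E) (src \<G> m)) (act E m)"
    and "\<And>x v. v \<in> fibre (tot E) x \<Longrightarrow> act E (idm \<G> x) v = v"
    and "\<And>m k v. m \<in> topspace (Mor \<G>) \<Longrightarrow> k \<in> topspace (Mor \<G>) \<Longrightarrow> src \<G> m = tgt \<G> k \<Longrightarrow>
      v \<in> fibre (tot E) (src \<G> k) \<Longrightarrow> act E (cmp \<G> m k) v = act E m (act E k v)"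
proof -
  show 1: "vector_bundle (Ob \<G>) (tot E)" and 2: "continuous_map (tot E) (Ob \<G>) fst"
    using assms by (auto simp: groupoid_bundle_def vector_bundle_def)
  show 3: "x \<in> topspace (Ob \<G>)" if "v \<in> fibre (tot E) x" for x v
    using continuous_map_mem[OF 2] that by (force simp: mem_fibre_iff)
  show "act E m v \<in> fibre (tot E) (tgt \<G> m)"
    if "m \<in> topspace (Mor \<G>)" "v \<in> fibre (tot E) (src \<G> m)" for m v
    using assms that by (auto simp: groupoid_bundle_def)
  show "clinear_on (fibre (tot E) (src \<G> m)) (act E m)" if "m \<in> topspace (Mor \<G>)" for m
    using assms that by (auto simp: groupoid_bundle_def)
  show "act E (idm \<G> x) v = v" if "v \<in> fibre (tot E) x" for x v
    using assms that 3[OF that] by (auto simp: groupoid_bundle_def)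
  show "act E (cmp \<G> m k) v = act E m (act E k v)"
    if "m \<in> topspace (Mor \<G>)" "k \<in> topspace (Mor \<G>)" "src \<G> m = tgt \<G> k"
      "v \<in> fibre (tot E) (src \<G> k)" for m k v
    using assms that by (auto simp: groupoid_bundle_def)
qed

text \<open>The continuity axiom lives on the fibre product of the morphism space and the total
  space; here it is stated for arbitrary families of matching arrows \<open>a z\<close> and vectors
  \<open>v z\<close> over a parameter space \<open>T\<close>.\<close>

lemma continuous_map_act:
  assumes "groupoid_bundle \<G> E"
    and "continuous_map T (Mor \<G>) a" "continuous_map T (tot E) (\<lambda>z. (b z, v z))"
    and "\<And>z. z \<in> topspace T \<Longrightarrow> src \<G> (a z) = b z"
  shows "continuous_map T (tot E) (\<lambda>z. (tgt \<G> (a z), act E (a z) (v z)))"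
proof -
  have act: "continuous_map (subtopology (prod_topology (Mor \<G>) (tot E)) {(m, e). src \<G> m = fst e})
       (tot E) (\<lambda>(m, e). (tgt \<G> m, act E m (snd e)))"
    using assms(1) by (simp add: groupoid_bundle_def)
  have "continuous_map T
      (subtopology (prod_topology (Mor \<G>) (tot E)) {(m, e). src \<G> m = fst e}) (\<lambda>z. (a z, (b z, v z)))"
    using assms(2-4) by (auto simp: continuous_map_in_subtopology continuous_map_pairwise o_def)
  from continuous_map_compose_eq[OF this act] show ?thesis
    by simp
qed

lemma groupoid_bundleI:
  assumes "vector_bundle (Ob \<G>) (tot E)"
    and "\<And>m v. m \<in> topspace (Mor \<G>) \<Longrightarrow> v \<in> fibre (tot E) (src \<G> m) \<Longrightarrow>
      act E m v \<in> fibre (tot E) (tgt \<G> m)"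
    and "\<And>m. m \<in> topspace (Mor \<G>) \<Longrightarrow> clinear_on (fibre (tot E) (src \<G> m)) (act E m)"
    and "\<And>x v. x \<in> topspace (Ob \<G>) \<Longrightarrow> v \<in> fibre (tot E) x \<Longrightarrow> act E (idm \<G> x) v = v"
    and "\<And>m k v. m \<in> topspace (Mor \<G>) \<Longrightarrow> k \<in> topspace (Mor \<G>) \<Longrightarrow> src \<G> m = tgt \<G> k \<Longrightarrow>
      v \<in> fibre (tot E) (src \<G> k) \<Longrightarrow> act E (cmp \<G> m k) v = act E m (act E k v)"
    and "continuous_map
       (subtopology (prod_topology (Mor \<G>) (tot E)) {(m, e). src \<G> m = fst e})
       (tot E) (\<lambda>(m, e). (tgt \<G> m, act E m (snd e)))"
  shows "groupoid_bundle \<G> E"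
  using assms by (auto simp: groupoid_bundle_def)

text \<open>\<open>gbundle_iso\<close> demands linearity of the forward map only. The subspace
  property keeps sums and multiples of preimages in \<open>V\<close>, where \<open>f'\<close> is
  known to undo \<open>f\<close>.\<close>

lemma clinear_on_inverse:
  assumes V: "csubspace V" and f: "clinear_on V f"
    and 1: "\<And>v. v \<in> V \<Longrightarrow> f' (f v) = v" and 2: "\<And>w. w \<in> W \<Longrightarrow> f' w \<in> V \<and> f (f' w) = w"
  shows "clinear_on W f'"
  unfolding clinear_on_def
proof (intro conjI ballI allI)
  fix u v assume "u \<in> W" "v \<in> W"
  then have uv: "f' u \<in> V" "f' v \<in> V" "f (f' u) = u" "f (f' v) = v"
    using 2 by auto
  have "(\<lambda>i. f' u i + f' v i) \<in> V"
    using V uv by (auto simp: csubspace_def)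
  moreover have "f (\<lambda>i. f' u i + f' v i) = (\<lambda>i. u i + v i)"
    using f uv by (simp add: clinear_on_def)
  ultimately show "f' (\<lambda>i. u i + v i) = (\<lambda>i. f' u i + f' v i)"
    using 1 by metis
next
  fix a v assume "v \<in> W"
  then have v: "f' v \<in> V" "f (f' v) = v"
    using 2 by auto
  have "(\<lambda>i. a * f' v i) \<in> V"
    using V v by (auto simp: csubspace_def)
  moreover have "f (\<lambda>i. a * f' v i) = (\<lambda>i. a * v i)"
    using f v by (simp add: clinear_on_def)
  ultimately show "f' (\<lambda>i. a * v i) = (\<lambda>i. a * f' v i)"
    using 1 by metis
qed

lemma gbundle_isoI:
  assumes "continuous_map (tot E) (tot F) (\<lambda>(x, v). (x, f x v))"
    and "continuous_map (tot F) (tot E) (\<lambda>(x, w). (x, f' x w))"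
    and "\<And>x v. v \<in> fibre (tot E) x \<Longrightarrow> f' x (f x v) = v"
    and "\<And>x w. w \<in> fibre (tot F) x \<Longrightarrow> f x (f' x w) = w"
    and "\<And>x. x \<in> topspace (Ob \<G>) \<Longrightarrow> clinear_on (fibre (tot E) x) (f x)"
    and "\<And>m v. m \<in> topspace (Mor \<G>) \<Longrightarrow> v \<in> fibre (tot E) (src \<G> m) \<Longrightarrow>
      f (tgt \<G> m) (act E m v) = act F m (f (src \<G> m) v)"
  shows "gbundle_iso \<G> E F"
  unfolding gbundle_iso_def
  using assms fibrewise_homeomorphic_mapI[of "tot E" "tot F" f f'] by (auto simp: mem_fibre_iff)

text \<open>Exposes the witness of \<open>gbundle_iso\<close> together with its inverse, so that
  witnesses can be chosen simultaneously over an index set and glued.\<close>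

definition gbundle_iso_via :: "('o, 'm) tgroupoid \<Rightarrow> ('o, 'm) gbundle \<Rightarrow> ('o, 'm) gbundle \<Rightarrow>
    ('o \<Rightarrow> cseq \<Rightarrow> cseq) \<Rightarrow> ('o \<Rightarrow> cseq \<Rightarrow> cseq) \<Rightarrow> bool" where
  "gbundle_iso_via \<G> E F f f' \<longleftrightarrow>
     continuous_map (tot E) (tot F) (\<lambda>(x, v). (x, f x v)) \<and>
     continuous_map (tot F) (tot E) (\<lambda>(x, w). (x, f' x w)) \<and>
     (\<forall>x. \<forall>v\<in>fibre (tot E) x. f x v \<in> fibre (tot F) x \<and> f' x (f x v) = v) \<and>
     (\<forall>x. \<forall>w\<in>fibre (tot F) x. f' x w \<in> fibre (tot E) x \<and> f x (f' x w) = w) \<and>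
     (\<forall>x\<in>topspace (Ob \<G>). clinear_on (fibre (tot E) x) (f x)) \<and>
     (\<forall>m\<in>topspace (Mor \<G>). \<forall>v\<in>fibre (tot E) (src \<G> m).
        f (tgt \<G> m) (act E m v) = act F m (f (src \<G> m) v))"

lemma gbundle_iso_viaD:
  assumes "gbundle_iso_via \<G> E F f f'"
  shows "continuous_map (tot E) (tot F) (\<lambda>(x, v). (x, f x v))"
    and "continuous_map (tot F) (tot E) (\<lambda>(x, w). (x, f' x w))"
    and "\<And>x v. v \<in> fibre (tot E) x \<Longrightarrow> f x v \<in> fibre (tot F) x \<and> f' x (f x v) = v"
    and "\<And>x w. w \<in> fibre (tot F) x \<Longrightarrow> f' x w \<in> fibre (tot E) x \<and> f x (f' x w) = w"
    and "\<And>x. x \<in> topspace (Ob \<G>) \<Longrightarrow> clinear_on (fibre (tot E) x) (f x)"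
    and "\<And>m v. m \<in> topspace (Mor \<G>) \<Longrightarrow> v \<in> fibre (tot E) (src \<G> m) \<Longrightarrow>
      f (tgt \<G> m) (act E m v) = act F m (f (src \<G> m) v)"
  using assms unfolding gbundle_iso_via_def by blast+

lemma gbundle_isoE:
  assumes "gbundle_iso \<G> E F"
  obtains f f' where "gbundle_iso_via \<G> E F f f'"
proof -
  from assms obtain f where h: "homeomorphic_map (tot E) (tot F) (\<lambda>(x, v). (x, f x v))"
    and f: "\<forall>x\<in>topspace (Ob \<G>). clinear_on (fibre (tot E) x) (f x)"
      "\<forall>m\<in>topspace (Mor \<G>). \<forall>v\<in>fibre (tot E) (src \<G> m).
        f (tgt \<G> m) (act E m v) = act F m (f (src \<G> m) v)"
    by (auto simp: gbundle_iso_def)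
  obtain f' where f': "continuous_map (tot E) (tot F) (\<lambda>(x, v). (x, f x v))"
    "continuous_map (tot F) (tot E) (\<lambda>(x, w). (x, f' x w))"
    "\<And>x v. (x, v) \<in> topspace (tot E) \<Longrightarrow> f' x (f x v) = v"
    "\<And>x w. (x, w) \<in> topspace (tot F) \<Longrightarrow> f x (f' x w) = w"
    by (rule fibrewise_homeomorphic_mapE[OF h]) (rule that)
  have "gbundle_iso_via \<G> E F f f'"
    unfolding gbundle_iso_via_def
    by (intro conjI f f'(1,2))
      (use f' continuous_map_mem[OF f'(1)] continuous_map_mem[OF f'(2)] in \<open>force simp: mem_fibre_iff\<close>)+
  then show thesis
    by (rule that)
qed

lemma gbundle_iso_refl: "gbundle_iso \<G> E E"
  by (rule gbundle_isoI[where f = "\<lambda>x v. v" and f' = "\<lambda>x v. v"]) (auto simp: clinear_on_def)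

lemma gbundle_iso_sym:
  assumes "groupoid_bundle \<G> E" "groupoid_bundle \<G> F" "gbundle_iso \<G> E F"
  shows "gbundle_iso \<G> F E"
  using assms(3)
proof (rule gbundle_isoE)
  fix f f' assume "gbundle_iso_via \<G> E F f f'"
  note f = gbundle_iso_viaD[OF this]
  show ?thesis
  proof (rule gbundle_isoI[OF f(2,1)])
    show "clinear_on (fibre (tot F) x) (f' x)" if "x \<in> topspace (Ob \<G>)" for x
      by (rule clinear_on_inverse[of "fibre (tot E) x" "f x"])
        (use f that groupoid_bundleD(1)[OF assms(1)] in \<open>auto simp: vector_bundle_def\<close>)
    fix m v assume m: "m \<in> topspace (Mor \<G>)" "v \<in> fibre (tot F) (src \<G> m)"
    have v: "f' (src \<G> m) v \<in> fibre (tot E) (src \<G> m)" "f (src \<G> m) (f' (src \<G> m) v) = v"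
      using f(4) m by auto
    show "f' (tgt \<G> m) (act F m v) = act E m (f' (src \<G> m) v)"
      using f(6)[OF m(1) v(1)] v(2) f(3)[OF groupoid_bundleD(4)[OF assms(1) m(1) v(1)]] by metis
  qed (use f in auto)
qed

lemma gbundle_iso_trans:
  assumes "gbundle_iso \<G> E F" "gbundle_iso \<G> F H"
    and "\<And>m v. m \<in> topspace (Mor \<G>) \<Longrightarrow> v \<in> fibre (tot E) (src \<G> m) \<Longrightarrow>
      act E m v \<in> fibre (tot E) (tgt \<G> m)"
  shows "gbundle_iso \<G> E H"
  using assms(1)
proof (rule gbundle_isoE)
  fix f f' assume "gbundle_iso_via \<G> E F f f'"
  note f = gbundle_iso_viaD[OF this]
  show ?thesis
    using assms(2)
  proof (rule gbundle_isoE)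
    fix g g' assume "gbundle_iso_via \<G> F H g g'"
    note g = gbundle_iso_viaD[OF this]
    show ?thesis
    proof (rule gbundle_isoI)
      show "continuous_map (tot E) (tot H) (\<lambda>(x, v). (x, g x (f x v)))"
        by (rule continuous_map_compose_eq[OF f(1) g(1)]) auto
      show "continuous_map (tot H) (tot E) (\<lambda>(x, v). (x, f' x (g' x v)))"
        by (rule continuous_map_compose_eq[OF g(2) f(2)]) auto
      show "clinear_on (fibre (tot E) x) (\<lambda>v. g x (f x v))" if "x \<in> topspace (Ob \<G>)" for x
        using f(3) f(5)[OF that] g(5)[OF that] by (auto simp: clinear_on_def)
    qed (use f g assms(3) in auto)
  qed
qed

text \<open>The field \<open>act\<close> is a total function, so bundles that are mathematically
  equal may differ as records at arguments that are not morphisms. They are still isomorphic through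
  the identity on fibres.\<close>

lemma gbundle_iso_same_tot:
  assumes "groupoid_bundle \<G> E" "tot F = tot E"
    and "\<And>m v. m \<in> topspace (Mor \<G>) \<Longrightarrow> v \<in> fibre (tot E) (src \<G> m) \<Longrightarrow> act F m v = act E m v"
  shows "gbundle_iso \<G> E F"
  by (rule gbundle_isoI[where f = "\<lambda>x v. v" and f' = "\<lambda>x v. v"])
    (use assms in \<open>auto simp: clinear_on_def\<close>)

section \<open>Direct sums\<close>

lemma evens_interleave [simp]: "evens (interleave v w) = v"
  and odds_interleave [simp]: "odds (interleave v w) = w"
  and interleave_evens_odds [simp]: "interleave (evens u) (odds u) = u"
  by (auto simp: evens_def odds_def interleave_def elim!: evenE oddE)

lemma evens_odds_linear:
  "evens (\<lambda>i. u i + v i) = (\<lambda>i. evens u i + evens v i)" "evens (\<lambda>i. a * v i) = (\<lambda>i. a * evens v i)"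
  "odds (\<lambda>i. u i + v i) = (\<lambda>i. odds u i + odds v i)" "odds (\<lambda>i. a * v i) = (\<lambda>i. a * odds v i)"
  "evens (\<lambda>i. 0) = (\<lambda>i. 0)" "odds (\<lambda>i. 0) = (\<lambda>i. 0)"
  "interleave (\<lambda>i. u i + v i) (\<lambda>i. u' i + v' i) = (\<lambda>i. interleave u u' i + interleave v v' i)"
  "interleave (\<lambda>i. a * v i) (\<lambda>i. a * v' i) = (\<lambda>i. a * interleave v v' i)"
  by (auto simp: evens_def odds_def interleave_def)

lemma continuous_map_cseq_iff:
  fixes g :: "'a \<Rightarrow> cseq"
  shows "continuous_map X euclidean g \<longleftrightarrow> (\<forall>i. continuous_map X euclidean (\<lambda>x. g x i))"
  by (simp add: continuous_map_componentwise_UNIV flip: euclidean_product_topology)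

lemma topspace_gbundle_sum [simp]:
  "(x, u) \<in> topspace (tot (gbundle_sum E F)) \<longleftrightarrow> evens u \<in> fibre (tot E) x \<and> odds u \<in> fibre (tot F) x"
  by (auto simp: gbundle_sum_def topspace_pullback_topology mem_fibre_iff)

lemma fibre_gbundle_sum [simp]:
  "u \<in> fibre (tot (gbundle_sum E F)) x \<longleftrightarrow> evens u \<in> fibre (tot E) x \<and> odds u \<in> fibre (tot F) x"
  by (simp add: mem_fibre_iff[of _ "tot (gbundle_sum E F)"])

lemma act_gbundle_sum [simp]:
  "act (gbundle_sum E F) m u = interleave (act E m (evens u)) (act F m (odds u))"
  by (simp add: gbundle_sum_def)

text \<open>Universal property of the fibre product; every later continuity statement about a direct
  sum goes through it.\<close>

lemma continuous_map_gbundle_sum: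
  "continuous_map T (tot (gbundle_sum E F)) (\<lambda>z. (a z, u z)) \<longleftrightarrow>
   continuous_map T (tot E) (\<lambda>z. (a z, evens (u z))) \<and> continuous_map T (tot F) (\<lambda>z. (a z, odds (u z)))"
  (is "?L \<longleftrightarrow> ?R")
proof
  assume L: ?L
  have "continuous_map (tot (gbundle_sum E F)) (prod_topology (tot E) (tot F))
      (id \<circ> (\<lambda>(x, u). ((x, evens u), (x, odds u))))"
    unfolding gbundle_sum_def gbundle.simps by (intro continuous_map_pullback) simp
  from continuous_map_compose[OF L this] show ?R
    by (auto simp: continuous_map_pairwise o_def)
next
  assume R: ?R
  show ?L
    unfolding gbundle_sum_def gbundle.simps
  proof (rule continuous_map_pullback')
    show "continuous_map T (prod_topology (tot E) (tot F))
        ((\<lambda>(x, u). ((x, evens u), (x, odds u))) \<circ> (\<lambda>z. (a z, u z)))"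
      using R by (auto simp: continuous_map_pairwise o_def)
    show "topspace T \<subseteq> (\<lambda>z. (a z, u z)) -` {(x, u). evens u \<in> fibre (tot E) x \<and> odds u \<in> fibre (tot F) x}"
      using R continuous_map_mem by (fastforce simp: mem_fibre_iff)
  qed
qed

lemma continuous_map_evens_odds:
  "continuous_map (tot (gbundle_sum E F)) (tot E) (\<lambda>e. (fst e, evens (snd e)))"
  "continuous_map (tot (gbundle_sum E F)) (tot F) (\<lambda>e. (fst e, odds (snd e)))"
  using continuous_map_gbundle_sum[of "tot (gbundle_sum E F)" E F fst snd] by auto

lemma vector_bundle_sum:
  assumes E: "vector_bundle B (tot E)" and F: "vector_bundle B (tot F)"
  shows "vector_bundle B (tot (gbundle_sum E F))"
  unfolding vector_bundle_iff
proof (intro conjI ballI)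
  let ?S = "tot (gbundle_sum E F)"
  show fst: "continuous_map ?S B fst"
    using E by (intro continuous_map_compose_eq[OF continuous_map_evens_odds(1)[of E F], of B fst])
      (auto simp: vector_bundle_def)
  fix x assume x: "x \<in> topspace B"
  show "csubspace (fibre ?S x)"
    using E F x by (auto simp: vector_bundle_def csubspace_def evens_odds_linear)
  obtain U n f f' where U: "openin B U" "x \<in> U" and f: "local_triv B (tot E) U n f f'"
    using E x vector_bundle_iff by metis
  obtain V m g g' where V: "openin B V" "x \<in> V" and g: "local_triv B (tot F) V m g g'"
    using F x vector_bundle_iff by metis
  \<comment> \<open>The trivialised fibres are concatenated, not interleaved: interleaving vectors
    from \<open>Cn n\<close> and \<open>Cn m\<close> leaves gaps when n and m differ and does not
    fill \<open>Cn (n + m)\<close>. The maps \<open>h1\<close> and \<open>h2\<close> cut a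
    concatenated vector apart again.\<close>
  define h where "h = (\<lambda>y u i. if i < n then f y (evens u) i else g y (odds u) (i - n))"
  define h1 where "h1 = (\<lambda>(w::cseq) i. if i < n then w i else 0)"
  define h2 where "h2 = (\<lambda>(w::cseq) i. w (n + i))"
  define h' where "h' = (\<lambda>y w. interleave (f' y (h1 w)) (g' y (h2 w)))"
  have h12: "h1 (h y u) = f y (evens u)" "h2 (h y u) = g y (odds u)" if "f y (evens u) \<in> Cn n" for y u
    using that by (auto simp: h_def h1_def h2_def Cn_def fun_eq_iff)
  have h12': "h1 w \<in> Cn n" "h2 w \<in> Cn m" "(\<lambda>i. if i < n then h1 w i else h2 w (i - n)) = w"
    if "w \<in> Cn (n + m)" for w
    using that by (auto simp: h1_def h2_def Cn_def fun_eq_iff)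
  have "local_triv B ?S (U \<inter> V) (n + m) h h'"
    unfolding local_triv_def
  proof (intro conjI ballI)
    fix y assume y: "y \<in> U \<inter> V"
    show "clinear_on (fibre ?S y) (h y)"
      using f g y by (auto simp: clinear_on_def local_triv_def h_def fun_eq_iff evens_odds_linear)
    fix u assume u: "u \<in> fibre ?S y"
    show "h y u \<in> Cn (n + m)"
      using f g y u by (auto simp: local_triv_def h_def Cn_def)
    show "h' y (h y u) = u"
      using f g y u by (simp add: h'_def h12 local_triv_def)
  next
    fix y w assume y: "y \<in> U \<inter> V" and w: "w \<in> Cn (n + m)"
    show "h' y w \<in> fibre ?S y"
      using f g y h12'[OF w] by (simp add: h'_def local_triv_def)
    show "h y (h' y w) = w"
    proof -
      have "f y (f' y (h1 w)) = h1 w" "g y (g' y (h2 w)) = h2 w"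
        using f g y h12'[OF w] by (auto simp: local_triv_def)
      then show ?thesis
        unfolding h_def h'_def evens_interleave odds_interleave using h12'(3)[OF w] by metis
    qed
  next
    have 1: "continuous_map (subtopology ?S {e. fst e \<in> U \<inter> V}) euclidean (\<lambda>e. f (fst e) (evens (snd e)))"
    proof (rule continuous_map_compose_eq)
      show "continuous_map (subtopology ?S {e. fst e \<in> U \<inter> V}) (subtopology (tot E) {e. fst e \<in> U})
          (\<lambda>e. (fst e, evens (snd e)))"
        by (auto simp: continuous_map_in_subtopology
            intro: continuous_map_from_subtopology continuous_map_evens_odds)
      show "continuous_map (subtopology (tot E) {e. fst e \<in> U}) euclidean (\<lambda>(y, v). f y v)"
        using f by (simp add: local_triv_def)
    qed auto
    have 2: "continuous_map (subtopology ?S {e. fst e \<in> U \<inter> V}) euclidean (\<lambda>e. g (fst e) (odds (snd e)))"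
    proof (rule continuous_map_compose_eq)
      show "continuous_map (subtopology ?S {e. fst e \<in> U \<inter> V}) (subtopology (tot F) {e. fst e \<in> V})
          (\<lambda>e. (fst e, odds (snd e)))"
        by (auto simp: continuous_map_in_subtopology
            intro: continuous_map_from_subtopology continuous_map_evens_odds)
      show "continuous_map (subtopology (tot F) {e. fst e \<in> V}) euclidean (\<lambda>(y, v). g y v)"
        using g by (simp add: local_triv_def)
    qed auto
    have "continuous_map (subtopology ?S {e. fst e \<in> U \<inter> V}) euclidean (\<lambda>e. h (fst e) (snd e) i)" for i
      using 1[unfolded continuous_map_cseq_iff, rule_format, of i]
        2[unfolded continuous_map_cseq_iff, rule_format, of "i - n"]
      by (simp add: h_def)
    then show "continuous_map (subtopology ?S {e. fst e \<in> U \<inter> V}) euclidean (\<lambda>(y, v). h y v)"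
      unfolding continuous_map_cseq_iff case_prod_unfold by blast
  next
    let ?P = "prod_topology (subtopology B (U \<inter> V)) (top_of_set (Cn (n + m)))"
    have pr: "continuous_map ?P euclidean (\<lambda>e. snd e i)" for i
    proof -
      have "continuous_map ?P euclidean snd"
        by (rule continuous_map_into_fulltopology[OF continuous_map_snd])
      then show ?thesis
        unfolding continuous_map_cseq_iff by blast
    qed
    have B: "continuous_map ?P (subtopology B U) fst" "continuous_map ?P (subtopology B V) fst"
      using continuous_map_fst[of "subtopology B (U \<inter> V)"]
      by (auto simp: continuous_map_in_subtopology)
    have "continuous_map ?P euclidean (\<lambda>e. h1 (snd e))" "continuous_map ?P euclidean (\<lambda>e. h2 (snd e))"
      unfolding continuous_map_cseq_iff h1_def h2_def using pr by auto
    then have "continuous_map ?P (prod_topology (subtopology B U) (top_of_set (Cn n))) (\<lambda>e. (fst e, h1 (snd e)))"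
      "continuous_map ?P (prod_topology (subtopology B V) (top_of_set (Cn m))) (\<lambda>e. (fst e, h2 (snd e)))"
      using B by (auto simp: continuous_map_pairwise o_def continuous_map_in_subtopology h12')
    moreover have "continuous_map (prod_topology (subtopology B U) (top_of_set (Cn n))) (tot E) (\<lambda>(y, w). (y, f' y w))"
      "continuous_map (prod_topology (subtopology B V) (top_of_set (Cn m))) (tot F) (\<lambda>(y, w). (y, g' y w))"
      using f g by (simp_all add: local_triv_def)
    ultimately have "continuous_map ?P (tot E) (\<lambda>e. (fst e, f' (fst e) (h1 (snd e))))"
      "continuous_map ?P (tot F) (\<lambda>e. (fst e, g' (fst e) (h2 (snd e))))"
      by (auto dest: continuous_map_compose simp: o_def)
    then show "continuous_map ?P ?S (\<lambda>(y, w). (y, h' y w))"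
      by (simp add: case_prod_unfold continuous_map_gbundle_sum h'_def)
  qed
  then show "\<exists>W k h h'. openin B W \<and> x \<in> W \<and> local_triv B ?S W k h h'"
    using U V by blast
qed

lemma groupoid_bundle_sum:
  assumes E: "groupoid_bundle \<G> E" and F: "groupoid_bundle \<G> F"
  shows "groupoid_bundle \<G> (gbundle_sum E F)"
proof (rule groupoid_bundleI)
  show "vector_bundle (Ob \<G>) (tot (gbundle_sum E F))"
    using E F by (intro vector_bundle_sum groupoid_bundleD(1))
  let ?S = "tot (gbundle_sum E F)"
  let ?Z = "subtopology (prod_topology (Mor \<G>) ?S) {(m, e). src \<G> m = fst e}"
  show "clinear_on (fibre ?S (src \<G> m)) (act (gbundle_sum E F) m)" if "m \<in> topspace (Mor \<G>)" for m
    using groupoid_bundleD(5)[OF E that] groupoid_bundleD(5)[OF F that]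
    by (simp add: clinear_on_def evens_odds_linear)
  have Z: "continuous_map ?Z (Mor \<G>) fst" "continuous_map ?Z ?S snd"
    by (auto intro: continuous_map_from_subtopology continuous_map_fst continuous_map_snd)
  have "continuous_map ?Z (tot E) (\<lambda>z. (fst (snd z), evens (snd (snd z))))"
    by (rule continuous_map_compose_eq[OF Z(2) continuous_map_evens_odds(1)]) simp
  from continuous_map_act[OF E Z(1) this]
  have 1: "continuous_map ?Z (tot E) (\<lambda>z. (tgt \<G> (fst z), act E (fst z) (evens (snd (snd z)))))"
    by auto
  have "continuous_map ?Z (tot F) (\<lambda>z. (fst (snd z), odds (snd (snd z))))"
    by (rule continuous_map_compose_eq[OF Z(2) continuous_map_evens_odds(2)]) simp
  from continuous_map_act[OF F Z(1) this]
  have 2: "continuous_map ?Z (tot F) (\<lambda>z. (tgt \<G> (fst z), act F (fst z) (odds (snd (snd z)))))"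
    by auto
  from 1 2 show "continuous_map ?Z ?S (\<lambda>(m, e). (tgt \<G> m, act (gbundle_sum E F) m (snd e)))"
    by (simp add: case_prod_unfold continuous_map_gbundle_sum)
qed (auto simp: groupoid_bundleD[OF E] groupoid_bundleD[OF F])

lemma gbundle_sum_cong:
  assumes "gbundle_iso \<G> E E'" "gbundle_iso \<G> F F'"
  shows "gbundle_iso \<G> (gbundle_sum E F) (gbundle_sum E' F')"
  using assms(1)
proof (rule gbundle_isoE)
  fix f f' assume "gbundle_iso_via \<G> E E' f f'"
  note f = gbundle_iso_viaD[OF this]
  show ?thesis
    using assms(2)
  proof (rule gbundle_isoE)
    fix g g' assume "gbundle_iso_via \<G> F F' g g'"
    note g = gbundle_iso_viaD[OF this]
    show ?thesis
    proof (rule gbundle_isoI)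
      let ?S = "gbundle_sum E F" and ?S' = "gbundle_sum E' F'"
      show "continuous_map (tot ?S) (tot ?S') (\<lambda>(x, u). (x, interleave (f x (evens u)) (g x (odds u))))"
        unfolding case_prod_unfold continuous_map_gbundle_sum evens_interleave odds_interleave
        by (intro conjI continuous_map_compose_eq[OF continuous_map_evens_odds(1) f(1)]
            continuous_map_compose_eq[OF continuous_map_evens_odds(2) g(1)]) auto
      show "continuous_map (tot ?S') (tot ?S) (\<lambda>(x, u). (x, interleave (f' x (evens u)) (g' x (odds u))))"
        unfolding case_prod_unfold continuous_map_gbundle_sum evens_interleave odds_interleave
        by (intro conjI continuous_map_compose_eq[OF continuous_map_evens_odds(1) f(2)]
            continuous_map_compose_eq[OF continuous_map_evens_odds(2) g(2)]) auto
      show "clinear_on (fibre (tot ?S) x) (\<lambda>u. interleave (f x (evens u)) (g x (odds u)))"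
        if "x \<in> topspace (Ob \<G>)" for x
        using f(5)[OF that] g(5)[OF that] by (simp add: clinear_on_def evens_odds_linear)
    qed (use f g in auto)
  qed
qed

lemma gbundle_sum_comm: "gbundle_iso \<G> (gbundle_sum E F) (gbundle_sum F E)"
proof (rule gbundle_isoI)
  show "continuous_map (tot (gbundle_sum E F)) (tot (gbundle_sum F E)) (\<lambda>(x, u). (x, interleave (odds u) (evens u)))"
    "continuous_map (tot (gbundle_sum F E)) (tot (gbundle_sum E F)) (\<lambda>(x, u). (x, interleave (odds u) (evens u)))"
    by (auto simp: case_prod_unfold continuous_map_gbundle_sum continuous_map_evens_odds)
qed (auto simp: clinear_on_def evens_odds_linear)

lemma gbundle_sum_assoc:
  "gbundle_iso \<G> (gbundle_sum (gbundle_sum E F) H) (gbundle_sum E (gbundle_sum F H))"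
proof (rule gbundle_isoI)
  let ?L = "gbundle_sum (gbundle_sum E F) H" and ?R = "gbundle_sum E (gbundle_sum F H)"
  have L: "continuous_map (tot ?L) (tot E) (\<lambda>e. (fst e, evens (evens (snd e))))"
    "continuous_map (tot ?L) (tot F) (\<lambda>e. (fst e, odds (evens (snd e))))"
    by (auto intro: continuous_map_compose_eq[OF continuous_map_evens_odds(1)] continuous_map_evens_odds)
  have R: "continuous_map (tot ?R) (tot F) (\<lambda>e. (fst e, evens (odds (snd e))))"
    "continuous_map (tot ?R) (tot H) (\<lambda>e. (fst e, odds (odds (snd e))))"
    by (auto intro: continuous_map_compose_eq[OF continuous_map_evens_odds(2)] continuous_map_evens_odds)
  show "continuous_map (tot ?L) (tot ?R)
      (\<lambda>(x, u). (x, interleave (evens (evens u)) (interleave (odds (evens u)) (odds u))))"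
    using L by (auto simp: case_prod_unfold continuous_map_gbundle_sum continuous_map_evens_odds)
  show "continuous_map (tot ?R) (tot ?L)
      (\<lambda>(x, u). (x, interleave (interleave (evens u) (evens (odds u))) (odds (odds u))))"
    using R by (auto simp: case_prod_unfold continuous_map_gbundle_sum continuous_map_evens_odds)
qed (auto simp: clinear_on_def evens_odds_linear)

section \<open>The Grothendieck group\<close>

text \<open>The defining relation of the Grothendieck group asserts an isomorphism between sums.
  Through classes it becomes an equation in a commutative semigroup, where reordering of summands is
  plain rewriting.\<close>

definition iso_class :: "('o, 'm) tgroupoid \<Rightarrow> ('o, 'm) gbundle \<Rightarrow> ('o, 'm) gbundle set" where
  "iso_class \<G> E = {F. groupoid_bundle \<G> F \<and> gbundle_iso \<G> F E}"

text \<open>Only the members of \<open>A\<close> and \<open>B\<close> that are bundles over \<open>\<G>\<close> count; this makes the operation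
  associative and commutative on arbitrary sets.\<close>

definition iso_class_sum :: "('o, 'm) tgroupoid \<Rightarrow> ('o, 'm) gbundle set \<Rightarrow> ('o, 'm) gbundle set \<Rightarrow>
    ('o, 'm) gbundle set" where
  "iso_class_sum \<G> A B = {H. groupoid_bundle \<G> H \<and> (\<exists>E\<in>A. \<exists>F\<in>B.
     groupoid_bundle \<G> E \<and> groupoid_bundle \<G> F \<and> gbundle_iso \<G> H (gbundle_sum E F))}"

lemma gbundle_iso_trans':
  "groupoid_bundle \<G> E \<Longrightarrow> gbundle_iso \<G> E F \<Longrightarrow> gbundle_iso \<G> F H \<Longrightarrow> gbundle_iso \<G> E H"
  by (erule (1) gbundle_iso_trans) (rule groupoid_bundleD(4))

lemma iso_class_eq_iff:
  assumes "groupoid_bundle \<G> E" "groupoid_bundle \<G> F"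
  shows "iso_class \<G> E = iso_class \<G> F \<longleftrightarrow> gbundle_iso \<G> E F"
  using assms gbundle_iso_refl[of \<G>] gbundle_iso_sym[of \<G>] gbundle_iso_trans'[of \<G>]
  unfolding iso_class_def by blast

lemma iso_class_sum_iso_class:
  assumes "groupoid_bundle \<G> E" "groupoid_bundle \<G> F"
  shows "iso_class_sum \<G> (iso_class \<G> E) (iso_class \<G> F) = iso_class \<G> (gbundle_sum E F)"
  using assms gbundle_iso_refl[of \<G>] gbundle_iso_trans'[of \<G>] gbundle_sum_cong[of \<G>]
  unfolding iso_class_sum_def iso_class_def by blast

text \<open>Eliminates the intermediate bundle of the iterated sum: it may be taken to be the direct
  sum of \<open>E\<close> and \<open>F\<close> itself.\<close>

lemma iso_class_sum_assoc_iff: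
  "H \<in> iso_class_sum \<G> (iso_class_sum \<G> A B) C \<longleftrightarrow> groupoid_bundle \<G> H \<and> (\<exists>E\<in>A. \<exists>F\<in>B. \<exists>K\<in>C.
     groupoid_bundle \<G> E \<and> groupoid_bundle \<G> F \<and> groupoid_bundle \<G> K \<and>
     gbundle_iso \<G> H (gbundle_sum (gbundle_sum E F) K))" (is "?L \<longleftrightarrow> ?R")
proof
  assume ?L
  then obtain D K E F where *: "groupoid_bundle \<G> H" "groupoid_bundle \<G> D" "groupoid_bundle \<G> K"
    "K \<in> C" "gbundle_iso \<G> H (gbundle_sum D K)" "E \<in> A" "F \<in> B" "groupoid_bundle \<G> E"
    "groupoid_bundle \<G> F" "gbundle_iso \<G> D (gbundle_sum E F)"
    unfolding iso_class_sum_def by blast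
  then have "gbundle_iso \<G> H (gbundle_sum (gbundle_sum E F) K)"
    by (meson gbundle_iso_refl gbundle_iso_trans' gbundle_sum_cong)
  with * show ?R by blast
next
  assume ?R
  then obtain E F K where "groupoid_bundle \<G> H" "E \<in> A" "F \<in> B" "K \<in> C"
     "groupoid_bundle \<G> E" "groupoid_bundle \<G> F" "groupoid_bundle \<G> K"
     "gbundle_iso \<G> H (gbundle_sum (gbundle_sum E F) K)"
    by blast
  moreover from this have "gbundle_sum E F \<in> iso_class_sum \<G> A B"
    unfolding iso_class_sum_def using groupoid_bundle_sum gbundle_iso_refl by blast
  ultimately show ?L
    unfolding iso_class_sum_def[of _ "iso_class_sum \<G> A B"] using groupoid_bundle_sum by blast
qed

lemma iso_class_sum_commute: "iso_class_sum \<G> A B = iso_class_sum \<G> B A"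
  unfolding iso_class_sum_def using gbundle_iso_trans'[OF _ _ gbundle_sum_comm] by blast

interpretation iso_class_sum: abel_semigroup "iso_class_sum \<G>" for \<G>
proof
  show "iso_class_sum \<G> A B = iso_class_sum \<G> B A" for A B
    by (rule iso_class_sum_commute)
  \<comment> \<open>One inclusion for a cyclic rotation of the three summands suffices: three
    rotations return to the start, so all the inclusions are equalities.\<close>
  have sub: "iso_class_sum \<G> (iso_class_sum \<G> A B) C \<subseteq> iso_class_sum \<G> (iso_class_sum \<G> B C) A" for A B C
  proof
    fix H assume "H \<in> iso_class_sum \<G> (iso_class_sum \<G> A B) C"
    then obtain E F K where *: "groupoid_bundle \<G> H" "E \<in> A" "F \<in> B" "K \<in> C"
       "groupoid_bundle \<G> E" "groupoid_bundle \<G> F" "groupoid_bundle \<G> K"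
       "gbundle_iso \<G> H (gbundle_sum (gbundle_sum E F) K)"
      unfolding iso_class_sum_assoc_iff by blast
    then have "gbundle_iso \<G> H (gbundle_sum E (gbundle_sum F K))"
      using gbundle_iso_trans'[OF _ _ gbundle_sum_assoc] by blast
    then have "gbundle_iso \<G> H (gbundle_sum (gbundle_sum F K) E)"
      using gbundle_iso_trans'[OF _ _ gbundle_sum_comm] *(1) by blast
    with * show "H \<in> iso_class_sum \<G> (iso_class_sum \<G> B C) A"
      unfolding iso_class_sum_assoc_iff by blast
  qed
  show "iso_class_sum \<G> (iso_class_sum \<G> A B) C = iso_class_sum \<G> A (iso_class_sum \<G> B C)" for A B C
    using sub[of A B C] sub[of B C A] sub[of C A B] iso_class_sum_commute[of \<G> A "iso_class_sum \<G> B C"]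
    by blast
qed

lemma K_rel_iff:
  "((E, F), (E', F')) \<in> K_rel \<G> \<longleftrightarrow>
     groupoid_bundle \<G> E \<and> groupoid_bundle \<G> F \<and> groupoid_bundle \<G> E' \<and> groupoid_bundle \<G> F' \<and>
     (\<exists>H. groupoid_bundle \<G> H \<and>
        iso_class_sum \<G> (iso_class_sum \<G> (iso_class \<G> E) (iso_class \<G> F')) (iso_class \<G> H) =
        iso_class_sum \<G> (iso_class_sum \<G> (iso_class \<G> E') (iso_class \<G> F)) (iso_class \<G> H))"
proof (cases "groupoid_bundle \<G> E \<and> groupoid_bundle \<G> F \<and> groupoid_bundle \<G> E' \<and> groupoid_bundle \<G> F'")
  case True
  then have "iso_class_sum \<G> (iso_class_sum \<G> (iso_class \<G> E) (iso_class \<G> F')) (iso_class \<G> H) =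
        iso_class_sum \<G> (iso_class_sum \<G> (iso_class \<G> E') (iso_class \<G> F)) (iso_class \<G> H) \<longleftrightarrow>
      gbundle_iso \<G> (gbundle_sum (gbundle_sum E F') H) (gbundle_sum (gbundle_sum E' F) H)"
    if "groupoid_bundle \<G> H" for H
    using that by (simp add: iso_class_sum_iso_class groupoid_bundle_sum iso_class_eq_iff)
  then show ?thesis
    using True by (auto simp: K_rel_def)
qed (auto simp: K_rel_def)

lemma equiv_K_rel: "equiv ({E. groupoid_bundle \<G> E} \<times> {E. groupoid_bundle \<G> E}) (K_rel \<G>)"
proof (rule equivI)
  show "refl_on ({E. groupoid_bundle \<G> E} \<times> {E. groupoid_bundle \<G> E}) (K_rel \<G>)"
    by (auto simp: refl_on_def K_rel_iff)
  show "K_rel \<G> \<subseteq> ({E. groupoid_bundle \<G> E} \<times> {E. groupoid_bundle \<G> E}) \<times>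
      ({E. groupoid_bundle \<G> E} \<times> {E. groupoid_bundle \<G> E})"
    by (auto simp: K_rel_iff)
  show "sym (K_rel \<G>)"
    by (rule symI, clarsimp simp: K_rel_iff) metis
  show "trans (K_rel \<G>)"
  proof (rule transI, clarify)
    fix E F E' F' E'' F''
    assume 1: "((E, F), (E', F')) \<in> K_rel \<G>" and 2: "((E', F'), (E'', F'')) \<in> K_rel \<G>"
    let ?c = "iso_class \<G>"
    obtain H H' where H: "groupoid_bundle \<G> H" "groupoid_bundle \<G> H'"
      and a: "iso_class_sum \<G> (iso_class_sum \<G> (?c E) (?c F')) (?c H) =
        iso_class_sum \<G> (iso_class_sum \<G> (?c E') (?c F)) (?c H)"
      and b: "iso_class_sum \<G> (iso_class_sum \<G> (?c E') (?c F'')) (?c H') =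
        iso_class_sum \<G> (iso_class_sum \<G> (?c E'') (?c F')) (?c H')"
      using 1 2 unfolding K_rel_iff by blast
    have gb: "groupoid_bundle \<G> E" "groupoid_bundle \<G> F" "groupoid_bundle \<G> E'" "groupoid_bundle \<G> F'"
      "groupoid_bundle \<G> E''" "groupoid_bundle \<G> F''"
      using 1 2 unfolding K_rel_iff by blast+
    let ?H = "gbundle_sum (gbundle_sum H H') (gbundle_sum E' F')"
    have cH: "?c ?H = iso_class_sum \<G> (iso_class_sum \<G> (?c H) (?c H')) (iso_class_sum \<G> (?c E') (?c F'))"
      using H gb by (simp add: iso_class_sum_iso_class groupoid_bundle_sum)
    have "iso_class_sum \<G> (iso_class_sum \<G> (?c E) (?c F'')) (?c ?H) =
      iso_class_sum \<G> (iso_class_sum \<G> (iso_class_sum \<G> (?c E) (?c F')) (?c H))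
        (iso_class_sum \<G> (iso_class_sum \<G> (?c E') (?c F'')) (?c H'))"
      unfolding cH by (simp only: iso_class_sum.assoc iso_class_sum.commute iso_class_sum.left_commute)
    also have "\<dots> = iso_class_sum \<G> (iso_class_sum \<G> (?c E'') (?c F)) (?c ?H)"
      unfolding a b cH by (simp only: iso_class_sum.assoc iso_class_sum.commute iso_class_sum.left_commute)
    finally show "((E, F), (E'', F'')) \<in> K_rel \<G>"
      unfolding K_rel_iff using gb H by (auto intro!: exI[of _ ?H] groupoid_bundle_sum)
  qed
qed

definition K_class :: "('o, 'm) tgroupoid \<Rightarrow> ('o, 'm) gbundle \<Rightarrow> ('o, 'm) gbundle \<Rightarrow>
    (('o, 'm) gbundle \<times> ('o, 'm) gbundle) set" where
  "K_class \<G> E F = K_rel \<G> `` {(E, F)}"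

lemma carrier_K_group:
  "\<xi> \<in> carrier (K_group \<G>) \<longleftrightarrow>
     (\<exists>E F. groupoid_bundle \<G> E \<and> groupoid_bundle \<G> F \<and> \<xi> = K_class \<G> E F)"
  by (auto simp: K_group_def K_class_def quotient_def)

lemma K_class_eq_iff:
  assumes "groupoid_bundle \<G> E" "groupoid_bundle \<G> F" "groupoid_bundle \<G> E'" "groupoid_bundle \<G> F'"
  shows "K_class \<G> E F = K_class \<G> E' F' \<longleftrightarrow>
    (\<exists>H. groupoid_bundle \<G> H \<and>
       gbundle_iso \<G> (gbundle_sum (gbundle_sum E F') H) (gbundle_sum (gbundle_sum E' F) H))"
  using eq_equiv_class_iff[OF equiv_K_rel, of "(E, F)" \<G> "(E', F')"] assms
  by (simp add: K_class_def K_rel_def)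

lemma K_class_eqI:
  assumes "groupoid_bundle \<G> E" "groupoid_bundle \<G> F" "groupoid_bundle \<G> E'" "groupoid_bundle \<G> F'"
    and "gbundle_iso \<G> E E'" "gbundle_iso \<G> F F'"
  shows "K_class \<G> E F = K_class \<G> E' F'"
proof -
  have "gbundle_iso \<G> F' F"
    using assms by (intro gbundle_iso_sym[of \<G> F F'])
  \<comment> \<open>Any bundle may serve as stabilising summand. \<open>E\<close> is at hand,
    whereas the zero bundle is shown to be a bundle only over a \<open>pregroupoid\<close>.\<close>
  then show ?thesis
    using assms by (subst K_class_eq_iff) (auto intro!: exI[of _ E] gbundle_sum_cong gbundle_iso_refl)
qed

lemma mem_K_classD:
  assumes "(E', F') \<in> K_class \<G> E F"
  shows "groupoid_bundle \<G> E'" "groupoid_bundle \<G> F'" "K_class \<G> E' F' = K_class \<G> E F"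
proof -
  show "groupoid_bundle \<G> E'" "groupoid_bundle \<G> F'"
    using assms by (auto simp: K_class_def K_rel_iff)
  show "K_class \<G> E' F' = K_class \<G> E F"
    using equiv_class_eq[OF equiv_K_rel assms[unfolded K_class_def Image_singleton_iff]]
    by (simp add: K_class_def)
qed

lemma mem_K_class_self:
  assumes "groupoid_bundle \<G> E" "groupoid_bundle \<G> F"
  shows "(E, F) \<in> K_class \<G> E F"
  using assms by (auto simp: K_class_def K_rel_iff)

text \<open>The two stable identities are added, and the sum of their stabilising summands
  stabilises the result.\<close>

lemma K_class_sum_cong:
  assumes gb: "groupoid_bundle \<G> E" "groupoid_bundle \<G> F" "groupoid_bundle \<G> E'" "groupoid_bundle \<G> F'"
      "groupoid_bundle \<G> D" "groupoid_bundle \<G> C" "groupoid_bundle \<G> D'" "groupoid_bundle \<G> C'"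
    and 1: "K_class \<G> E F = K_class \<G> E' F'" and 2: "K_class \<G> D C = K_class \<G> D' C'"
  shows "K_class \<G> (gbundle_sum E D) (gbundle_sum F C) = K_class \<G> (gbundle_sum E' D') (gbundle_sum F' C')"
proof -
  let ?c = "iso_class \<G>"
  have "((E, F), (E', F')) \<in> K_rel \<G>" "((D, C), (D', C')) \<in> K_rel \<G>"
    using mem_K_class_self[of \<G> E' F'] mem_K_class_self[of \<G> D' C'] gb 1 2 by (auto simp: K_class_def)
  then obtain H H' where H: "groupoid_bundle \<G> H" "groupoid_bundle \<G> H'"
      and a: "iso_class_sum \<G> (iso_class_sum \<G> (?c E) (?c F')) (?c H) =
        iso_class_sum \<G> (iso_class_sum \<G> (?c E') (?c F)) (?c H)"
      and b: "iso_class_sum \<G> (iso_class_sum \<G> (?c D) (?c C')) (?c H') =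
        iso_class_sum \<G> (iso_class_sum \<G> (?c D') (?c C)) (?c H')"
    unfolding K_rel_iff by blast
  have "iso_class_sum \<G> (iso_class_sum \<G> (iso_class_sum \<G> (?c E) (?c D)) (iso_class_sum \<G> (?c F') (?c C')))
      (iso_class_sum \<G> (?c H) (?c H')) =
    iso_class_sum \<G> (iso_class_sum \<G> (iso_class_sum \<G> (?c E) (?c F')) (?c H))
      (iso_class_sum \<G> (iso_class_sum \<G> (?c D) (?c C')) (?c H'))"
    by (simp only: iso_class_sum.assoc iso_class_sum.commute iso_class_sum.left_commute)
  also have "\<dots> = iso_class_sum \<G> (iso_class_sum \<G> (iso_class_sum \<G> (?c E') (?c D'))
      (iso_class_sum \<G> (?c F) (?c C))) (iso_class_sum \<G> (?c H) (?c H'))"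
    unfolding a b by (simp only: iso_class_sum.assoc iso_class_sum.commute iso_class_sum.left_commute)
  finally have rel: "((gbundle_sum E D, gbundle_sum F C), (gbundle_sum E' D', gbundle_sum F' C')) \<in> K_rel \<G>"
    unfolding K_rel_iff using gb H
    by (auto simp: iso_class_sum_iso_class groupoid_bundle_sum intro!: exI[of _ "gbundle_sum H H'"])
  show ?thesis
    unfolding K_class_def by (rule equiv_class_eq[OF equiv_K_rel rel])
qed

text \<open>Operations on K-theory classes are defined as unions over representatives; such a union
  is evaluated at one representative once the value is known to be independent of it.\<close>

lemma UN_case_prod_const:
  assumes "(a, b) \<in> S" "\<And>x y. (x, y) \<in> S \<Longrightarrow> f x y = c"
  shows "(\<Union>(x, y)\<in>S. f x y) = c"
  using assms by (auto; blast)

lemma mult_K_group: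
  assumes "groupoid_bundle \<G> E" "groupoid_bundle \<G> F" "groupoid_bundle \<G> E'" "groupoid_bundle \<G> F'"
  shows "K_class \<G> E F \<otimes>\<^bsub>K_group \<G>\<^esub> K_class \<G> E' F' = K_class \<G> (gbundle_sum E E') (gbundle_sum F F')"
proof -
  have *: "K_class \<G> (gbundle_sum A A') (gbundle_sum B B') = K_class \<G> (gbundle_sum E E') (gbundle_sum F F')"
    if "(A, B) \<in> K_class \<G> E F" "(A', B') \<in> K_class \<G> E' F'" for A B A' B'
    using assms mem_K_classD[OF that(1)] mem_K_classD[OF that(2)] by (intro K_class_sum_cong)
  show ?thesis
    unfolding K_group_def monoid.simps K_class_def[symmetric]
    by (rule UN_case_prod_const[OF mem_K_class_self UN_case_prod_const[OF mem_K_class_self]]) (use assms * in auto)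
qed

section \<open>Functoriality\<close>

text \<open>The part of the axioms of a topological groupoid that is needed to pull back and glue bundles.\<close>

locale pregroupoid =
  fixes \<G> :: "('o, 'm) tgroupoid"
  assumes src_cont: "continuous_map (Mor \<G>) (Ob \<G>) (src \<G>)"
    and tgt_cont: "continuous_map (Mor \<G>) (Ob \<G>) (tgt \<G>)"
    and src_idm: "\<And>x. x \<in> topspace (Ob \<G>) \<Longrightarrow> src \<G> (idm \<G> x) = x"
    and src_cmp: "\<And>m k. m \<in> topspace (Mor \<G>) \<Longrightarrow> k \<in> topspace (Mor \<G>) \<Longrightarrow> src \<G> m = tgt \<G> k \<Longrightarrow>
      src \<G> (cmp \<G> m k) = src \<G> k"

definition continuous_functor :: "('o, 'm) tgroupoid \<Rightarrow> ('o', 'm') tgroupoid \<Rightarrow>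
    ('o, 'm, 'o', 'm') gfunctor \<Rightarrow> bool" where
  "continuous_functor \<G> \<H> F \<longleftrightarrow>
     continuous_map (Ob \<G>) (Ob \<H>) (fst F) \<and> continuous_map (Mor \<G>) (Mor \<H>) (snd F) \<and>
     (\<forall>m\<in>topspace (Mor \<G>). src \<H> (snd F m) = fst F (src \<G> m) \<and> tgt \<H> (snd F m) = fst F (tgt \<G> m)) \<and>
     (\<forall>x\<in>topspace (Ob \<G>). snd F (idm \<G> x) = idm \<H> (fst F x)) \<and>
     (\<forall>m\<in>topspace (Mor \<G>). \<forall>k\<in>topspace (Mor \<G>). src \<G> m = tgt \<G> k \<longrightarrow>
        snd F (cmp \<G> m k) = cmp \<H> (snd F m) (snd F k))"

text \<open>The inverse components \<eta>' are separate data with a continuity condition of their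
  own, because the groupoids carry no inversion map from which it could be inferred.\<close>

definition nat_iso :: "('o, 'm) tgroupoid \<Rightarrow> ('o', 'm') tgroupoid \<Rightarrow>
    ('o, 'm, 'o', 'm') gfunctor \<Rightarrow> ('o, 'm, 'o', 'm') gfunctor \<Rightarrow> bool" where
  "nat_iso \<G> \<H> F F' \<longleftrightarrow> (\<exists>\<eta> \<eta>'.
     continuous_map (Ob \<G>) (Mor \<H>) \<eta> \<and> continuous_map (Ob \<G>) (Mor \<H>) \<eta>' \<and>
     (\<forall>x\<in>topspace (Ob \<G>). src \<H> (\<eta> x) = fst F x \<and> tgt \<H> (\<eta> x) = fst F' x \<and>
        src \<H> (\<eta>' x) = fst F' x \<and> tgt \<H> (\<eta>' x) = fst F x \<and>
        cmp \<H> (\<eta>' x) (\<eta> x) = idm \<H> (fst F x) \<and> cmp \<H> (\<eta> x) (\<eta>' x) = idm \<H> (fst F' x)) \<and>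
     (\<forall>m\<in>topspace (Mor \<G>). cmp \<H> (\<eta> (tgt \<G> m)) (snd F m) = cmp \<H> (snd F' m) (\<eta> (src \<G> m))))"

definition functor_comp :: "('o', 'm', 'o'', 'm'') gfunctor \<Rightarrow> ('o, 'm, 'o', 'm') gfunctor \<Rightarrow>
    ('o, 'm, 'o'', 'm'') gfunctor" where
  "functor_comp F' F = (fst F' \<circ> fst F, snd F' \<circ> snd F)"

lemma functor_comp_simps [simp]:
  "fst (functor_comp F' F) x = fst F' (fst F x)" "snd (functor_comp F' F) m = snd F' (snd F m)"
  by (simp_all add: functor_comp_def)

lemma continuous_functor_comp:
  assumes F: "continuous_functor \<G> \<H> F" and F': "continuous_functor \<H> \<K> F'" and "pregroupoid \<G>"
  shows "continuous_functor \<G> \<K> (functor_comp F' F)"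
proof -
  interpret pregroupoid \<G> by fact
  have m: "snd F m \<in> topspace (Mor \<H>)" if "m \<in> topspace (Mor \<G>)" for m
    using F that continuous_map_mem by (fastforce simp: continuous_functor_def)
  have o: "fst F x \<in> topspace (Ob \<H>)" if "x \<in> topspace (Ob \<G>)" for x
    using F that continuous_map_mem by (fastforce simp: continuous_functor_def)
  show ?thesis
    unfolding continuous_functor_def
  proof (intro conjI ballI impI)
    show "continuous_map (Ob \<G>) (Ob \<K>) (fst (functor_comp F' F))"
      "continuous_map (Mor \<G>) (Mor \<K>) (snd (functor_comp F' F))"
      using F F' by (auto simp: continuous_functor_def functor_comp_def intro: continuous_map_compose)
  qed (use F F' m o in \<open>auto simp: continuous_functor_def\<close>)
qed

section \<open>Pullback of bundles along functors\<close>

lemma topspace_gbundle_pullback [simp]: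
  "(x, v) \<in> topspace (tot (gbundle_pullback \<G> F E)) \<longleftrightarrow> x \<in> topspace (Ob \<G>) \<and> v \<in> fibre (tot E) (fst F x)"
  by (auto simp: gbundle_pullback_def topspace_pullback_topology mem_fibre_iff)

lemma fibre_gbundle_pullback [simp]:
  "v \<in> fibre (tot (gbundle_pullback \<G> F E)) x \<longleftrightarrow> x \<in> topspace (Ob \<G>) \<and> v \<in> fibre (tot E) (fst F x)"
  by (simp add: mem_fibre_iff[of _ "tot (gbundle_pullback \<G> F E)"])

lemma act_gbundle_pullback [simp]: "act (gbundle_pullback \<G> F E) m = act E (snd F m)"
  by (simp add: gbundle_pullback_def)

text \<open>Universal property of the pullback topology, the counterpart of
  \<open>continuous_map_gbundle_sum\<close>.\<close>

lemma continuous_map_gbundle_pullback: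
  "continuous_map T (tot (gbundle_pullback \<G> F E)) (\<lambda>z. (a z, v z)) \<longleftrightarrow>
   continuous_map T (Ob \<G>) a \<and> continuous_map T (tot E) (\<lambda>z. (fst F (a z), v z))" (is "?L \<longleftrightarrow> ?R")
proof
  assume L: ?L
  have "continuous_map (tot (gbundle_pullback \<G> F E)) (prod_topology (Ob \<G>) (tot E))
      (id \<circ> (\<lambda>(x, v). (x, (fst F x, v))))"
    unfolding gbundle_pullback_def gbundle.simps by (intro continuous_map_pullback) simp
  from continuous_map_compose[OF L this] show ?R
    by (auto simp: continuous_map_pairwise o_def)
next
  assume R: ?R
  show ?L
    unfolding gbundle_pullback_def gbundle.simps
  proof (rule continuous_map_pullback')
    show "continuous_map T (prod_topology (Ob \<G>) (tot E)) ((\<lambda>(x, v). (x, (fst F x, v))) \<circ> (\<lambda>z. (a z, v z)))"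
      using R by (auto simp: continuous_map_pairwise o_def)
    show "topspace T \<subseteq> (\<lambda>z. (a z, v z)) -` {(x, v). x \<in> topspace (Ob \<G>) \<and> v \<in> fibre (tot E) (fst F x)}"
      using continuous_map_mem[of T "Ob \<G>" a] continuous_map_mem[of T "tot E" "\<lambda>z. (fst F (a z), v z)"] R
      by (auto simp: mem_fibre_iff)
  qed
qed

lemma continuous_map_from_gbundle_pullback:
  "continuous_map (tot (gbundle_pullback \<G> F E)) (Ob \<G>) fst"
  "continuous_map (tot (gbundle_pullback \<G> F E)) (tot E) (\<lambda>e. (fst F (fst e), snd e))"
  using continuous_map_gbundle_pullback[of "tot (gbundle_pullback \<G> F E)" \<G> F E fst snd] by auto

lemma vector_bundle_pullback:
  assumes F: "continuous_map (Ob \<G>) B (fst F)" and E: "vector_bundle B (tot E)"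
  shows "vector_bundle (Ob \<G>) (tot (gbundle_pullback \<G> F E))"
  unfolding vector_bundle_iff
proof (intro conjI ballI)
  let ?P = "tot (gbundle_pullback \<G> F E)"
  show "continuous_map ?P (Ob \<G>) fst"
    by (rule continuous_map_from_gbundle_pullback)
  fix x assume x: "x \<in> topspace (Ob \<G>)"
  then have Fx: "fst F x \<in> topspace B"
    by (rule continuous_map_mem[OF F])
  show "csubspace (fibre ?P x)"
    using E Fx x by (auto simp: vector_bundle_def csubspace_def)
  obtain U n f f' where U: "openin B U" "fst F x \<in> U" and f: "local_triv B (tot E) U n f f'"
    using E Fx vector_bundle_iff by metis
  let ?U = "{x \<in> topspace (Ob \<G>). fst F x \<in> U}"
  have "local_triv (Ob \<G>) ?P ?U n (\<lambda>y. f (fst F y)) (\<lambda>y. f' (fst F y))"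
    unfolding local_triv_def
  proof (intro conjI)
    show "\<forall>y\<in>?U. clinear_on (fibre ?P y) (f (fst F y)) \<and>
        (\<forall>v\<in>fibre ?P y. f (fst F y) v \<in> Cn n \<and> f' (fst F y) (f (fst F y) v) = v) \<and>
        (\<forall>w\<in>Cn n. f' (fst F y) w \<in> fibre ?P y \<and> f (fst F y) (f' (fst F y) w) = w)"
      using f by (auto simp: local_triv_def clinear_on_def)
    have 1: "continuous_map (subtopology (tot E) {e. fst e \<in> U}) euclidean (\<lambda>(y, v). f y v)"
      and 2: "continuous_map (prod_topology (subtopology B U) (top_of_set (Cn n))) (tot E) (\<lambda>(y, w). (y, f' y w))"
      using f by (simp_all add: local_triv_def)
    have "continuous_map (subtopology ?P {e. fst e \<in> ?U}) (subtopology (tot E) {e. fst e \<in> U})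
        (\<lambda>e. (fst F (fst e), snd e))"
      by (auto simp: continuous_map_in_subtopology
          intro: continuous_map_from_subtopology continuous_map_from_gbundle_pullback)
    from continuous_map_compose[OF this 1]
    show "continuous_map (subtopology ?P {e. fst e \<in> ?U}) euclidean (\<lambda>(y, v). f (fst F y) v)"
      by (simp add: o_def case_prod_unfold)
    let ?Q = "prod_topology (subtopology (Ob \<G>) ?U) (top_of_set (Cn n))"
    have p: "continuous_map ?Q (Ob \<G>) fst"
      by (rule continuous_map_into_fulltopology[OF continuous_map_fst])
    have "continuous_map ?Q B (\<lambda>e. fst F (fst e))"
      using continuous_map_compose[OF p F] by (simp add: o_def)
    then have "continuous_map ?Q (prod_topology (subtopology B U) (top_of_set (Cn n))) (\<lambda>e. (fst F (fst e), snd e))"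
      by (auto simp: continuous_map_pairwise o_def continuous_map_in_subtopology
          intro: continuous_map_into_fulltopology[OF continuous_map_snd])
    from continuous_map_compose[OF this 2] p show "continuous_map ?Q ?P (\<lambda>(y, w). (y, f' (fst F y) w))"
      by (simp add: o_def case_prod_unfold continuous_map_gbundle_pullback)
  qed
  moreover have "openin (Ob \<G>) ?U"
    by (rule openin_continuous_map_preimage[OF F U(1)])
  ultimately show "\<exists>U n f f'. openin (Ob \<G>) U \<and> x \<in> U \<and> local_triv (Ob \<G>) ?P U n f f'"
    using x U(2) by blast
qed

lemma groupoid_bundle_pullback:
  assumes "pregroupoid \<G>" and F: "continuous_functor \<G> \<H> F" and E: "groupoid_bundle \<H> E"
  shows "groupoid_bundle \<G> (gbundle_pullback \<G> F E)"
proof -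
  interpret pregroupoid \<G> by fact
  let ?P = "gbundle_pullback \<G> F E"
  have m: "snd F m \<in> topspace (Mor \<H>)" "src \<G> m \<in> topspace (Ob \<G>)" "tgt \<G> m \<in> topspace (Ob \<G>)"
    "src \<H> (snd F m) = fst F (src \<G> m)" "tgt \<H> (snd F m) = fst F (tgt \<G> m)"
    if "m \<in> topspace (Mor \<G>)" for m
    using F that continuous_map_mem src_cont tgt_cont by (fastforce simp: continuous_functor_def)+
  show ?thesis
  proof (rule groupoid_bundleI)
    show "vector_bundle (Ob \<G>) (tot ?P)"
      using F groupoid_bundleD(1)[OF E] by (intro vector_bundle_pullback) (auto simp: continuous_functor_def)
    show "act ?P m v \<in> fibre (tot ?P) (tgt \<G> m)" if "m \<in> topspace (Mor \<G>)" "v \<in> fibre (tot ?P) (src \<G> m)" for m v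
      using groupoid_bundleD(4)[OF E m(1)[OF that(1)]] m that by simp
    show "clinear_on (fibre (tot ?P) (src \<G> m)) (act ?P m)" if "m \<in> topspace (Mor \<G>)" for m
      using groupoid_bundleD(5)[OF E m(1)[OF that]] m[OF that] by (simp add: clinear_on_def)
    show "act ?P (idm \<G> x) v = v" if "x \<in> topspace (Ob \<G>)" "v \<in> fibre (tot ?P) x" for x v
      using groupoid_bundleD(6)[OF E] that F by (simp add: continuous_functor_def)
    show "act ?P (cmp \<G> m k) v = act ?P m (act ?P k v)"
      if "m \<in> topspace (Mor \<G>)" "k \<in> topspace (Mor \<G>)" "src \<G> m = tgt \<G> k" "v \<in> fibre (tot ?P) (src \<G> k)" for m k v
      using groupoid_bundleD(7)[OF E m(1)[OF that(1)] m(1)[OF that(2)]] m[OF that(1)] m[OF that(2)] that F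
      by (simp add: continuous_functor_def)
    let ?Z = "subtopology (prod_topology (Mor \<G>) (tot ?P)) {(m, e). src \<G> m = fst e}"
    have Z: "continuous_map ?Z (Mor \<G>) fst" "continuous_map ?Z (tot ?P) snd"
      by (auto intro: continuous_map_from_subtopology continuous_map_fst continuous_map_snd)
    have 1: "continuous_map ?Z (Mor \<H>) (\<lambda>z. snd F (fst z))"
      using continuous_map_compose[OF Z(1)] F by (auto simp: continuous_functor_def o_def)
    have 2: "continuous_map ?Z (tot E) (\<lambda>z. (fst F (fst (snd z)), snd (snd z)))"
      using continuous_map_compose[OF Z(2) continuous_map_from_gbundle_pullback(2)] by (simp add: o_def)
    have "continuous_map ?Z (tot E) (\<lambda>z. (tgt \<H> (snd F (fst z)), act E (snd F (fst z)) (snd (snd z))))"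
      by (rule continuous_map_act[OF E 1 2]) (auto simp: m)
    then have 3: "continuous_map ?Z (tot E) (\<lambda>z. (fst F (tgt \<G> (fst z)), act E (snd F (fst z)) (snd (snd z))))"
      by (rule continuous_map_eq) (auto simp: m)
    have 4: "continuous_map ?Z (Ob \<G>) (\<lambda>z. tgt \<G> (fst z))"
      using continuous_map_compose[OF Z(1) tgt_cont] by (simp add: o_def)
    from 3 4 show "continuous_map ?Z (tot ?P) (\<lambda>(m, e). (tgt \<G> m, act ?P m (snd e)))"
      by (simp add: case_prod_unfold continuous_map_gbundle_pullback)
  qed
qed

text \<open>An equality and not only an isomorphism: both total spaces consist of the same pairs and
  admit the same continuous maps into them.\<close>

lemma gbundle_pullback_sum:
  "gbundle_pullback \<G> F (gbundle_sum E E') = gbundle_sum (gbundle_pullback \<G> F E) (gbundle_pullback \<G> F E')"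
  (is "?L = ?R")
proof -
  have L: "continuous_map (tot ?L) (Ob \<G>) fst"
    "continuous_map (tot ?L) (tot E) (\<lambda>e. (fst F (fst e), evens (snd e)))"
    "continuous_map (tot ?L) (tot E') (\<lambda>e. (fst F (fst e), odds (snd e)))"
    using continuous_map_gbundle_pullback[of "tot ?L" \<G> F "gbundle_sum E E'" fst snd]
    by (auto simp: continuous_map_gbundle_sum)
  have R: "continuous_map (tot ?R) (Ob \<G>) fst"
    "continuous_map (tot ?R) (tot E) (\<lambda>e. (fst F (fst e), evens (snd e)))"
    "continuous_map (tot ?R) (tot E') (\<lambda>e. (fst F (fst e), odds (snd e)))"
    using continuous_map_gbundle_sum[of "tot ?R" "gbundle_pullback \<G> F E" "gbundle_pullback \<G> F E'" fst snd]
    by (auto simp: continuous_map_gbundle_pullback)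
  have "tot ?L = tot ?R"
    using continuous_map_gbundle_sum[of "tot ?L" "gbundle_pullback \<G> F E" "gbundle_pullback \<G> F E'" fst snd]
      continuous_map_gbundle_pullback[of "tot ?R" \<G> F "gbundle_sum E E'" fst snd] L R
    by (intro topology_eq_via_id) (simp_all add: continuous_map_gbundle_pullback continuous_map_gbundle_sum)
  moreover have "act ?L = act ?R"
    by (intro ext) simp
  ultimately show ?thesis
    by simp
qed

text \<open>The two-step pullback also records a projection to \<open>Ob \<H>\<close>; continuity of
  \<open>F\<close> on objects supplies it from the projection to \<open>Ob \<G>\<close>.\<close>

lemma gbundle_pullback_comp:
  assumes F: "continuous_map (Ob \<G>) (Ob \<H>) (fst F)"
  shows "gbundle_pullback \<G> F (gbundle_pullback \<H> F' E) = gbundle_pullback \<G> (functor_comp F' F) E"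
  (is "?L = ?R")
proof -
  have L: "continuous_map (tot ?L) (Ob \<G>) fst"
    "continuous_map (tot ?L) (tot E) (\<lambda>e. (fst F' (fst F (fst e)), snd e))"
    using continuous_map_gbundle_pullback[of "tot ?L" \<G> F "gbundle_pullback \<H> F' E" fst snd]
    by (auto simp: continuous_map_gbundle_pullback)
  have R: "continuous_map (tot ?R) (Ob \<G>) fst"
    "continuous_map (tot ?R) (tot E) (\<lambda>e. (fst F' (fst F (fst e)), snd e))"
    using continuous_map_from_gbundle_pullback[of \<G> "functor_comp F' F" E] by auto
  have R': "continuous_map (tot ?R) (Ob \<H>) (\<lambda>e. fst F (fst e))"
    using continuous_map_compose[OF R(1) F] by (simp add: o_def)
  have "tot ?L = tot ?R"
    using continuous_map_gbundle_pullback[of "tot ?L" \<G> "functor_comp F' F" E fst snd]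
      continuous_map_gbundle_pullback[of "tot ?R" \<G> F "gbundle_pullback \<H> F' E" fst snd] L R R'
    by (intro topology_eq_via_id) (simp_all add: continuous_map_gbundle_pullback)
  moreover have "act ?L = act ?R"
    by (intro ext) simp
  ultimately show ?thesis
    by simp
qed

lemma gbundle_pullback_id:
  assumes "groupoid_bundle \<G> E"
  shows "gbundle_pullback \<G> (id, id) E = E"
proof -
  let ?P = "gbundle_pullback \<G> (id, id) E"
  have "tot ?P = tot E"
    using continuous_map_gbundle_pullback[of "tot E" \<G> "(id, id)" E fst snd] groupoid_bundleD(2)[OF assms]
      continuous_map_from_gbundle_pullback[of \<G> "(id, id)" E]
    by (intro topology_eq_via_id) simp_all
  moreover have "act ?P = act E"
    by (intro ext) simp
  ultimately show ?thesis
    by simp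
qed

lemma gbundle_pullback_iso:
  assumes "pregroupoid \<G>" and F: "continuous_functor \<G> \<H> F" and iso: "gbundle_iso \<H> E E'"
  shows "gbundle_iso \<G> (gbundle_pullback \<G> F E) (gbundle_pullback \<G> F E')"
  using iso
proof (rule gbundle_isoE)
  interpret pregroupoid \<G> by fact
  fix f f' assume "gbundle_iso_via \<H> E E' f f'"
  note f = gbundle_iso_viaD[OF this]
  have m: "snd F m \<in> topspace (Mor \<H>)" "src \<H> (snd F m) = fst F (src \<G> m)" "tgt \<H> (snd F m) = fst F (tgt \<G> m)"
    if "m \<in> topspace (Mor \<G>)" for m
    using F that continuous_map_mem by (fastforce simp: continuous_functor_def)+
  have o: "fst F x \<in> topspace (Ob \<H>)" if "x \<in> topspace (Ob \<G>)" for x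
    using F that continuous_map_mem by (fastforce simp: continuous_functor_def)
  let ?P = "gbundle_pullback \<G> F E" and ?P' = "gbundle_pullback \<G> F E'"
  show ?thesis
  proof (rule gbundle_isoI[where f = "\<lambda>x. f (fst F x)" and f' = "\<lambda>x. f' (fst F x)"])
    show "continuous_map (tot ?P) (tot ?P') (\<lambda>(x, v). (x, f (fst F x) v))"
      using continuous_map_compose[OF continuous_map_from_gbundle_pullback(2)[of \<G> F E] f(1)]
      by (simp add: case_prod_unfold continuous_map_gbundle_pullback continuous_map_from_gbundle_pullback o_def)
    show "continuous_map (tot ?P') (tot ?P) (\<lambda>(x, v). (x, f' (fst F x) v))"
      using continuous_map_compose[OF continuous_map_from_gbundle_pullback(2)[of \<G> F E'] f(2)]
      by (simp add: case_prod_unfold continuous_map_gbundle_pullback continuous_map_from_gbundle_pullback o_def)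
    show "clinear_on (fibre (tot ?P) x) (f (fst F x))" if "x \<in> topspace (Ob \<G>)" for x
      using f(5)[OF o[OF that]] that by (simp add: clinear_on_def)
    show "f (fst F (tgt \<G> m)) (act ?P m v) = act ?P' m (f (fst F (src \<G> m)) v)"
      if "m \<in> topspace (Mor \<G>)" "v \<in> fibre (tot ?P) (src \<G> m)" for m v
      using f(6)[OF m(1)[OF that(1)]] m that by simp
  qed (use f in auto)
qed

text \<open>The arrow \<eta> x acts on \<open>E\<close> as a linear map from the fibre over
  \<open>fst F x\<close> to the fibre over \<open>fst F' x\<close>. Compatibility of the action with
  composition makes \<eta>' x act as its inverse, and naturality of \<eta> is equivariance.\<close>

lemma gbundle_pullback_nat_iso:
  assumes "pregroupoid \<G>" and F: "continuous_functor \<G> \<H> F" and F': "continuous_functor \<G> \<H> F'"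
    and nat: "nat_iso \<G> \<H> F F'" and E: "groupoid_bundle \<H> E"
  shows "gbundle_iso \<G> (gbundle_pullback \<G> F E) (gbundle_pullback \<G> F' E)"
proof -
  interpret pregroupoid \<G> by fact
  let ?P = "gbundle_pullback \<G> F E" and ?P' = "gbundle_pullback \<G> F' E"
  obtain \<eta> \<eta>' where cont: "continuous_map (Ob \<G>) (Mor \<H>) \<eta>" "continuous_map (Ob \<G>) (Mor \<H>) \<eta>'"
    and \<eta>: "\<And>x. x \<in> topspace (Ob \<G>) \<Longrightarrow> src \<H> (\<eta> x) = fst F x \<and> tgt \<H> (\<eta> x) = fst F' x \<and>
        src \<H> (\<eta>' x) = fst F' x \<and> tgt \<H> (\<eta>' x) = fst F x \<and>
        cmp \<H> (\<eta>' x) (\<eta> x) = idm \<H> (fst F x) \<and> cmp \<H> (\<eta> x) (\<eta>' x) = idm \<H> (fst F' x)"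
    and natural: "\<And>m. m \<in> topspace (Mor \<G>) \<Longrightarrow>
        cmp \<H> (\<eta> (tgt \<G> m)) (snd F m) = cmp \<H> (snd F' m) (\<eta> (src \<G> m))"
    using nat unfolding nat_iso_def by metis
  have mem: "\<eta> x \<in> topspace (Mor \<H>)" "\<eta>' x \<in> topspace (Mor \<H>)" if "x \<in> topspace (Ob \<G>)" for x
    using cont that continuous_map_mem by fastforce+
  have m: "snd F m \<in> topspace (Mor \<H>)" "src \<H> (snd F m) = fst F (src \<G> m)" "tgt \<H> (snd F m) = fst F (tgt \<G> m)"
     "snd F' m \<in> topspace (Mor \<H>)" "src \<H> (snd F' m) = fst F' (src \<G> m)" "tgt \<H> (snd F' m) = fst F' (tgt \<G> m)"
     "src \<G> m \<in> topspace (Ob \<G>)" "tgt \<G> m \<in> topspace (Ob \<G>)"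
    if "m \<in> topspace (Mor \<G>)" for m
    using F F' that continuous_map_mem src_cont tgt_cont by (fastforce simp: continuous_functor_def)+
  have c: "continuous_map (tot (gbundle_pullback \<G> A E)) (tot (gbundle_pullback \<G> B E)) (\<lambda>(x, v). (x, act E (\<theta> x) v))"
    if "continuous_map (Ob \<G>) (Mor \<H>) \<theta>"
      "\<And>x. x \<in> topspace (Ob \<G>) \<Longrightarrow> src \<H> (\<theta> x) = fst A x \<and> tgt \<H> (\<theta> x) = fst B x" for \<theta> A B
  proof -
    let ?A = "tot (gbundle_pullback \<G> A E)"
    have "continuous_map ?A (tot E) (\<lambda>z. (tgt \<H> (\<theta> (fst z)), act E (\<theta> (fst z)) (snd z)))"
    proof (rule continuous_map_act[OF E])
      show "continuous_map ?A (Mor \<H>) (\<lambda>z. \<theta> (fst z))"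
        using continuous_map_compose[OF continuous_map_from_gbundle_pullback(1) that(1)] by (simp add: o_def)
      show "continuous_map ?A (tot E) (\<lambda>z. (fst A (fst z), snd z))"
        by (rule continuous_map_from_gbundle_pullback)
    qed (use that in auto)
    then have "continuous_map ?A (tot E) (\<lambda>z. (fst B (fst z), act E (\<theta> (fst z)) (snd z)))"
      by (rule continuous_map_eq) (use that in auto)
    then show ?thesis
      by (simp add: case_prod_unfold continuous_map_gbundle_pullback continuous_map_from_gbundle_pullback)
  qed
  show ?thesis
  proof (rule gbundle_isoI[OF c[OF cont(1)] c[OF cont(2)]])
    fix x v assume "v \<in> fibre (tot ?P) x"
    then show "act E (\<eta>' x) (act E (\<eta> x) v) = v"
      using groupoid_bundleD(7)[OF E mem(2) mem(1), of x x v] \<eta>[of x] groupoid_bundleD(6)[OF E] by auto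
  next
    fix x v assume "v \<in> fibre (tot ?P') x"
    then show "act E (\<eta> x) (act E (\<eta>' x) v) = v"
      using groupoid_bundleD(7)[OF E mem(1) mem(2), of x x v] \<eta>[of x] groupoid_bundleD(6)[OF E] by auto
  next
    fix x assume "x \<in> topspace (Ob \<G>)"
    then show "clinear_on (fibre (tot ?P) x) (act E (\<eta> x))"
      using groupoid_bundleD(5)[OF E mem(1), of x] \<eta>[of x] by (simp add: clinear_on_def)
  next
    fix k v assume k: "k \<in> topspace (Mor \<G>)" and v: "v \<in> fibre (tot ?P) (src \<G> k)"
    show "act E (\<eta> (tgt \<G> k)) (act ?P k v) = act ?P' k (act E (\<eta> (src \<G> k)) v)"
      using groupoid_bundleD(7)[OF E mem(1)[OF m(8)[OF k]] m(1)[OF k], of v]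
        groupoid_bundleD(7)[OF E m(4)[OF k] mem(1)[OF m(7)[OF k]], of v] natural[OF k] m[OF k] v
        \<eta>[OF m(7)[OF k]] \<eta>[OF m(8)[OF k]] by simp
  qed (use \<eta> in auto)
qed

section \<open>The zero bundle and the neutral element\<close>

lemma zero_cseq [simp]: "csubspace {\<lambda>i. 0}" "Cn 0 = {\<lambda>i. 0}"
  by (auto simp: csubspace_def Cn_def)

lemma fibre_zero_gbundle [simp]:
  "v \<in> fibre (tot (zero_gbundle \<G>)) x \<longleftrightarrow> x \<in> topspace (Ob \<G>) \<and> v = (\<lambda>i. 0)"
  by (simp add: zero_gbundle_def mem_fibre_iff)

lemma continuous_map_zero_gbundle:
  "continuous_map T (tot (zero_gbundle \<G>)) (\<lambda>z. (a z, v z)) \<longleftrightarrow>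
   continuous_map T (Ob \<G>) a \<and> (\<forall>z\<in>topspace T. v z = (\<lambda>i. 0))"
  by (auto simp: zero_gbundle_def continuous_map_pairwise o_def continuous_map_in_subtopology
      intro: continuous_map_eq[OF continuous_map_const[THEN iffD2]])

lemma groupoid_bundle_zero:
  assumes "pregroupoid \<G>"
  shows "groupoid_bundle \<G> (zero_gbundle \<G>)"
proof -
  interpret pregroupoid \<G> by fact
  let ?T = "tot (zero_gbundle \<G>)"
  have top: "e \<in> topspace ?T \<longleftrightarrow> fst e \<in> topspace (Ob \<G>) \<and> snd e = (\<lambda>i. 0)" for e
    by (cases e) (simp add: zero_gbundle_def)
  have [simp]: "act (zero_gbundle \<G>) m v = v" for m v
    by (simp add: zero_gbundle_def)
  have fst: "continuous_map ?T (Ob \<G>) fst"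
    using continuous_map_zero_gbundle[of ?T \<G> fst snd] by simp
  show ?thesis
  proof (rule groupoid_bundleI)
    show "vector_bundle (Ob \<G>) ?T"
      unfolding vector_bundle_iff
    proof (intro conjI ballI)
      show "continuous_map ?T (Ob \<G>) fst" by (rule fst)
      fix x assume x: "x \<in> topspace (Ob \<G>)"
      show "csubspace (fibre ?T x)"
        using x by (auto simp: csubspace_def)
      have "continuous_map (prod_topology (Ob \<G>) (top_of_set {\<lambda>i::nat. 0::complex})) ?T (\<lambda>(y, w). (y, w))"
        by (simp add: zero_gbundle_def case_prod_unfold)
      moreover have "continuous_map ?T euclidean (\<lambda>e. snd e)"
        by (rule continuous_map_eq[of _ _ "\<lambda>e i. 0"]) (auto simp: top)
      ultimately have "local_triv (Ob \<G>) ?T (topspace (Ob \<G>)) 0 (\<lambda>y v. v) (\<lambda>y v. v)"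
        by (auto simp: local_triv_def clinear_on_def case_prod_unfold intro: continuous_map_from_subtopology)
      then show "\<exists>U n f f'. openin (Ob \<G>) U \<and> x \<in> U \<and> local_triv (Ob \<G>) ?T U n f f'"
        using x by blast
    qed
    let ?Z = "subtopology (prod_topology (Mor \<G>) ?T) {(m, e). src \<G> m = fst e}"
    have "continuous_map ?Z (Ob \<G>) (\<lambda>z. tgt \<G> (fst z))"
      using continuous_map_compose[OF continuous_map_from_subtopology[OF continuous_map_fst] tgt_cont]
      by (simp add: o_def)
    then show "continuous_map ?Z ?T (\<lambda>(m, e). (tgt \<G> m, act (zero_gbundle \<G>) m (snd e)))"
      by (auto simp: case_prod_unfold continuous_map_zero_gbundle top)
  qed (use continuous_map_mem[OF tgt_cont] in \<open>auto simp: clinear_on_def\<close>)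
qed

lemma gbundle_pullback_zero:
  assumes F: "continuous_map (Ob \<G>) (Ob \<H>) (fst F)"
  shows "gbundle_pullback \<G> F (zero_gbundle \<H>) = zero_gbundle \<G>" (is "?L = ?R")
proof -
  have R: "continuous_map (tot ?R) (Ob \<G>) fst" "\<forall>z\<in>topspace (tot ?R). snd z = (\<lambda>i. 0)"
    using continuous_map_zero_gbundle[of "tot ?R" \<G> fst snd] by simp_all
  have L: "continuous_map (tot ?L) (Ob \<G>) fst" "\<forall>z\<in>topspace (tot ?L). snd z = (\<lambda>i. 0)"
    using continuous_map_gbundle_pullback[of "tot ?L" \<G> F "zero_gbundle \<H>" fst snd]
    by (simp_all add: continuous_map_zero_gbundle)
  have "continuous_map (tot ?R) (Ob \<H>) (\<lambda>z. fst F (fst z))"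
    using continuous_map_compose[OF R(1) F] by (simp add: o_def)
  then have "tot ?L = tot ?R"
    using continuous_map_gbundle_pullback[of "tot ?R" \<G> F "zero_gbundle \<H>" fst snd]
      continuous_map_zero_gbundle[of "tot ?L" \<G> fst snd] L R
    by (intro topology_eq_via_id) (simp_all add: continuous_map_zero_gbundle)
  moreover have "act ?L = act ?R"
    by (intro ext) (simp add: zero_gbundle_def)
  ultimately show ?thesis
    by simp
qed

lemma one_K_group: "\<one>\<^bsub>K_group \<G>\<^esub> = K_class \<G> (zero_gbundle \<G>) (zero_gbundle \<G>)"
  by (simp add: K_group_def K_class_def)

lemma one_K_group_closed: "pregroupoid \<G> \<Longrightarrow> \<one>\<^bsub>K_group \<G>\<^esub> \<in> carrier (K_group \<G>)"
  using groupoid_bundle_zero by (auto simp: one_K_group carrier_K_group)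

text \<open>Pullback preserves isomorphisms and commutes with sums, so a stable isomorphism between
  representatives pulls back to a stable isomorphism, with the pulled back stabilising
  summand.\<close>

lemma K_group_map_K_class:
  assumes \<G>: "pregroupoid \<G>" and F: "continuous_functor \<G> \<H> F"
    and gb: "groupoid_bundle \<H> E" "groupoid_bundle \<H> E'"
  shows "K_group_map \<G> F (K_class \<H> E E') = K_class \<G> (gbundle_pullback \<G> F E) (gbundle_pullback \<G> F E')"
proof -
  note pb = groupoid_bundle_pullback[OF \<G> F]
  have *: "K_class \<G> (gbundle_pullback \<G> F A) (gbundle_pullback \<G> F B) =
      K_class \<G> (gbundle_pullback \<G> F E) (gbundle_pullback \<G> F E')"
    if AB: "(A, B) \<in> K_class \<H> E E'" for A B
  proof -
    note d = mem_K_classD[OF AB]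
    obtain H where H: "groupoid_bundle \<H> H"
      "gbundle_iso \<H> (gbundle_sum (gbundle_sum A E') H) (gbundle_sum (gbundle_sum E B) H)"
      using d(3) unfolding K_class_eq_iff[OF d(1,2) gb] by blast
    show ?thesis
      unfolding K_class_eq_iff[OF pb[OF d(1)] pb[OF d(2)] pb[OF gb(1)] pb[OF gb(2)]]
      using gbundle_pullback_iso[OF \<G> F H(2)] pb[OF H(1)] by (auto simp: gbundle_pullback_sum)
  qed
  show ?thesis
    unfolding K_group_map_def K_class_def[symmetric, of \<G>]
    by (rule UN_case_prod_const[OF mem_K_class_self[OF gb] *])
qed

context
  fixes \<G> :: "('o, 'm) tgroupoid" and \<H> :: "('o', 'm') tgroupoid" and F :: "('o, 'm, 'o', 'm') gfunctor"
  assumes \<G>: "pregroupoid \<G>" and F: "continuous_functor \<G> \<H> F"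
begin

lemma K_group_map_closed:
  assumes "\<xi> \<in> carrier (K_group \<H>)"
  shows "K_group_map \<G> F \<xi> \<in> carrier (K_group \<G>)"
  using assms groupoid_bundle_pullback[OF \<G> F]
  by (auto simp: carrier_K_group[of _ \<H>] K_group_map_K_class[OF \<G> F]) (auto simp: carrier_K_group)

lemma K_group_map_mult:
  assumes "\<xi> \<in> carrier (K_group \<H>)" "\<zeta> \<in> carrier (K_group \<H>)"
  shows "K_group_map \<G> F (\<xi> \<otimes>\<^bsub>K_group \<H>\<^esub> \<zeta>) = K_group_map \<G> F \<xi> \<otimes>\<^bsub>K_group \<G>\<^esub> K_group_map \<G> F \<zeta>"
  using assms groupoid_bundle_pullback[OF \<G> F]
  by (auto simp: carrier_K_group[of _ \<H>] mult_K_group K_group_map_K_class[OF \<G> F] groupoid_bundle_sum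
      gbundle_pullback_sum)

lemma K_group_map_one:
  assumes "pregroupoid \<H>"
  shows "K_group_map \<G> F \<one>\<^bsub>K_group \<H>\<^esub> = \<one>\<^bsub>K_group \<G>\<^esub>"
  using F groupoid_bundle_zero[OF assms]
  by (simp add: one_K_group K_group_map_K_class[OF \<G> F] gbundle_pullback_zero continuous_functor_def)

lemma K_group_map_comp:
  assumes \<H>: "pregroupoid \<H>" and F': "continuous_functor \<H> \<K> F'" and "\<xi> \<in> carrier (K_group \<K>)"
  shows "K_group_map \<G> F (K_group_map \<H> F' \<xi>) = K_group_map \<G> (functor_comp F' F) \<xi>"
  using assms(3) groupoid_bundle_pullback[OF \<H> F'] F
  by (auto simp: carrier_K_group K_group_map_K_class[OF \<G> F] K_group_map_K_class[OF \<H> F']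
      K_group_map_K_class[OF \<G> continuous_functor_comp[OF F F' \<G>]] gbundle_pullback_comp continuous_functor_def)

lemma K_group_map_nat_iso:
  assumes F': "continuous_functor \<G> \<H> F'" and nat: "nat_iso \<G> \<H> F F'" and "\<xi> \<in> carrier (K_group \<H>)"
  shows "K_group_map \<G> F \<xi> = K_group_map \<G> F' \<xi>"
proof -
  obtain E E' where "groupoid_bundle \<H> E" "groupoid_bundle \<H> E'" "\<xi> = K_class \<H> E E'"
    using assms(3) by (auto simp: carrier_K_group)
  then show ?thesis
    using groupoid_bundle_pullback[OF \<G> F] groupoid_bundle_pullback[OF \<G> F']
      gbundle_pullback_nat_iso[OF \<G> F F' nat]
    by (simp add: K_group_map_K_class[OF \<G> F] K_group_map_K_class[OF \<G> F'] K_class_eqI)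
qed

end

lemma continuous_functor_id: "continuous_functor \<G> \<G> (id, id)"
  by (simp add: continuous_functor_def)

lemma K_group_map_id:
  assumes "pregroupoid \<G>" "\<xi> \<in> carrier (K_group \<G>)"
  shows "K_group_map \<G> (id, id) \<xi> = \<xi>"
  using assms by (auto simp: carrier_K_group K_group_map_K_class[OF _ continuous_functor_id] gbundle_pullback_id)

text \<open>Isomorphic functors induce the same map, so a quasi-inverse functor induces a genuine
  two-sided inverse.\<close>

lemma bij_betw_K_group_map:
  assumes \<G>: "pregroupoid \<G>" and \<H>: "pregroupoid \<H>"
    and F: "continuous_functor \<G> \<H> F" and P: "continuous_functor \<H> \<G> P"
    and PF: "nat_iso \<G> \<G> (functor_comp P F) (id, id)" and FP: "nat_iso \<H> \<H> (functor_comp F P) (id, id)"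
  shows "bij_betw (K_group_map \<G> F) (carrier (K_group \<H>)) (carrier (K_group \<G>))"
proof (rule bij_betw_byWitness[where f' = "K_group_map \<H> P"])
  show "\<forall>\<xi>\<in>carrier (K_group \<H>). K_group_map \<H> P (K_group_map \<G> F \<xi>) = \<xi>"
    by (simp add: K_group_map_comp[OF \<H> P \<G> F] K_group_map_id[OF \<H>]
        K_group_map_nat_iso[OF \<H> continuous_functor_comp[OF P F \<H>] continuous_functor_id FP])
  show "\<forall>\<xi>\<in>carrier (K_group \<G>). K_group_map \<G> F (K_group_map \<H> P \<xi>) = \<xi>"
    by (simp add: K_group_map_comp[OF \<G> F \<H> P] K_group_map_id[OF \<G>]
        K_group_map_nat_iso[OF \<G> continuous_functor_comp[OF F P \<G>] continuous_functor_id PF])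
qed (auto simp: K_group_map_closed[OF \<G> F] K_group_map_closed[OF \<H> P])

section \<open>Decomposition into open and closed pieces\<close>

text \<open>The labelling \<open>d\<close> cuts \<open>X\<close> into disjoint open sets, so pasting
  has no agreement on overlaps to check.\<close>

lemma continuous_map_on_pieces:
  assumes "\<And>j. j \<in> I \<Longrightarrow> openin X {x \<in> topspace X. d x = j}" "\<And>x. x \<in> topspace X \<Longrightarrow> d x \<in> I"
    and "\<And>j. j \<in> I \<Longrightarrow> continuous_map (subtopology X {x. d x = j}) Y f"
  shows "continuous_map X Y f"
proof (rule pasting_lemma[where I = I and T = "\<lambda>j. {x \<in> topspace X. d x = j}" and f = "\<lambda>j. f"])
  show "continuous_map (subtopology X {x \<in> topspace X. d x = j}) Y f" if "j \<in> I" for j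
    by (rule continuous_map_from_subtopology_mono[OF assms(3)[OF that]]) auto
qed (use assms in auto)

text \<open>Only the source of an arrow is constrained. When the label \<open>c\<close> is constant
  along arrows, as required below, the target then lies in the same piece, and this is the full
  subgroupoid.\<close>

definition restrict_gpd :: "('o, 'm) tgroupoid \<Rightarrow> ('o \<Rightarrow> 'i) \<Rightarrow> 'i \<Rightarrow> ('o, 'm) tgroupoid" where
  "restrict_gpd \<G> c j = \<G>\<lparr>Ob := subtopology (Ob \<G>) {x. c x = j},
     Mor := subtopology (Mor \<G>) {m. c (src \<G> m) = j}\<rparr>"

lemma restrict_gpd_simps [simp]:
  "Ob (restrict_gpd \<G> c j) = subtopology (Ob \<G>) {x. c x = j}"
  "Mor (restrict_gpd \<G> c j) = subtopology (Mor \<G>) {m. c (src \<G> m) = j}"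
  "src (restrict_gpd \<G> c j) = src \<G>" "tgt (restrict_gpd \<G> c j) = tgt \<G>"
  "cmp (restrict_gpd \<G> c j) = cmp \<G>" "idm (restrict_gpd \<G> c j) = idm \<G>"
  by (simp_all add: restrict_gpd_def)

text \<open>Each piece is open, and closed as the complement of the union of the others. The last
  condition says that no arrow joins two different pieces.\<close>

locale decomposed_pregroupoid = pregroupoid \<G> for \<G> :: "('o, 'm) tgroupoid" +
  fixes c :: "'o \<Rightarrow> 'i" and I :: "'i set"
  assumes open_piece: "\<And>j. j \<in> I \<Longrightarrow> openin (Ob \<G>) {x \<in> topspace (Ob \<G>). c x = j}"
    and c_mem: "\<And>x. x \<in> topspace (Ob \<G>) \<Longrightarrow> c x \<in> I"
    and c_tgt: "\<And>m. m \<in> topspace (Mor \<G>) \<Longrightarrow> c (tgt \<G> m) = c (src \<G> m)"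
begin

abbreviation piece :: "'i \<Rightarrow> ('o, 'm) tgroupoid" where
  "piece j \<equiv> restrict_gpd \<G> c j"

lemma pregroupoid_piece: "pregroupoid (piece j)"
  by unfold_locales
    (auto simp: continuous_map_in_subtopology src_cont tgt_cont src_idm src_cmp c_tgt
      intro: continuous_map_from_subtopology)

lemma continuous_functor_piece: "continuous_functor (piece j) \<G> (id, id)"
  by (auto simp: continuous_functor_def intro: continuous_map_from_subtopology)

abbreviation restr :: "'i \<Rightarrow> ('o, 'm) gbundle \<Rightarrow> ('o, 'm) gbundle" where
  "restr j \<equiv> gbundle_pullback (piece j) (id, id)"

text \<open>Restriction to a piece is encoded as pullback along the inclusion functor
  \<open>(id, id)\<close>. These facts identify its total space with the part of
  \<open>tot E\<close> lying over the piece.\<close>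

lemma continuous_map_restr:
  assumes E: "groupoid_bundle \<G> E"
  shows "continuous_map (tot (restr j E)) (tot E) (\<lambda>e. e)"
    and "continuous_map (subtopology (tot E) {e. c (fst e) = j}) (tot (restr j E)) (\<lambda>e. e)"
    and "continuous_map X (tot E) f \<Longrightarrow> (\<And>x. x \<in> topspace X \<Longrightarrow> c (fst (f x)) = j) \<Longrightarrow>
      continuous_map X (tot (restr j E)) f"
proof -
  show "continuous_map (tot (restr j E)) (tot E) (\<lambda>e. e)"
    using continuous_map_from_gbundle_pullback(2)[of "piece j" "(id, id)" E] by simp
  show 1: "continuous_map (subtopology (tot E) {e. c (fst e) = j}) (tot (restr j E)) (\<lambda>e. e)"
    using continuous_map_gbundle_pullback[of "subtopology (tot E) {e. c (fst e) = j}" "piece j" "(id, id)" E fst snd]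
      groupoid_bundleD(2)[OF E]
    by (auto simp: continuous_map_in_subtopology intro: continuous_map_from_subtopology)
  show "continuous_map X (tot (restr j E)) f"
    if "continuous_map X (tot E) f" "\<And>x. x \<in> topspace X \<Longrightarrow> c (fst (f x)) = j"
    by (rule continuous_map_compose_eq[OF _ 1]) (use that in \<open>auto simp: continuous_map_in_subtopology\<close>)
qed

lemma openin_piece_bundle:
  assumes "groupoid_bundle \<G> E" "j \<in> I"
  shows "openin (tot E) {e \<in> topspace (tot E). c (fst e) = j}"
proof -
  have "{e \<in> topspace (tot E). fst e \<in> {x \<in> topspace (Ob \<G>). c x = j}} = {e \<in> topspace (tot E). c (fst e) = j}"
    using continuous_map_mem[OF groupoid_bundleD(2)[OF assms(1)]] by auto
  then show ?thesis
    using openin_continuous_map_preimage[OF groupoid_bundleD(2)[OF assms(1)] open_piece[OF assms(2)]] by simp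
qed

text \<open>Isomorphisms chosen independently over the pieces fit together, since each point uses
  only the one for its own label. Equivariance is a condition inside a single piece because source
  and target of an arrow carry the same label.\<close>

lemma gbundle_iso_pieces:
  assumes A: "groupoid_bundle \<G> A" and B: "groupoid_bundle \<G> B"
    and iso: "\<And>j. j \<in> I \<Longrightarrow> gbundle_iso (piece j) (restr j A) (restr j B)"
  shows "gbundle_iso \<G> A B"
proof -
  have "\<exists>f f'. gbundle_iso_via (piece j) (restr j A) (restr j B) f f'" if "j \<in> I" for j
    using iso[OF that] by (rule gbundle_isoE) blast
  then obtain f f' where "\<And>j. j \<in> I \<Longrightarrow> gbundle_iso_via (piece j) (restr j A) (restr j B) (f j) (f' j)"
    by metis
  note ff = gbundle_iso_viaD[OF this]
  have cont: "continuous_map (tot C) (tot D) (\<lambda>(x, v). (x, g (c x) x v))"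
    if C: "groupoid_bundle \<G> C" and D: "groupoid_bundle \<G> D"
      and g: "\<And>j. j \<in> I \<Longrightarrow> continuous_map (tot (restr j C)) (tot (restr j D)) (\<lambda>(x, v). (x, g j x v))"
    for C D and g :: "'i \<Rightarrow> 'o \<Rightarrow> cseq \<Rightarrow> cseq"
  proof (rule continuous_map_on_pieces[where I = I and d = "c \<circ> fst"])
    fix j assume j: "j \<in> I"
    show "openin (tot C) {x \<in> topspace (tot C). (c \<circ> fst) x = j}"
      using openin_piece_bundle[OF C j] by simp
    have "continuous_map (subtopology (tot C) {e. c (fst e) = j}) (tot D) (\<lambda>(x, v). (x, g j x v))"
      using continuous_map_compose[OF continuous_map_compose[OF continuous_map_restr(2)[OF C] g[OF j]]
          continuous_map_restr(1)[OF D]] by (simp add: o_def case_prod_unfold)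
    then show "continuous_map (subtopology (tot C) {x. (c \<circ> fst) x = j}) (tot D) (\<lambda>(x, v). (x, g (c x) x v))"
      unfolding o_def by (rule continuous_map_eq) auto
  next
    fix e assume "e \<in> topspace (tot C)"
    then show "(c \<circ> fst) e \<in> I"
      using continuous_map_mem[OF groupoid_bundleD(2)[OF C]] c_mem by simp
  qed
  have mem: "x \<in> topspace (Ob \<G>)" "c x \<in> I" if "v \<in> fibre (tot A) x \<or> v \<in> fibre (tot B) x" for x v
    using that groupoid_bundleD(3)[OF A] groupoid_bundleD(3)[OF B] c_mem by blast+
  show ?thesis
  proof (rule gbundle_isoI[OF cont[OF A B] cont[OF B A]])
    fix x assume x: "x \<in> topspace (Ob \<G>)"
    then show "clinear_on (fibre (tot A) x) (f (c x) x)"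
      using ff[OF c_mem[OF x]] by (simp add: clinear_on_def)
  next
    fix m v assume m: "m \<in> topspace (Mor \<G>)" and v: "v \<in> fibre (tot A) (src \<G> m)"
    show "f (c (tgt \<G> m)) (tgt \<G> m) (act A m v) = act B m (f (c (src \<G> m)) (src \<G> m) v)"
      using ff[OF mem(2)[OF disjI1[OF v]]] m v mem[of v] by (simp add: c_tgt)
  next
    fix x v assume v: "v \<in> fibre (tot A) x"
    show "f' (c x) x (f (c x) x v) = v"
      using ff[OF mem(2)[OF disjI1[OF v]]] v mem[of v] by simp
  next
    fix x v assume v: "v \<in> fibre (tot B) x"
    show "f (c x) x (f' (c x) x v) = v"
      using ff[OF mem(2)[OF disjI2[OF v]]] v mem[of v] by simp
  qed (use ff in auto)
qed

text \<open>The disjoint union of the total spaces \<open>tot (E j)\<close>, with its topology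
  transported to pairs \<open>(x, v)\<close>: the index of the summand is recovered from the base
  point as \<open>c x\<close>, so that the result again has the required form.\<close>

definition glue :: "('i \<Rightarrow> ('o, 'm) gbundle) \<Rightarrow> ('o, 'm) gbundle" where
  "glue E = \<lparr>tot = pullback_topology {(x, v). x \<in> topspace (Ob \<G>) \<and> v \<in> fibre (tot (E (c x))) x}
      (\<lambda>e. (c (fst e), e)) (sum_topology (\<lambda>j. tot (E j)) I),
    act = (\<lambda>m. act (E (c (src \<G> m))) m)\<rparr>"

context
  fixes E :: "'i \<Rightarrow> ('o, 'm) gbundle"
  assumes E: "\<And>j. j \<in> I \<Longrightarrow> groupoid_bundle (piece j) (E j)"
begin

lemma topspace_glue: "(x, v) \<in> topspace (tot (glue E)) \<longleftrightarrow> x \<in> topspace (Ob \<G>) \<and> v \<in> fibre (tot (E (c x))) x"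
  by (auto simp: glue_def topspace_pullback_topology mem_fibre_iff c_mem)

lemma fibre_glue: "v \<in> fibre (tot (glue E)) x \<longleftrightarrow> x \<in> topspace (Ob \<G>) \<and> v \<in> fibre (tot (E (c x))) x"
  by (simp add: mem_fibre_iff[of _ "tot (glue E)"] topspace_glue)

lemma fibre_glue_eq: "x \<in> topspace (Ob \<G>) \<Longrightarrow> fibre (tot (glue E)) x = fibre (tot (E (c x))) x"
  by (auto simp: fibre_glue)

lemma act_glue: "act (glue E) m = act (E (c (src \<G> m))) m"
  by (simp add: glue_def)

lemma fst_mem_piece: "j \<in> I \<Longrightarrow> e \<in> topspace (tot (E j)) \<Longrightarrow> fst e \<in> topspace (Ob \<G>) \<and> c (fst e) = j"
  using continuous_map_mem[OF groupoid_bundleD(2)[OF E]] by simp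

lemma continuous_map_into_glue:
  assumes "j \<in> I"
  shows "continuous_map (tot (E j)) (tot (glue E)) (\<lambda>e. e)"
  unfolding glue_def gbundle.simps
proof (rule continuous_map_pullback')
  show "continuous_map (tot (E j)) (sum_topology (\<lambda>j. tot (E j)) I) ((\<lambda>e. (c (fst e), e)) \<circ> (\<lambda>e. e))"
    by (rule continuous_map_eq[OF continuous_map_component_injection[OF assms]])
      (use fst_mem_piece[OF assms] in auto)
qed (use fst_mem_piece[OF assms] in \<open>auto simp: mem_fibre_iff\<close>)

text \<open>Each summand of a disjoint union is open in it. Together with
  \<open>continuous_map_into_glue\<close> this identifies \<open>tot (E j)\<close> with the part of
  the glued space over the j-th piece.\<close>

lemma openin_glue:
  assumes j: "j \<in> I" and V: "openin (tot (E j)) V"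
  shows "openin (tot (glue E)) V"
proof -
  have "{x. (i, x) \<in> {j} \<times> V} = (if i = j then V else {})" for i
    by auto
  then have "openin (sum_topology (\<lambda>j. tot (E j)) I) ({j} \<times> V)"
    using j V openin_subset[OF V] unfolding openin_sum_topology by auto
  moreover have "V = (\<lambda>e. (c (fst e), e)) -` ({j} \<times> V) \<inter> {(x, v). x \<in> topspace (Ob \<G>) \<and> v \<in> fibre (tot (E (c x))) x}"
    using openin_subset[OF V] fst_mem_piece[OF j] by (force simp: mem_fibre_iff)
  ultimately show ?thesis
    unfolding glue_def gbundle.simps openin_pullback_topology by blast
qed

lemma continuous_map_from_glue:
  assumes j: "j \<in> I"
  shows "continuous_map (subtopology (tot (glue E)) {e. c (fst e) = j}) (tot (E j)) (\<lambda>e. e)"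
proof -
  have top: "topspace (subtopology (tot (glue E)) {e. c (fst e) = j}) = topspace (tot (E j))"
    using fst_mem_piece[OF j] by (auto simp: topspace_glue mem_fibre_iff)
  have "openin (subtopology (tot (glue E)) {e. c (fst e) = j}) V" if "openin (tot (E j)) V" for V
    using openin_glue[OF j that] openin_subset[OF that] fst_mem_piece[OF j]
    by (auto simp: openin_subtopology intro!: exI[of _ V])
  moreover have "{x \<in> topspace (tot (E j)). x \<in> V} = V" if "openin (tot (E j)) V" for V
    using openin_subset[OF that] by auto
  ultimately show ?thesis
    unfolding continuous_map_def top by simp
qed

lemma openin_piece_glue:
  assumes j: "j \<in> I"
  shows "openin (tot (glue E)) {e \<in> topspace (tot (glue E)). c (fst e) = j}"
proof -
  have "{e \<in> topspace (tot (glue E)). c (fst e) = j} = topspace (tot (E j))"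
    using fst_mem_piece[OF j] by (auto simp: topspace_glue mem_fibre_iff)
  then show ?thesis
    using openin_glue[OF j openin_topspace] by simp
qed

lemma continuous_map_fst_glue: "continuous_map (tot (glue E)) (Ob \<G>) fst"
proof (rule continuous_map_on_pieces[where I = I and d = "c \<circ> fst"])
  fix j assume j: "j \<in> I"
  have "continuous_map (tot (E j)) (Ob \<G>) fst"
    using groupoid_bundleD(2)[OF E[OF j]] by (simp add: continuous_map_in_subtopology)
  from continuous_map_compose[OF continuous_map_from_glue[OF j] this]
  show "continuous_map (subtopology (tot (glue E)) {x. (c \<circ> fst) x = j}) (Ob \<G>) fst"
    by (simp add: o_def)
qed (use openin_piece_glue in \<open>auto simp: topspace_glue c_mem\<close>)

lemma vector_bundle_glue: "vector_bundle (Ob \<G>) (tot (glue E))"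
  unfolding vector_bundle_iff
proof (intro conjI ballI)
  let ?T = "tot (glue E)"
  show "continuous_map ?T (Ob \<G>) fst"
    by (rule continuous_map_fst_glue)
  fix x assume x: "x \<in> topspace (Ob \<G>)"
  define j where "j = c x"
  have j: "j \<in> I" and xj: "x \<in> topspace (Ob (piece j))"
    using x by (auto simp: j_def c_mem)
  have vb: "vector_bundle (Ob (piece j)) (tot (E j))"
    by (rule groupoid_bundleD(1)[OF E[OF j]])
  show "csubspace (fibre ?T x)"
    using vb xj unfolding fibre_glue_eq[OF x] vector_bundle_def j_def by blast
  obtain U n f f' where U: "openin (Ob (piece j)) U" "x \<in> U" and f: "local_triv (Ob (piece j)) (tot (E j)) U n f f'"
    using vb xj vector_bundle_iff by metis
  \<comment> \<open>A trivialising set is given as open in the piece; it is open in the whole object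
    space because the piece is.\<close>
  have UO: "openin (Ob \<G>) U" "U \<subseteq> {x \<in> topspace (Ob \<G>). c x = j}"
  proof -
    obtain W where "openin (Ob \<G>) W" "U = W \<inter> {x. c x = j}"
      using U(1) by (auto simp: openin_subtopology)
    then have "U = W \<inter> {x \<in> topspace (Ob \<G>). c x = j}"
      using openin_subset by blast
    then show "openin (Ob \<G>) U" "U \<subseteq> {x \<in> topspace (Ob \<G>). c x = j}"
      using open_piece[OF j] \<open>openin (Ob \<G>) W\<close> by auto
  qed
  have fib: "fibre ?T y = fibre (tot (E j)) y" if "y \<in> U" for y
    using that UO(2) fibre_glue_eq[of y] by auto
  have 1: "continuous_map (subtopology (tot (E j)) {e. fst e \<in> U}) euclidean (\<lambda>(y, v). f y v)"
    and 2: "continuous_map (prod_topology (subtopology (Ob (piece j)) U) (top_of_set (Cn n))) (tot (E j)) (\<lambda>(y, w). (y, f' y w))"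
    using f by (simp_all add: local_triv_def)
  have "continuous_map (subtopology ?T {e. fst e \<in> U}) (tot (E j)) (\<lambda>e. e)"
    by (rule continuous_map_from_subtopology_mono[OF continuous_map_from_glue[OF j]]) (use UO in auto)
  then have "continuous_map (subtopology ?T {e. fst e \<in> U}) (subtopology (tot (E j)) {e. fst e \<in> U}) (\<lambda>e. e)"
    by (auto simp: continuous_map_in_subtopology)
  from continuous_map_compose[OF this 1]
  have 3: "continuous_map (subtopology ?T {e. fst e \<in> U}) euclidean (\<lambda>(y, v). f y v)"
    by (simp add: o_def)
  have "subtopology (Ob (piece j)) U = subtopology (Ob \<G>) U"
    using UO(2) by (simp add: subtopology_subtopology Int_absorb1 subset_iff)
  then have 4: "continuous_map (prod_topology (subtopology (Ob \<G>) U) (top_of_set (Cn n))) ?T (\<lambda>(y, w). (y, f' y w))"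
    using continuous_map_compose[OF 2 continuous_map_into_glue[OF j]] by (simp add: o_def)
  have "local_triv (Ob \<G>) ?T U n f f'"
    using f 3 4 by (auto simp: local_triv_def fib)
  then show "\<exists>U n f f'. openin (Ob \<G>) U \<and> x \<in> U \<and> local_triv (Ob \<G>) ?T U n f f'"
    using U(2) UO(1) by blast
qed

lemma groupoid_bundle_glue: "groupoid_bundle \<G> (glue E)"
proof (rule groupoid_bundleI)
  let ?T = "tot (glue E)"
  have m: "src \<G> m \<in> topspace (Ob \<G>)" "tgt \<G> m \<in> topspace (Ob \<G>)" "c (src \<G> m) \<in> I"
    "m \<in> topspace (Mor (piece (c (src \<G> m))))"
    if "m \<in> topspace (Mor \<G>)" for m
    using that continuous_map_mem[OF src_cont] continuous_map_mem[OF tgt_cont] c_mem by auto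
  show "act (glue E) m v \<in> fibre ?T (tgt \<G> m)" if "m \<in> topspace (Mor \<G>)" "v \<in> fibre ?T (src \<G> m)" for m v
    using groupoid_bundleD(4)[OF E[OF m(3)[OF that(1)]] m(4)[OF that(1)], of v] that m[OF that(1)]
    by (simp add: fibre_glue act_glue c_tgt)
  show "clinear_on (fibre ?T (src \<G> m)) (act (glue E) m)" if "m \<in> topspace (Mor \<G>)" for m
    using groupoid_bundleD(5)[OF E[OF m(3)[OF that(1)]] m(4)[OF that(1)]] that m[OF that]
    by (simp add: fibre_glue_eq act_glue)
  show "act (glue E) (idm \<G> x) v = v" if "x \<in> topspace (Ob \<G>)" "v \<in> fibre ?T x" for x v
    using groupoid_bundleD(6)[OF E[OF c_mem[OF that(1)]], of v x] that by (simp add: fibre_glue act_glue src_idm)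
  show "act (glue E) (cmp \<G> m k) v = act (glue E) m (act (glue E) k v)"
    if "m \<in> topspace (Mor \<G>)" "k \<in> topspace (Mor \<G>)" "src \<G> m = tgt \<G> k" "v \<in> fibre ?T (src \<G> k)" for m k v
    using groupoid_bundleD(7)[OF E[OF m(3)[OF that(2)]], of m k v] that m[OF that(2)]
    by (simp add: fibre_glue act_glue src_cmp c_tgt)
  let ?Z = "subtopology (prod_topology (Mor \<G>) ?T) {(m, e). src \<G> m = fst e}"
  have Z: "continuous_map ?Z (Mor \<G>) fst" "continuous_map ?Z ?T snd"
    by (auto intro: continuous_map_from_subtopology continuous_map_fst continuous_map_snd)
  show "continuous_map ?Z ?T (\<lambda>(m, e). (tgt \<G> m, act (glue E) m (snd e)))"
  \<comment> \<open>The label of the base point of the vector decides which action is used, and it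
    is locally constant on the fibre product.\<close>
  proof (rule continuous_map_on_pieces[where I = I and d = "\<lambda>z. c (fst (snd z))"])
    fix j assume j: "j \<in> I"
    show "openin ?Z {z \<in> topspace ?Z. c (fst (snd z)) = j}"
    proof -
      have "{z \<in> topspace ?Z. snd z \<in> {e \<in> topspace ?T. c (fst e) = j}} = {z \<in> topspace ?Z. c (fst (snd z)) = j}"
        using continuous_map_mem[OF Z(2)] by blast
      then show ?thesis
        using openin_continuous_map_preimage[OF Z(2) openin_piece_glue[OF j]] by argo
    qed
    let ?Zj = "subtopology ?Z {z. c (fst (snd z)) = j}"
    have 1: "continuous_map ?Zj (Mor (piece j)) fst"
      using Z(1) by (auto simp: continuous_map_in_subtopology intro: continuous_map_from_subtopology)
    have "continuous_map ?Zj (subtopology ?T {e. c (fst e) = j}) snd"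
      using Z(2) by (auto simp: continuous_map_in_subtopology intro: continuous_map_from_subtopology)
    from continuous_map_compose[OF this continuous_map_from_glue[OF j]]
    have 2: "continuous_map ?Zj (tot (E j)) (\<lambda>z. (fst (snd z), snd (snd z)))"
      by (simp add: o_def)
    have "continuous_map ?Zj (tot (E j)) (\<lambda>z. (tgt (piece j) (fst z), act (E j) (fst z) (snd (snd z))))"
      by (rule continuous_map_act[OF E[OF j] 1 2]) auto
    from continuous_map_compose[OF this continuous_map_into_glue[OF j]]
    have "continuous_map ?Zj ?T (\<lambda>z. (tgt \<G> (fst z), act (E j) (fst z) (snd (snd z))))"
      by (simp add: o_def)
    then show "continuous_map ?Zj ?T (\<lambda>(m, e). (tgt \<G> m, act (glue E) m (snd e)))"
      by (rule continuous_map_eq) (auto simp: act_glue)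
  qed (auto simp: topspace_glue c_mem)
qed (rule vector_bundle_glue)

lemma restr_glue:
  assumes j: "j \<in> I"
  shows "gbundle_iso (piece j) (restr j (glue E)) (E j)"
proof (rule gbundle_iso_same_tot)
  show "groupoid_bundle (piece j) (restr j (glue E))"
    by (rule groupoid_bundle_pullback[OF pregroupoid_piece continuous_functor_piece groupoid_bundle_glue])
  show "tot (E j) = tot (restr j (glue E))"
  proof (rule topology_eq_via_id)
    show "continuous_map (tot (E j)) (tot (restr j (glue E))) (\<lambda>e. e)"
      by (rule continuous_map_restr(3)[OF groupoid_bundle_glue continuous_map_into_glue[OF j]])
        (use fst_mem_piece[OF j] in blast)
    have "continuous_map (tot (restr j (glue E))) (subtopology (tot (glue E)) {e. c (fst e) = j}) (\<lambda>e. e)"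
      using continuous_map_restr(1)[OF groupoid_bundle_glue] by (auto simp: continuous_map_in_subtopology)
    from continuous_map_compose[OF this continuous_map_from_glue[OF j]]
    show "continuous_map (tot (restr j (glue E))) (tot (E j)) (\<lambda>e. e)"
      by (simp add: o_def)
  qed
qed (auto simp: act_glue)

end

text \<open>Surjectivity glues representatives; injectivity glues the stabilising summands, which
  may differ from piece to piece. For an infinite index set the glued bundle may have unbounded
  rank, which the notion of bundle permits since the rank is only locally constant.\<close>

lemma bij_betw_K_group_pieces:
  "bij_betw (\<lambda>\<xi>. \<lambda>j\<in>I. K_group_map (piece j) (id, id) \<xi>) (carrier (K_group \<G>))
     (\<Pi>\<^sub>E j\<in>I. carrier (K_group (piece j)))"
proof (rule bij_betw_imageI)
  note Kmap = K_group_map_K_class[OF pregroupoid_piece continuous_functor_piece]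
  note pb = groupoid_bundle_pullback[OF pregroupoid_piece continuous_functor_piece]
  show "inj_on (\<lambda>\<xi>. \<lambda>j\<in>I. K_group_map (piece j) (id, id) \<xi>) (carrier (K_group \<G>))"
  proof (rule inj_onI)
    fix \<xi> \<zeta> assume car: "\<xi> \<in> carrier (K_group \<G>)" "\<zeta> \<in> carrier (K_group \<G>)"
      and eq: "(\<lambda>j\<in>I. K_group_map (piece j) (id, id) \<xi>) = (\<lambda>j\<in>I. K_group_map (piece j) (id, id) \<zeta>)"
    obtain A B C D where gb: "groupoid_bundle \<G> A" "groupoid_bundle \<G> B" "groupoid_bundle \<G> C"
      "groupoid_bundle \<G> D" and \<xi>: "\<xi> = K_class \<G> A B" and \<zeta>: "\<zeta> = K_class \<G> C D"
      using car unfolding carrier_K_group by blast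
    have "K_class (piece j) (restr j A) (restr j B) = K_class (piece j) (restr j C) (restr j D)" if "j \<in> I" for j
      using fun_cong[OF eq, of j] that gb by (simp add: \<xi> \<zeta> Kmap)
    then have "\<exists>H. groupoid_bundle (piece j) H \<and>
        gbundle_iso (piece j) (gbundle_sum (gbundle_sum (restr j A) (restr j D)) H)
          (gbundle_sum (gbundle_sum (restr j C) (restr j B)) H)" if "j \<in> I" for j
      using that gb by (simp add: K_class_eq_iff pb)
    then obtain H where H: "\<And>j. j \<in> I \<Longrightarrow> groupoid_bundle (piece j) (H j)"
      and iso: "\<And>j. j \<in> I \<Longrightarrow> gbundle_iso (piece j) (gbundle_sum (gbundle_sum (restr j A) (restr j D)) (H j))
          (gbundle_sum (gbundle_sum (restr j C) (restr j B)) (H j))"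
      by metis
    have gH: "groupoid_bundle \<G> (glue H)"
      by (rule groupoid_bundle_glue[OF H])
    have "gbundle_iso \<G> (gbundle_sum (gbundle_sum A D) (glue H)) (gbundle_sum (gbundle_sum C B) (glue H))"
    proof (rule gbundle_iso_pieces)
      fix j assume j: "j \<in> I"
      have gbj: "groupoid_bundle (piece j) (restr j A)" "groupoid_bundle (piece j) (restr j B)"
        "groupoid_bundle (piece j) (restr j C)" "groupoid_bundle (piece j) (restr j D)"
        "groupoid_bundle (piece j) (restr j (glue H))"
        using gb gH by (auto intro: pb)
      \<comment> \<open>The isomorphism \<open>iso\<close> involves \<open>H j\<close>, while the
        glued summand restricts to it only up to isomorphism; so it is exchanged on both
        sides.\<close>
      have 1: "gbundle_iso (piece j) (restr j (glue H)) (H j)"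
        by (rule restr_glue[OF H j])
      have 2: "gbundle_iso (piece j) (H j) (restr j (glue H))"
        by (rule gbundle_iso_sym[OF gbj(5) H[OF j] 1])
      have "gbundle_iso (piece j) (gbundle_sum (gbundle_sum (restr j A) (restr j D)) (restr j (glue H)))
          (gbundle_sum (gbundle_sum (restr j C) (restr j B)) (H j))"
        using gbj by (intro gbundle_iso_trans'[OF _ gbundle_sum_cong[OF gbundle_iso_refl 1] iso[OF j]] groupoid_bundle_sum)
      then have "gbundle_iso (piece j) (gbundle_sum (gbundle_sum (restr j A) (restr j D)) (restr j (glue H)))
          (gbundle_sum (gbundle_sum (restr j C) (restr j B)) (restr j (glue H)))"
        using gbj by (intro gbundle_iso_trans'[OF _ _ gbundle_sum_cong[OF gbundle_iso_refl 2]] groupoid_bundle_sum)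
      then show "gbundle_iso (piece j) (restr j (gbundle_sum (gbundle_sum A D) (glue H)))
          (restr j (gbundle_sum (gbundle_sum C B) (glue H)))"
        by (simp add: gbundle_pullback_sum)
    qed (use gb gH in \<open>auto intro: groupoid_bundle_sum\<close>)
    then show "\<xi> = \<zeta>"
      unfolding \<xi> \<zeta> K_class_eq_iff[OF gb] using gH by blast
  qed
  show "(\<lambda>\<xi>. \<lambda>j\<in>I. K_group_map (piece j) (id, id) \<xi>) ` carrier (K_group \<G>) = (\<Pi>\<^sub>E j\<in>I. carrier (K_group (piece j)))"
  proof (intro equalityI subsetI)
    fix \<eta> assume \<eta>: "\<eta> \<in> (\<Pi>\<^sub>E j\<in>I. carrier (K_group (piece j)))"
    then have "\<exists>A B. groupoid_bundle (piece j) A \<and> groupoid_bundle (piece j) B \<and> \<eta> j = K_class (piece j) A B"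
      if "j \<in> I" for j
      using PiE_mem[OF \<eta> that] carrier_K_group by blast
    then obtain A B where A: "\<And>j. j \<in> I \<Longrightarrow> groupoid_bundle (piece j) (A j)"
      and B: "\<And>j. j \<in> I \<Longrightarrow> groupoid_bundle (piece j) (B j)"
      and AB: "\<And>j. j \<in> I \<Longrightarrow> \<eta> j = K_class (piece j) (A j) (B j)"
      by metis
    have gA: "groupoid_bundle \<G> (glue A)" and gB: "groupoid_bundle \<G> (glue B)"
      by (rule groupoid_bundle_glue[OF A], assumption) (rule groupoid_bundle_glue[OF B])
    have "K_group_map (piece j) (id, id) (K_class \<G> (glue A) (glue B)) = \<eta> j" if j: "j \<in> I" for j
      unfolding Kmap[OF gA gB] AB[OF j]
      by (rule K_class_eqI[OF pb[OF gA] pb[OF gB] A[OF j] B[OF j] restr_glue[OF A j] restr_glue[OF B j]])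
    then have "(\<lambda>j\<in>I. K_group_map (piece j) (id, id) (K_class \<G> (glue A) (glue B))) = \<eta>"
      using \<eta> by (metis (mono_tags, lifting) PiE_restrict restrict_ext)
    moreover have "K_class \<G> (glue A) (glue B) \<in> carrier (K_group \<G>)"
      using gA gB unfolding carrier_K_group by blast
    ultimately show "\<eta> \<in> (\<lambda>\<xi>. \<lambda>j\<in>I. K_group_map (piece j) (id, id) \<xi>) ` carrier (K_group \<G>)"
      by (rule rev_image_eqI[OF _ sym, rotated])
  qed (auto simp: K_group_map_closed[OF pregroupoid_piece continuous_functor_piece])
qed

end

section \<open>Replacing the pieces by equivalent groupoids\<close>

lemma bij_betw_PiE_componentwise:
  assumes "\<And>j. j \<in> I \<Longrightarrow> bij_betw (g j) (X j) (Y j)"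
  shows "bij_betw (\<lambda>\<eta>. \<lambda>j\<in>I. g j (\<eta> j)) (Pi\<^sub>E I X) (Pi\<^sub>E I Y)"
proof (rule bij_betw_byWitness[where f' = "\<lambda>\<eta>. \<lambda>j\<in>I. inv_into (X j) (g j) (\<eta> j)"])
  have inv: "inv_into (X j) (g j) y \<in> X j \<and> g j (inv_into (X j) (g j) y) = y" if "j \<in> I" "y \<in> Y j" for j y
    using assms[OF that(1)] that(2) by (metis bij_betw_imp_surj_on f_inv_into_f inv_into_into)
  have inv': "inv_into (X j) (g j) (g j x) = x" if "j \<in> I" "x \<in> X j" for j x
    using assms[OF that(1)] that(2) by (meson bij_betw_imp_inj_on inv_into_f_f)
  show "\<forall>\<eta>\<in>Pi\<^sub>E I X. (\<lambda>j\<in>I. inv_into (X j) (g j) ((\<lambda>j\<in>I. g j (\<eta> j)) j)) = \<eta>"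
    by (intro ballI, rule PiE_ext[where k = I and s = X]) (auto simp: inv' PiE_mem)
  show "\<forall>\<eta>\<in>Pi\<^sub>E I Y. (\<lambda>j\<in>I. g j ((\<lambda>j\<in>I. inv_into (X j) (g j) (\<eta> j)) j)) = \<eta>"
    by (intro ballI, rule PiE_ext[where k = I and s = Y]) (auto simp: inv PiE_mem)
  show "(\<lambda>\<eta>. \<lambda>j\<in>I. g j (\<eta> j)) ` Pi\<^sub>E I X \<subseteq> Pi\<^sub>E I Y"
    using assms by (fastforce simp: bij_betw_def dest: PiE_mem)
  show "(\<lambda>\<eta>. \<lambda>j\<in>I. inv_into (X j) (g j) (\<eta> j)) ` Pi\<^sub>E I Y \<subseteq> Pi\<^sub>E I X"
    using inv by (fastforce dest: PiE_mem)
qed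

definition gpd_equivalence :: "('o, 'm) tgroupoid \<Rightarrow> ('o', 'm') tgroupoid \<Rightarrow>
    ('o, 'm, 'o', 'm') gfunctor \<Rightarrow> ('o', 'm', 'o, 'm) gfunctor \<Rightarrow> bool" where
  "gpd_equivalence \<G> \<H> F P \<longleftrightarrow> continuous_functor \<G> \<H> F \<and> continuous_functor \<H> \<G> P \<and>
     nat_iso \<G> \<G> (functor_comp P F) (id, id) \<and> nat_iso \<H> \<H> (functor_comp F P) (id, id)"

lemma (in decomposed_pregroupoid) bij_betw_K_group_equivalences:
  assumes A: "\<And>j. j \<in> I \<Longrightarrow> pregroupoid (\<A> j)"
    and eqv: "\<And>j. j \<in> I \<Longrightarrow> gpd_equivalence (\<A> j) (piece j) (i j) (p j)"
  shows "bij_betw (\<lambda>\<xi>. \<lambda>j\<in>I. K_group_map (\<A> j) (i j) \<xi>) (carrier (K_group \<G>))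
     (\<Pi>\<^sub>E j\<in>I. carrier (K_group (\<A> j)))"
proof -
  have F: "continuous_functor (\<A> j) (piece j) (i j)" if "j \<in> I" for j
    using eqv[OF that] by (simp add: gpd_equivalence_def)
  have "bij_betw (\<lambda>\<eta>. \<lambda>j\<in>I. K_group_map (\<A> j) (i j) (\<eta> j))
      (\<Pi>\<^sub>E j\<in>I. carrier (K_group (piece j))) (\<Pi>\<^sub>E j\<in>I. carrier (K_group (\<A> j)))"
    using eqv by (intro bij_betw_PiE_componentwise bij_betw_K_group_map[OF A pregroupoid_piece])
      (auto simp: gpd_equivalence_def)
  from bij_betw_trans[OF bij_betw_K_group_pieces this] show ?thesis
  proof (rule bij_betw_cong[THEN iffD1, rotated])
    fix \<xi> assume \<xi>: "\<xi> \<in> carrier (K_group \<G>)"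
    \<comment> \<open>Restricting to a piece and then pulling back along \<open>i j\<close> is
      pulling back along \<open>i j\<close> regarded as a functor into the whole groupoid.\<close>
    have "functor_comp (id, id) (i j) = i j" for j
      by (simp add: functor_comp_def)
    then show "((\<lambda>\<eta>. \<lambda>j\<in>I. K_group_map (\<A> j) (i j) (\<eta> j)) \<circ> (\<lambda>\<xi>. \<lambda>j\<in>I. K_group_map (piece j) (id, id) \<xi>)) \<xi> =
        (\<lambda>j\<in>I. K_group_map (\<A> j) (i j) \<xi>)"
      using \<xi> K_group_map_comp[OF A F pregroupoid_piece continuous_functor_piece \<xi>] by (auto simp: fun_eq_iff)
  qed
qed

section \<open>Products with spheres\<close>

lemma groupoid_times_simps [simp]:
  "Ob (groupoid_times \<G> S) = prod_topology (Ob \<G>) S" "Mor (groupoid_times \<G> S) = prod_topology (Mor \<G>) S"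
  "src (groupoid_times \<G> S) = map_prod (src \<G>) id" "tgt (groupoid_times \<G> S) = map_prod (tgt \<G>) id"
  "cmp (groupoid_times \<G> S) = (\<lambda>(m, s) (k, s'). (cmp \<G> m k, s))"
  "idm (groupoid_times \<G> S) = map_prod (idm \<G>) id"
  by (simp_all add: groupoid_times_def)

lemma continuous_map_map_prod_id:
  assumes "continuous_map X Y f"
  shows "continuous_map (prod_topology X S) (prod_topology Y S) (map_prod f id)"
  using continuous_map_compose[OF continuous_map_fst assms, of S]
  by (auto simp: continuous_map_pairwise o_def map_prod_def case_prod_unfold continuous_map_snd)

lemma pregroupoid_times: "pregroupoid \<G> \<Longrightarrow> pregroupoid (groupoid_times \<G> S)"
  unfolding pregroupoid_def by (auto simp: continuous_map_map_prod_id)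

abbreviation functor_times :: "('o, 'm, 'o', 'm') gfunctor \<Rightarrow> ('o \<times> 's, 'm \<times> 's, 'o' \<times> 's, 'm' \<times> 's) gfunctor" where
  "functor_times F \<equiv> (map_prod (fst F) id, map_prod (snd F) id)"

lemma continuous_functor_times:
  assumes "continuous_functor \<G> \<H> F"
  shows "continuous_functor (groupoid_times \<G> S) (groupoid_times \<H> S) (functor_times F)"
  using assms unfolding continuous_functor_def by (auto simp: continuous_map_map_prod_id)

lemma nat_iso_times:
  assumes "nat_iso \<G> \<H> F F'"
  shows "nat_iso (groupoid_times \<G> S) (groupoid_times \<H> S) (functor_times F) (functor_times F')"
proof -
  obtain \<eta> \<eta>' where *: "continuous_map (Ob \<G>) (Mor \<H>) \<eta> \<and> continuous_map (Ob \<G>) (Mor \<H>) \<eta>' \<and>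
     (\<forall>x\<in>topspace (Ob \<G>). src \<H> (\<eta> x) = fst F x \<and> tgt \<H> (\<eta> x) = fst F' x \<and>
        src \<H> (\<eta>' x) = fst F' x \<and> tgt \<H> (\<eta>' x) = fst F x \<and>
        cmp \<H> (\<eta>' x) (\<eta> x) = idm \<H> (fst F x) \<and> cmp \<H> (\<eta> x) (\<eta>' x) = idm \<H> (fst F' x)) \<and>
     (\<forall>m\<in>topspace (Mor \<G>). cmp \<H> (\<eta> (tgt \<G> m)) (snd F m) = cmp \<H> (snd F' m) (\<eta> (src \<G> m)))"
    using assms unfolding nat_iso_def by blast
  then show ?thesis
    unfolding nat_iso_def
    by (intro exI[of _ "map_prod \<eta> id"] exI[of _ "map_prod \<eta>' id"]) (auto simp: continuous_map_map_prod_id)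
qed

lemma functor_comp_times: "functor_comp (functor_times F') (functor_times F) = functor_times (functor_comp F' F)"
  by (simp add: functor_comp_def map_prod.comp)

lemma functor_times_id: "functor_times (id, id) = (id, id)"
  by (simp add: map_prod.id)

lemma gpd_equivalence_times:
  assumes "gpd_equivalence \<G> \<H> F P"
  shows "gpd_equivalence (groupoid_times \<G> S) (groupoid_times \<H> S) (functor_times F) (functor_times P)"
  using assms continuous_functor_times[of \<G> \<H> F S] continuous_functor_times[of \<H> \<G> P S]
    nat_iso_times[of \<G> \<G> "functor_comp P F" "(id, id)" S] nat_iso_times[of \<H> \<H> "functor_comp F P" "(id, id)" S]
  unfolding gpd_equivalence_def functor_comp_times functor_times_id by blast

lemma subtopology_prod_fst:
  fixes S :: "'s topology"
  shows "subtopology (prod_topology X S) {z. P (fst z)} = prod_topology (subtopology X {x. P x}) S"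
proof -
  have "{z. P (fst z)} = {x. P x} \<times> (UNIV :: 's set)"
    by auto
  then show ?thesis
    by (simp only: subtopology_Times subtopology_UNIV)
qed

text \<open>The sphere coordinate plays no part in the labelling, so decomposing and multiplying
  with a sphere commute; equivalences for the pieces can then be multiplied with the sphere.\<close>

lemma restrict_gpd_times: "restrict_gpd (groupoid_times \<G> S) (c \<circ> fst) j = groupoid_times (restrict_gpd \<G> c j) S"
  using subtopology_prod_fst[of "Ob \<G>" S "\<lambda>x. c x = j"] subtopology_prod_fst[of "Mor \<G>" S "\<lambda>m. c (src \<G> m) = j"]
  by (simp add: restrict_gpd_def groupoid_times_def o_def case_prod_unfold map_prod_def)

lemma decomposed_pregroupoid_times:
  assumes "decomposed_pregroupoid \<G> c I"
  shows "decomposed_pregroupoid (groupoid_times \<G> S) (c \<circ> fst) I"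
proof -
  interpret decomposed_pregroupoid \<G> c I by fact
  interpret T: pregroupoid "groupoid_times \<G> S"
    by (rule pregroupoid_times) unfold_locales
  show ?thesis
  proof
    fix j assume "j \<in> I"
    have "{x \<in> topspace (Ob (groupoid_times \<G> S)). (c \<circ> fst) x = j} = {x \<in> topspace (Ob \<G>). c x = j} \<times> topspace S"
      by auto
    then show "openin (Ob (groupoid_times \<G> S)) {x \<in> topspace (Ob (groupoid_times \<G> S)). (c \<circ> fst) x = j}"
      using open_piece[OF \<open>j \<in> I\<close>] by (simp add: openin_prod_Times_iff)
  qed (auto simp: c_mem c_tgt)
qed

lemma nsphere_pt_mem: "nsphere_pt \<in> topspace (nsphere d)"
proof -
  have "(\<Sum>i\<le>d. (nsphere_pt i)\<^sup>2) = (\<Sum>i\<le>d. if i = 0 then 1 else 0)"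
    by (rule sum.cong) (auto simp: nsphere_pt_def)
  then show ?thesis
    by (simp add: nsphere nsphere_pt_def)
qed

text \<open>Inclusion of the slice over the base point of the sphere; the restriction whose kernel
  is \<open>K_orb\<close> is the pullback along it.\<close>

definition base_functor :: "('o, 'm, 'o \<times> (nat \<Rightarrow> real), 'm \<times> (nat \<Rightarrow> real)) gfunctor" where
  "base_functor = (\<lambda>x. (x, nsphere_pt), \<lambda>m. (m, nsphere_pt))"

lemma continuous_functor_base: "continuous_functor \<G> (groupoid_times \<G> (nsphere d)) base_functor"
  using nsphere_pt_mem[of d] by (auto simp: continuous_functor_def base_functor_def continuous_map_pairwise o_def)

text \<open>Naturality of the inclusion of the base point slice, which makes induced maps preserve
  the kernels defining \<open>K_orb\<close>.\<close>

lemma functor_comp_times_base: "functor_comp (functor_times F) base_functor = functor_comp base_functor F"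
  by (simp add: functor_comp_def base_functor_def fun_eq_iff)

section \<open>Orbifold K-theory\<close>

abbreviation sphere_times :: "int \<Rightarrow> ('o, 'm) tgroupoid \<Rightarrow> ('o \<times> (nat \<Rightarrow> real), 'm \<times> (nat \<Rightarrow> real)) tgroupoid" where
  "sphere_times n \<G> \<equiv> groupoid_times \<G> (nsphere (sphere_dim n))"

lemma carrier_K_orb:
  "\<xi> \<in> carrier (K_orb n \<G>) \<longleftrightarrow> \<xi> \<in> carrier (K_group (sphere_times n \<G>)) \<and>
     K_group_map \<G> base_functor \<xi> = \<one>\<^bsub>K_group \<G>\<^esub>"
  by (simp add: K_orb_def Let_def kernel_def base_functor_def)

lemma mult_K_orb: "x \<otimes>\<^bsub>K_orb n \<G>\<^esub> y = x \<otimes>\<^bsub>K_group (sphere_times n \<G>)\<^esub> y"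
  by (simp add: K_orb_def Let_def)

context
  fixes \<G> :: "('o, 'm) tgroupoid" and \<H> :: "('o', 'm') tgroupoid" and F :: "('o, 'm, 'o', 'm') gfunctor"
  assumes \<G>: "pregroupoid \<G>" and \<H>: "pregroupoid \<H>" and F: "continuous_functor \<G> \<H> F"
begin

lemma K_group_map_base:
  assumes "\<xi> \<in> carrier (K_group (sphere_times n \<H>))"
  shows "K_group_map \<G> base_functor (K_orb_map n \<G> F \<xi>) = K_group_map \<G> F (K_group_map \<H> base_functor \<xi>)"
  using assms K_group_map_comp[OF \<G> continuous_functor_base pregroupoid_times[OF \<G>] continuous_functor_times[OF F, of "nsphere (sphere_dim n)"]]
    K_group_map_comp[OF \<G> F \<H> continuous_functor_base]
  by (simp add: K_orb_map_def functor_comp_times_base)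

lemma K_orb_map_closed:
  assumes "\<xi> \<in> carrier (K_orb n \<H>)"
  shows "K_orb_map n \<G> F \<xi> \<in> carrier (K_orb n \<G>)"
  using assms K_group_map_base[of \<xi> n] K_group_map_one[OF \<G> F \<H>]
    K_group_map_closed[OF pregroupoid_times[OF \<G>] continuous_functor_times[OF F, of "nsphere (sphere_dim n)"], of \<xi>]
  by (simp add: carrier_K_orb K_orb_map_def)

lemma K_orb_map_mult:
  assumes "\<xi> \<in> carrier (K_orb n \<H>)" "\<zeta> \<in> carrier (K_orb n \<H>)"
  shows "K_orb_map n \<G> F (\<xi> \<otimes>\<^bsub>K_orb n \<H>\<^esub> \<zeta>) = K_orb_map n \<G> F \<xi> \<otimes>\<^bsub>K_orb n \<G>\<^esub> K_orb_map n \<G> F \<zeta>"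
  using assms K_group_map_mult[OF pregroupoid_times[OF \<G>] continuous_functor_times[OF F, of "nsphere (sphere_dim n)"]]
  by (simp add: carrier_K_orb K_orb_map_def mult_K_orb)

lemma K_orb_map_comp:
  assumes "continuous_functor \<H> \<K> F'" "\<xi> \<in> carrier (K_orb n \<K>)"
  shows "K_orb_map n \<G> F (K_orb_map n \<H> F' \<xi>) = K_orb_map n \<G> (functor_comp F' F) \<xi>"
  using assms K_group_map_comp[OF pregroupoid_times[OF \<G>] continuous_functor_times[OF F, of "nsphere (sphere_dim n)"] pregroupoid_times[OF \<H>] continuous_functor_times[OF assms(1), of "nsphere (sphere_dim n)"]]
  by (simp add: carrier_K_orb K_orb_map_def functor_comp_times flip: functor_comp_times)

lemma K_orb_map_nat_iso:
  assumes F': "continuous_functor \<G> \<H> F'" and nat: "nat_iso \<G> \<H> F F'" and "\<xi> \<in> carrier (K_orb n \<H>)"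
  shows "K_orb_map n \<G> F \<xi> = K_orb_map n \<G> F' \<xi>"
  using assms(3) K_group_map_nat_iso[OF pregroupoid_times[OF \<G>] continuous_functor_times[OF F, of "nsphere (sphere_dim n)"]
      continuous_functor_times[OF F', of "nsphere (sphere_dim n)"] nat_iso_times[OF nat, of "nsphere (sphere_dim n)"]]
  by (simp add: carrier_K_orb K_orb_map_def)

end

text \<open>The decomposition is used twice. For the product with the sphere it gives a bijection of
  the ambient K-groups. That it is onto the kernels comes from the decomposition of the groupoid
  itself: if all local components of a class vanish at the base point, then so do all local
  restrictions of its base point restriction, and injectivity makes that restriction
  trivial.\<close>

lemma (in decomposed_pregroupoid) bij_betw_K_orb_equivalences:
  assumes A: "\<And>j. j \<in> I \<Longrightarrow> pregroupoid (\<A> j)"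
    and eqv: "\<And>j. j \<in> I \<Longrightarrow> gpd_equivalence (\<A> j) (piece j) (i j) (p j)"
  shows "bij_betw (\<lambda>\<xi>. \<lambda>j\<in>I. K_orb_map n (\<A> j) (i j) \<xi>) (carrier (K_orb n \<G>))
     (\<Pi>\<^sub>E j\<in>I. carrier (K_orb n (\<A> j)))"
proof -
  have \<G>: "pregroupoid \<G>" by unfold_locales
  have F: "continuous_functor (\<A> j) \<G> (i j)" if "j \<in> I" for j
  proof -
    have "functor_comp (id, id) (i j) = i j"
      by (simp add: functor_comp_def)
    moreover have "continuous_functor (\<A> j) (piece j) (i j)"
      using eqv[OF that] by (simp add: gpd_equivalence_def)
    ultimately show ?thesis
      using continuous_functor_comp[OF _ continuous_functor_piece A[OF that]] by metis
  qed
  have inj0: "inj_on (\<lambda>\<xi>. \<lambda>j\<in>I. K_group_map (\<A> j) (i j) \<xi>) (carrier (K_group \<G>))"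
    by (rule bij_betw_imp_inj_on[OF bij_betw_K_group_equivalences[OF A eqv]])
  interpret T: decomposed_pregroupoid "sphere_times n \<G>" "c \<circ> fst" I
    by (rule decomposed_pregroupoid_times) unfold_locales
  let ?f = "\<lambda>\<xi>. \<lambda>j\<in>I. K_orb_map n (\<A> j) (i j) \<xi>"
  have bij: "bij_betw ?f (carrier (K_group (sphere_times n \<G>)))
     (\<Pi>\<^sub>E j\<in>I. carrier (K_group (sphere_times n (\<A> j))))"
    unfolding K_orb_map_def
    by (rule T.bij_betw_K_group_equivalences[where p = "\<lambda>j. functor_times (p j)"])
      (auto simp: restrict_gpd_times intro: pregroupoid_times A gpd_equivalence_times eqv)
  show ?thesis
  proof (rule bij_betw_subset[OF bij])
    show "carrier (K_orb n \<G>) \<subseteq> carrier (K_group (sphere_times n \<G>))"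
      by (auto simp: carrier_K_orb)
    show "?f ` carrier (K_orb n \<G>) = (\<Pi>\<^sub>E j\<in>I. carrier (K_orb n (\<A> j)))"
    proof (intro equalityI subsetI)
      fix \<eta> assume \<eta>: "\<eta> \<in> (\<Pi>\<^sub>E j\<in>I. carrier (K_orb n (\<A> j)))"
      then have "\<eta> \<in> (\<Pi>\<^sub>E j\<in>I. carrier (K_group (sphere_times n (\<A> j))))"
        by (auto simp: PiE_iff carrier_K_orb)
      then have "\<eta> \<in> ?f ` carrier (K_group (sphere_times n \<G>))"
        using bij_betw_imp_surj_on[OF bij] by simp
      then obtain \<xi> where \<xi>: "\<xi> \<in> carrier (K_group (sphere_times n \<G>))" "?f \<xi> = \<eta>"
        by blast
      have "K_group_map (\<A> j) (i j) (K_group_map \<G> base_functor \<xi>) = K_group_map (\<A> j) (i j) \<one>\<^bsub>K_group \<G>\<^esub>"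
        if j: "j \<in> I" for j
      proof -
        have "K_orb_map n (\<A> j) (i j) \<xi> = \<eta> j"
          using fun_cong[OF \<xi>(2), of j] j by simp
        then have "K_group_map (\<A> j) base_functor (K_orb_map n (\<A> j) (i j) \<xi>) = \<one>\<^bsub>K_group (\<A> j)\<^esub>"
          using PiE_mem[OF \<eta> j] by (simp add: carrier_K_orb)
        then show ?thesis
          using K_group_map_base[OF A[OF j] \<G> F[OF j] \<xi>(1)] K_group_map_one[OF A[OF j] F[OF j] \<G>] by simp
      qed
      then have "(\<lambda>j\<in>I. K_group_map (\<A> j) (i j) (K_group_map \<G> base_functor \<xi>)) =
          (\<lambda>j\<in>I. K_group_map (\<A> j) (i j) \<one>\<^bsub>K_group \<G>\<^esub>)"
        by (rule restrict_ext)
      then have "K_group_map \<G> base_functor \<xi> = \<one>\<^bsub>K_group \<G>\<^esub>"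
        using inj_onD[OF inj0 _ K_group_map_closed[OF \<G> continuous_functor_base \<xi>(1)] one_K_group_closed[OF \<G>]]
        by blast
      then have "\<xi> \<in> carrier (K_orb n \<G>)"
        using \<xi>(1) by (simp add: carrier_K_orb)
      with \<xi>(2) show "\<eta> \<in> ?f ` carrier (K_orb n \<G>)"
        by blast
    qed (auto simp: K_orb_map_closed[OF A \<G> F])
  qed
qed

section \<open>Morphism classes\<close>

lemma open_map_prod:
  assumes f: "open_map X X' f" and g: "open_map Y Y' g"
  shows "open_map (prod_topology X Y) (prod_topology X' Y') (\<lambda>(x, y). (f x, g y))"
  unfolding open_map_def openin_prod_topology_alt[of X' Y']
proof (intro allI impI)
  fix U x' y' assume U: "openin (prod_topology X Y) U" and "(x', y') \<in> (\<lambda>(x, y). (f x, g y)) ` U"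
  then obtain x y where xy: "(x, y) \<in> U" "x' = f x" "y' = g y"
    by auto
  obtain A B where AB: "openin X A" "openin Y B" "x \<in> A" "y \<in> B" "A \<times> B \<subseteq> U"
    using U[unfolded openin_prod_topology_alt, rule_format, OF xy(1)] by (elim exE conjE)
  then have "openin X' (f ` A)" "openin Y' (g ` B)"
    using f g by (auto simp: open_map_def)
  moreover have "f ` A \<times> g ` B \<subseteq> (\<lambda>(x, y). (f x, g y)) ` U"
    using AB(5) by force
  ultimately show "\<exists>V W. openin X' V \<and> openin Y' W \<and> x' \<in> V \<and> y' \<in> W \<and> V \<times> W \<subseteq> (\<lambda>(x, y). (f x, g y)) ` U"
    unfolding xy using AB by (intro exI[of _ "f ` A"] exI[of _ "g ` B"] conjI) auto
qed

text \<open>Multiplying a quotient map with an identity can destroy the quotient property; an open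
  continuous surjection keeps it.\<close>

lemma quotient_map_prod_open:
  assumes "quotient_map X X' f" "open_map X X' f"
  shows "quotient_map (prod_topology X Y) (prod_topology X' Y) (\<lambda>(x, y). (f x, y))"
proof (rule continuous_open_imp_quotient_map)
  have f: "continuous_map X X' f"
    using assms(1) by (rule quotient_imp_continuous_map)
  show "continuous_map (prod_topology X Y) (prod_topology X' Y) (\<lambda>(x, y). (f x, y))"
    using continuous_map_map_prod_id[OF f, of Y] by (simp add: map_prod_def id_def)
  show "open_map (prod_topology X Y) (prod_topology X' Y) (\<lambda>(x, y). (f x, y))"
    by (rule open_map_prod[OF assms(2)]) (simp add: open_map_def)
  show "(\<lambda>(x, y). (f x, y)) ` topspace (prod_topology X Y) = topspace (prod_topology X' Y)"
    using quotient_imp_surjective_map[OF assms(1)] by force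
qed

text \<open>Suited to quotients by translations: the saturation of \<open>U\<close> is then a union
  of translates of \<open>U\<close>.\<close>

lemma open_map_quotientI:
  assumes q: "quotient_map X Y q"
    and sat: "\<And>U. openin X U \<Longrightarrow> openin X {x \<in> topspace X. q x \<in> q ` U}"
  shows "open_map X Y q"
  unfolding open_map_def
proof (intro allI impI)
  fix U assume U: "openin X U"
  have "q ` U \<subseteq> topspace Y"
    using openin_subset[OF U] quotient_imp_surjective_map[OF q] by blast
  then show "openin Y (q ` U)"
    using q sat[OF U] unfolding quotient_map_def by blast
qed

section \<open>Cosets in the real line\<close>

lemma mem_circle_coset: "t \<in> circle_coset l t"
  by (auto simp: circle_coset_def intro!: exI[of _ "0::int"])

lemma circle_coset_eq_iff: "circle_coset l s = circle_coset l t \<longleftrightarrow> (\<exists>m::int. t = s + of_int m * of_nat l)"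
proof
  assume "circle_coset l s = circle_coset l t"
  then have "t \<in> circle_coset l s"
    using mem_circle_coset by simp
  then show "\<exists>m::int. t = s + of_int m * of_nat l"
    by (auto simp: circle_coset_def)
next
  assume "\<exists>m::int. t = s + of_int m * of_nat l"
  then obtain m :: int where t: "t = s + of_int m * of_nat l" ..
  show "circle_coset l s = circle_coset l t"
    unfolding circle_coset_def
  proof (intro equalityI subsetI; clarsimp)
    fix k :: int
    show "\<exists>k'::int. s + of_int k * real l = t + of_int k' * real l"
      by (rule exI[of _ "k - m"]) (simp add: t algebra_simps)
    show "\<exists>k'::int. t + of_int k * real l = s + of_int k' * real l"
      by (rule exI[of _ "k + m"]) (simp add: t algebra_simps)
  qed
qed

lemma circle_coset_shift: "(\<lambda>s. s - of_int k) ` circle_coset l t = circle_coset l (t - of_int k)"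
proof -
  have "(\<lambda>s. s - of_int k) ` circle_coset l t = {s - of_int k | s. s \<in> circle_coset l t}"
    by auto
  also have "\<dots> = circle_coset l (t - of_int k)"
    unfolding circle_coset_def by (auto; metis add_diff_eq diff_add_eq)
  finally show ?thesis .
qed

lemma circle_coset_add: "(\<lambda>(s, t). s + t) ` (circle_coset l a \<times> circle_coset l b) = circle_coset l (a + b)"
proof (intro equalityI subsetI)
  fix x assume "x \<in> (\<lambda>(s, t). s + t) ` (circle_coset l a \<times> circle_coset l b)"
  then obtain i j :: int where "x = (a + of_int i * of_nat l) + (b + of_int j * of_nat l)"
    by (auto simp: circle_coset_def)
  then have "x = (a + b) + of_int (i + j) * of_nat l"
    by (simp add: algebra_simps)
  then show "x \<in> circle_coset l (a + b)"
    unfolding circle_coset_def by blast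
next
  fix x assume "x \<in> circle_coset l (a + b)"
  then obtain i :: int where "x = (a + of_int i * of_nat l) + b"
    by (auto simp: circle_coset_def algebra_simps)
  moreover have "a + of_int i * of_nat l \<in> circle_coset l a"
    unfolding circle_coset_def by blast
  ultimately show "x \<in> (\<lambda>(s, t). s + t) ` (circle_coset l a \<times> circle_coset l b)"
    using mem_circle_coset[of b l] by force
qed

lemma group_real_group: "group real_group"
proof (rule groupI)
  show "\<exists>y\<in>carrier real_group. y \<otimes>\<^bsub>real_group\<^esub> x = \<one>\<^bsub>real_group\<^esub>" for x
    by (rule bexI[of _ "- x"]) (auto simp: real_group_def)
qed (auto simp: real_group_def)

lemma real_group_int_pow: "(-1) [^]\<^bsub>real_group\<^esub> (k::int) = - of_int k"
proof -
  interpret group real_group by (rule group_real_group)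
  have n: "(-1) [^]\<^bsub>real_group\<^esub> (n::nat) = - of_nat n" for n
    by (induction n) (auto simp: real_group_def)
  have "inv\<^bsub>real_group\<^esub> x = - x" for x
    by (rule inv_equality) (auto simp: real_group_def)
  then show ?thesis
    by (simp add: int_pow_def2 n)
qed

section \<open>Transporters, conjugation and classes of arrows\<close>

context group
begin

lemma transporter_iff:
  assumes "g \<in> carrier G" "g' \<in> carrier G"
  shows "\<sigma> \<in> transporter G g g' \<longleftrightarrow> \<sigma> \<in> carrier G \<and> g' = conj_by G \<sigma> g"
proof -
  have "g' \<otimes> \<sigma> = \<sigma> \<otimes> g \<longleftrightarrow> g' = \<sigma> \<otimes> g \<otimes> inv \<sigma>" if "\<sigma> \<in> carrier G"
    using assms that by (metis inv_solve_right m_closed)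
  then show ?thesis
    by (auto simp: transporter_def conj_by_def)
qed

lemma transporter_carrier: "\<sigma> \<in> transporter G g g' \<Longrightarrow> \<sigma> \<in> carrier G"
  by (simp add: transporter_def)

lemma transporter_mult:
  assumes "g \<in> carrier G" "g' \<in> carrier G" "g'' \<in> carrier G"
    "\<sigma> \<in> transporter G g' g''" "\<tau> \<in> transporter G g g'"
  shows "\<sigma> \<otimes> \<tau> \<in> transporter G g g''"
proof -
  have c: "\<sigma> \<in> carrier G" "\<tau> \<in> carrier G" and e: "g'' \<otimes> \<sigma> = \<sigma> \<otimes> g'" "g' \<otimes> \<tau> = \<tau> \<otimes> g"
    using assms by (auto simp: transporter_def)
  have "g'' \<otimes> (\<sigma> \<otimes> \<tau>) = (\<sigma> \<otimes> g') \<otimes> \<tau>"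
    using assms c by (simp add: m_assoc flip: e(1))
  also have "\<dots> = \<sigma> \<otimes> \<tau> \<otimes> g"
    using assms c by (simp add: m_assoc e(2))
  finally show ?thesis
    using c by (simp add: transporter_def)
qed

lemma transporter_inv:
  assumes "g \<in> carrier G" "g' \<in> carrier G" "\<sigma> \<in> transporter G g g'"
  shows "inv \<sigma> \<in> transporter G g' g"
proof -
  have c: "\<sigma> \<in> carrier G" and e: "g' \<otimes> \<sigma> = \<sigma> \<otimes> g"
    using assms by (auto simp: transporter_def)
  have "inv \<sigma> \<otimes> g' = inv \<sigma> \<otimes> (g' \<otimes> \<sigma>) \<otimes> inv \<sigma>"
    using assms c by (simp add: m_assoc)
  also have "\<dots> = inv \<sigma> \<otimes> \<sigma> \<otimes> g \<otimes> inv \<sigma>"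
    unfolding e using assms c by (simp only: m_assoc inv_closed m_closed)
  also have "\<dots> = g \<otimes> inv \<sigma>"
    using assms c by simp
  finally show ?thesis
    using c by (simp add: transporter_def)
qed

lemma transporter_one: "g \<in> carrier G \<Longrightarrow> \<one> \<in> transporter G g g"
  by (simp add: transporter_def)

lemma conj_by_closed [simp, intro]: "h \<in> carrier G \<Longrightarrow> g \<in> carrier G \<Longrightarrow> conj_by G h g \<in> carrier G"
  by (simp add: conj_by_def)

lemma inv_cancel: "x \<in> carrier G \<Longrightarrow> y \<in> carrier G \<Longrightarrow> inv x \<otimes> (x \<otimes> y) = y"
  "x \<in> carrier G \<Longrightarrow> y \<in> carrier G \<Longrightarrow> x \<otimes> (inv x \<otimes> y) = y"
  by (simp_all flip: m_assoc)

lemma conj_by_mult: "h \<in> carrier G \<Longrightarrow> a \<in> carrier G \<Longrightarrow> b \<in> carrier G \<Longrightarrow>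
    conj_by G h (a \<otimes> b) = conj_by G h a \<otimes> conj_by G h b"
  by (simp add: conj_by_def m_assoc inv_cancel)

lemma conj_by_hom: "h \<in> carrier G \<Longrightarrow> conj_by G h \<in> hom G G"
  by (rule homI) (auto simp: conj_by_mult)

lemma conj_by_int_pow: "h \<in> carrier G \<Longrightarrow> g \<in> carrier G \<Longrightarrow> conj_by G h (g [^] (k::int)) = conj_by G h g [^] k"
  by (rule hom_int_pow[OF conj_by_hom]) auto

lemma conj_by_conj_by:
  "a \<in> carrier G \<Longrightarrow> b \<in> carrier G \<Longrightarrow> g \<in> carrier G \<Longrightarrow> conj_by G a (conj_by G b g) = conj_by G (a \<otimes> b) g"
  by (simp add: conj_by_def m_assoc inv_mult_group)

lemma conj_by_one: "g \<in> carrier G \<Longrightarrow> conj_by G \<one> g = g"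
  by (simp add: conj_by_def)

lemma conj_by_transporter:
  "h \<in> carrier G \<Longrightarrow> g \<in> carrier G \<Longrightarrow> h \<in> transporter G g (conj_by G h g)"
  by (simp add: transporter_iff)

lemma transporter_int_pow:
  assumes "g \<in> carrier G" "g' \<in> carrier G" "\<sigma> \<in> transporter G g g'"
  shows "g' [^] (k::int) \<otimes> \<sigma> = \<sigma> \<otimes> g [^] k"
proof -
  have \<sigma>: "\<sigma> \<in> carrier G" "g' = conj_by G \<sigma> g"
    using assms by (auto simp: transporter_iff)
  have "g' [^] k = \<sigma> \<otimes> g [^] k \<otimes> inv \<sigma>"
    using conj_by_int_pow[OF \<sigma>(1) assms(1), of k] by (simp add: \<sigma>(2) conj_by_def)
  then show ?thesis
    using \<sigma>(1) assms(1) by (simp add: m_assoc)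
qed

text \<open>A composite of arrows adds a coset modulo \<open>ord g'\<close> to a coset modulo
  \<open>ord g\<close>, so the two orders have to agree.\<close>

lemma transporter_ord:
  assumes "g \<in> carrier G" "g' \<in> carrier G" "\<sigma> \<in> transporter G g g'"
  shows "ord g' = ord g"
proof -
  have \<sigma>: "\<sigma> \<in> carrier G"
    using assms by (auto simp: transporter_iff)
  have "g' [^] k = \<one> \<longleftrightarrow> g [^] k = \<one>" for k :: int
    using transporter_int_pow[OF assms, of k] \<sigma> assms
    by (metis int_pow_closed l_cancel_one' l_one r_cancel_one' r_one)
  \<comment> \<open>Comparing the integers divisible by each order also covers elements of infinite
    order, whose \<open>ord\<close> is 0.\<close>
  then have "int (ord g') dvd k \<longleftrightarrow> int (ord g) dvd k" for k
    using assms by (simp add: int_pow_eq_id)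
  then show ?thesis
    by (meson dvd_antisym dvd_refl int_dvd_int_iff)
qed

lemma tors_carrier: "g \<in> tors G \<Longrightarrow> g \<in> carrier G"
  by (simp add: tors_def)

lemma conj_by_tors:
  assumes "h \<in> carrier G" "g \<in> tors G"
  shows "conj_by G h g \<in> tors G"
proof -
  obtain l :: nat where l: "0 < l" "g [^] l = \<one>" and g: "g \<in> carrier G"
    using assms(2) by (auto simp: tors_def)
  have "conj_by G h g [^] l = conj_by G h (g [^] l)"
    by (rule hom_nat_pow[OF conj_by_hom, symmetric]) (use assms g in auto)
  also have "\<dots> = \<one>"
    using assms(1) by (simp add: l conj_by_def)
  finally show ?thesis
    using l(1) g assms(1) by (auto simp: tors_def)
qed

text \<open>The classes of \<open>(\<sigma>, t)\<close>, \<open>t\<close> real, in \<open>\<Lambda>\<^sub>G(g)\<close> and in \<open>\<Lambda>\<^sub>G(g, g')\<close>.\<close>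

definition real_class :: "'a \<Rightarrow> 'a \<Rightarrow> real \<Rightarrow> ('a \<times> real) set" where
  "real_class g \<sigma> t = {(\<sigma> \<otimes> g [^] k, t - of_int k) | k::int. True}"

definition mor_class :: "'a \<Rightarrow> 'a \<Rightarrow> real \<Rightarrow> ('a \<times> real set) set" where
  "mor_class g \<sigma> t = Lambda_class G g (\<sigma>, circle_coset (ord g) t)"

lemma mor_class_eq: "mor_class g \<sigma> t = {(\<sigma> \<otimes> g [^] k, circle_coset (ord g) (t - of_int k)) | k::int. True}"
  by (simp add: mor_class_def Lambda_class_def circle_coset_shift)

lemma image_real_class: "(\<lambda>(h, t). (h, circle_coset (ord g) t)) ` real_class g \<sigma> t = mor_class g \<sigma> t"
  unfolding real_class_def mor_class_eq by force

text \<open>The right-hand side no longer mentions cosets in the circle: a full turn of the circle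
  is absorbed into the exponent of \<open>g\<close>. It is the same identification that
  \<open>real_class\<close> makes on pairs with a real parameter.\<close>

lemma mor_class_eq_iff:
  assumes g: "g \<in> carrier G" and \<sigma>: "\<sigma> \<in> carrier G" and \<sigma>': "\<sigma>' \<in> carrier G"
  shows "mor_class g \<sigma> t = mor_class g \<sigma>' t' \<longleftrightarrow> (\<exists>k::int. \<sigma>' = \<sigma> \<otimes> g [^] k \<and> t' = t - of_int k)"
proof
  assume eq: "mor_class g \<sigma> t = mor_class g \<sigma>' t'"
  have "(\<sigma>', circle_coset (ord g) t') \<in> mor_class g \<sigma>' t'"
    unfolding mor_class_eq using \<sigma>' g by (auto intro!: exI[of _ "0::int"])
  then obtain k :: int where k: "\<sigma>' = \<sigma> \<otimes> g [^] k" "circle_coset (ord g) t' = circle_coset (ord g) (t - of_int k)"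
    unfolding eq[symmetric] by (auto simp: mor_class_eq)
  then obtain m :: int where m: "t' = (t - of_int k) + of_int m * of_nat (ord g)"
    using circle_coset_eq_iff by metis
  \<comment> \<open>The discrepancy of \<open>m\<close> turns is moved into the exponent, which does
    not change the power of \<open>g\<close>.\<close>
  have "g [^] k = g [^] (k - m * int (ord g))"
    using g by (simp add: int_pow_eq)
  moreover have "t' = t - of_int (k - m * int (ord g))"
    by (simp add: m)
  ultimately show "\<exists>k::int. \<sigma>' = \<sigma> \<otimes> g [^] k \<and> t' = t - of_int k"
    using k(1) by metis
next
  assume "\<exists>k::int. \<sigma>' = \<sigma> \<otimes> g [^] k \<and> t' = t - of_int k"
  then obtain k :: int where k: "\<sigma>' = \<sigma> \<otimes> g [^] k" "t' = t - of_int k"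
    by blast
  have *: "\<sigma>' \<otimes> g [^] j = \<sigma> \<otimes> g [^] (k + j)" for j :: int
    using g \<sigma> by (simp add: k m_assoc int_pow_mult)
  show "mor_class g \<sigma> t = mor_class g \<sigma>' t'"
    unfolding mor_class_eq *
  proof (intro equalityI subsetI; clarsimp)
    fix j :: int
    show "\<exists>i. \<sigma> \<otimes> g [^] j = \<sigma> \<otimes> g [^] (k + i) \<and>
        circle_coset (ord g) (t - of_int j) = circle_coset (ord g) (t' - of_int i)"
      by (rule exI[of _ "j - k"]) (simp add: k)
    show "\<exists>i. \<sigma> \<otimes> g [^] (k + j) = \<sigma> \<otimes> g [^] i \<and>
        circle_coset (ord g) (t' - of_int j) = circle_coset (ord g) (t - of_int i)"
      by (rule exI[of _ "k + j"]) (simp add: k algebra_simps)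
  qed
qed

end

lemma carrier_real_group: "carrier real_group = UNIV"
  by (simp add: real_group_def)

context group
begin

lemma shifted_mult:
  assumes c: "g \<in> carrier G" "g' \<in> carrier G"
    and \<sigma>: "\<sigma> \<in> carrier G" and \<tau>: "\<tau> \<in> transporter G g g'"
  shows "(\<sigma> \<otimes> g' [^] i) \<otimes> (\<tau> \<otimes> g [^] j) = \<sigma> \<otimes> \<tau> \<otimes> g [^] (i + j :: int)"
proof -
  have \<tau>': "\<tau> \<in> carrier G"
    using \<tau> by (rule transporter_carrier)
  have "(\<sigma> \<otimes> g' [^] i) \<otimes> (\<tau> \<otimes> g [^] j) = \<sigma> \<otimes> (g' [^] i \<otimes> \<tau>) \<otimes> g [^] j"
    using c \<sigma> \<tau>' by (simp add: m_assoc)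
  also have "\<dots> = \<sigma> \<otimes> \<tau> \<otimes> g [^] (i + j)"
    unfolding transporter_int_pow[OF c \<tau>] using c \<sigma> \<tau>' by (simp add: m_assoc int_pow_mult)
  finally show ?thesis .
qed

lemma Lambda_comp_mor_class:
  assumes c: "g \<in> carrier G" "g' \<in> carrier G"
    and \<sigma>: "\<sigma> \<in> carrier G" and \<tau>: "\<tau> \<in> transporter G g g'"
  shows "Lambda_comp G (mor_class g' \<sigma> s) (mor_class g \<tau> t) = mor_class g (\<sigma> \<otimes> \<tau>) (s + t)"
proof -
  note [simp] = transporter_ord[OF c \<tau>]
  note e = shifted_mult[OF c \<sigma> \<tau>]
  show ?thesis
  proof (intro equalityI subsetI)
    fix p assume "p \<in> Lambda_comp G (mor_class g' \<sigma> s) (mor_class g \<tau> t)"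
    then obtain i j :: int where "p = ((\<sigma> \<otimes> g' [^] i) \<otimes> (\<tau> \<otimes> g [^] j),
        circle_coset (ord g) ((s - of_int i) + (t - of_int j)))"
      by (auto simp: Lambda_comp_def mor_class_eq circle_coset_add)
    then have "p = (\<sigma> \<otimes> \<tau> \<otimes> g [^] (i + j), circle_coset (ord g) (s + t - of_int (i + j)))"
      by (simp add: e algebra_simps)
    then show "p \<in> mor_class g (\<sigma> \<otimes> \<tau>) (s + t)"
      unfolding mor_class_eq by blast
  next
    fix p assume "p \<in> mor_class g (\<sigma> \<otimes> \<tau>) (s + t)"
    then obtain j :: int where p: "p = (\<sigma> \<otimes> \<tau> \<otimes> g [^] j, circle_coset (ord g) (s + t - of_int j))"
      by (auto simp: mor_class_eq)
    \<comment> \<open>The whole shift is put into the right-hand factor; the left-hand factor keeps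
      exponent 0.\<close>
    have "p = (\<lambda>((\<sigma>, S), (\<tau>, T)). (\<sigma> \<otimes> \<tau>, (\<lambda>(s, t). s + t) ` (S \<times> T)))
        ((\<sigma> \<otimes> g' [^] (0::int), circle_coset (ord g') (s - of_int 0)),
         (\<tau> \<otimes> g [^] j, circle_coset (ord g) (t - of_int j)))"
      using e[of 0 j] by (simp add: p circle_coset_add algebra_simps)
    then show "p \<in> Lambda_comp G (mor_class g' \<sigma> s) (mor_class g \<tau> t)"
      unfolding Lambda_comp_def mor_class_eq by blast
  qed
qed

lemma conj_real_class:
  assumes "h \<in> carrier G" "g \<in> carrier G" "u \<in> carrier G"
  shows "(\<lambda>(u, t). (conj_by G h u, t)) ` real_class g u t = real_class (conj_by G h g) (conj_by G h u) t"
proof -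
  have "conj_by G h (u \<otimes> g [^] k) = conj_by G h u \<otimes> conj_by G h g [^] k" for k :: int
    using assms by (simp add: conj_by_mult conj_by_int_pow)
  then show ?thesis
    by (simp add: real_class_def full_SetCompr_eq image_image)
qed

text \<open>Conjugates by the chosen \<open>a\<close> at the source and \<open>b\<close> at the
  target and unwinds the circle at the same time: all real members of each coset are collected, so
  no representative has to be chosen.\<close>

definition retract_class :: "'a \<Rightarrow> 'a \<Rightarrow> ('a \<times> real set) set \<Rightarrow> ('a \<times> real) set" where
  "retract_class a b A = {(b \<otimes> \<sigma> \<otimes> inv a, t) | \<sigma> T t. (\<sigma>, T) \<in> A \<and> t \<in> T}"

text \<open>Unwinding yields parameters \<open>t - k + m l\<close>, with \<open>l\<close> the order
  of \<open>g\<close>. Since \<open>g\<^sup>l\<close> is trivial, the exponent \<open>k\<close> may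
  be replaced by \<open>k - m l\<close>, and the pairs form one class with real parameter. Moving
  \<open>a\<inverse>\<close> to the left of the power of \<open>g\<close> turns \<open>g\<close>
  into its conjugate by \<open>a\<close>.\<close>

lemma retract_mor_class:
  assumes c: "g \<in> carrier G" "a \<in> carrier G" "b \<in> carrier G" "\<sigma> \<in> carrier G"
  shows "retract_class a b (mor_class g \<sigma> t) = real_class (conj_by G a g) (b \<otimes> \<sigma> \<otimes> inv a) t"
proof -
  have e: "b \<otimes> (\<sigma> \<otimes> g [^] k) \<otimes> inv a = b \<otimes> \<sigma> \<otimes> inv a \<otimes> conj_by G a g [^] k" for k :: int
  proof -
    have "conj_by G a g [^] k = conj_by G a (g [^] k)"
      using c by (simp add: conj_by_int_pow)
    then have "inv a \<otimes> conj_by G a g [^] k = g [^] k \<otimes> inv a"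
      using c by (simp add: conj_by_def m_assoc inv_cancel)
    then show ?thesis
      using c by (simp add: m_assoc)
  qed
  show ?thesis
  proof (intro equalityI subsetI)
    fix p assume "p \<in> retract_class a b (mor_class g \<sigma> t)"
    then obtain k m :: int where p: "p = (b \<otimes> (\<sigma> \<otimes> g [^] k) \<otimes> inv a, t - of_int k + of_int m * of_nat (ord g))"
      by (auto simp: retract_class_def mor_class_eq circle_coset_def)
    have "g [^] k = g [^] (k - m * int (ord g))"
      using c by (simp add: int_pow_eq)
    then have "p = (b \<otimes> (\<sigma> \<otimes> g [^] (k - m * int (ord g))) \<otimes> inv a, t - of_int (k - m * int (ord g)))"
      by (simp add: p)
    then show "p \<in> real_class (conj_by G a g) (b \<otimes> \<sigma> \<otimes> inv a) t"
      unfolding e real_class_def by blast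
  next
    fix p assume "p \<in> real_class (conj_by G a g) (b \<otimes> \<sigma> \<otimes> inv a) t"
    then obtain k :: int where "p = (b \<otimes> (\<sigma> \<otimes> g [^] k) \<otimes> inv a, t - of_int k)"
      unfolding e real_class_def by blast
    then show "p \<in> retract_class a b (mor_class g \<sigma> t)"
      unfolding retract_class_def mor_class_eq using mem_circle_coset by blast
  qed
qed

section \<open>The groups \<open>\<Lambda>\<^sub>G(g)\<close> in terms of classes\<close>

lemma carrier_centralizer [simp]: "carrier (centralizer_group G g) = transporter G g g"
  by (auto simp: centralizer_group_def transporter_def)

lemma group_centralizer:
  assumes g: "g \<in> carrier G"
  shows "group (centralizer_group G g)"
proof -
  have "subgroup (transporter G g g) G"
    using g transporter_mult[OF g g g] transporter_inv[OF g g] transporter_one[OF g]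
    by (intro subgroupI) (auto simp: transporter_carrier)
  then have "group (G\<lparr>carrier := transporter G g g\<rparr>)"
    by (rule subgroup_imp_group)
  moreover have "{h \<in> carrier G. h \<otimes> g = g \<otimes> h} = transporter G g g"
    by (auto simp: transporter_def)
  ultimately show ?thesis
    by (simp add: centralizer_group_def)
qed

lemma mult_centralizer [simp]: "x \<otimes>\<^bsub>centralizer_group G g\<^esub> y = x \<otimes> y"
  and one_centralizer [simp]: "\<one>\<^bsub>centralizer_group G g\<^esub> = \<one>"
  by (simp_all add: centralizer_group_def)

text \<open>A subgroup generated by one element consists of its integer powers, and the two
  projections, being homomorphisms, compute these powers componentwise.\<close>

lemma Lambda_sub_eq:
  assumes g: "g \<in> carrier G"
  shows "Lambda_sub G g = real_class g \<one> 0"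
proof -
  let ?C = "centralizer_group G g" and ?H = "centralizer_group G g \<times>\<times> real_group"
  interpret C: group ?C by (rule group_centralizer[OF g])
  interpret R: group real_group by (rule group_real_group)
  interpret H: group ?H
    by (rule DirProd_group) unfold_locales
  have gH: "(g, -1) \<in> carrier ?H"
    using g by (simp add: transporter_def real_group_def)
  have "(g, -1) [^]\<^bsub>?H\<^esub> (k::int) = (g [^] k, - of_int k)" for k
  proof (rule prod_eqI)
    have hom1: "fst \<in> hom ?H G" and hom2: "snd \<in> hom ?H real_group"
      by (auto simp: hom_def transporter_carrier)
    show "fst ((g, -1) [^]\<^bsub>?H\<^esub> k) = fst (g [^] k, - of_int k)"
      using hom_int_pow[OF hom1 gH H.group_axioms group_axioms, of k] by simp
    show "snd ((g, -1) [^]\<^bsub>?H\<^esub> k) = snd (g [^] k, - of_int k)"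
      using hom_int_pow[OF hom2 gH H.group_axioms R.group_axioms, of k] by (simp add: real_group_int_pow)
  qed
  then show ?thesis
    unfolding Lambda_sub_def H.generate_pow[OF gH] real_class_def using g by auto
qed

text \<open>The quotient group is formed from right cosets, with powers of \<open>g\<close> on the
  left of \<open>h\<close>; they pass to the right because \<open>h\<close> commutes with
  \<open>g\<close>.\<close>

lemma Lambda_coset:
  assumes g: "g \<in> carrier G" and h: "h \<in> transporter G g g"
  shows "Lambda_sub G g #>\<^bsub>centralizer_group G g \<times>\<times> real_group\<^esub> (h, t) = real_class g h t"
proof -
  have "(\<one> \<otimes> g [^] k) \<otimes> h = h \<otimes> g [^] k" for k :: int
    using transporter_int_pow[OF g g h] g by simp
  then show ?thesis
    unfolding Lambda_sub_eq[OF g] r_coset_def real_class_def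
    by (auto simp: real_group_def)
qed

lemma carrier_Lambda_group:
  assumes g: "g \<in> carrier G"
  shows "A \<in> carrier (Lambda_group G g) \<longleftrightarrow> (\<exists>h\<in>transporter G g g. \<exists>t. A = real_class g h t)"
proof -
  have "carrier (Lambda_group G g) =
      (\<Union>p\<in>transporter G g g \<times> UNIV. {Lambda_sub G g #>\<^bsub>centralizer_group G g \<times>\<times> real_group\<^esub> p})"
    by (simp add: Lambda_group_def FactGroup_def RCOSETS_def carrier_real_group)
  then show ?thesis
    using Lambda_coset[OF g] by fastforce
qed

lemma mult_Lambda_group:
  assumes g: "g \<in> carrier G" and h: "h \<in> transporter G g g" and h': "h' \<in> transporter G g g"
  shows "real_class g h t \<otimes>\<^bsub>Lambda_group G g\<^esub> real_class g h' t' = real_class g (h \<otimes> h') (t + t')"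
proof -
  note e = shifted_mult[OF g g transporter_carrier[OF h] h']
  have "real_class g h t \<otimes>\<^bsub>Lambda_group G g\<^esub> real_class g h' t' =
      {((h \<otimes> g [^] i) \<otimes> (h' \<otimes> g [^] j), (t - of_int i) + (t' - of_int j)) | i j :: int. True}"
  proof (intro equalityI subsetI)
    fix p assume "p \<in> real_class g h t \<otimes>\<^bsub>Lambda_group G g\<^esub> real_class g h' t'"
    then show "p \<in> {((h \<otimes> g [^] i) \<otimes> (h' \<otimes> g [^] j), (t - of_int i) + (t' - of_int j)) | i j :: int. True}"
      by (auto simp: Lambda_group_def FactGroup_def set_mult_def real_class_def real_group_def)
  next
    fix p assume "p \<in> {((h \<otimes> g [^] i) \<otimes> (h' \<otimes> g [^] j), (t - of_int i) + (t' - of_int j)) | i j :: int. True}"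
    then obtain i j :: int where "p = (h \<otimes> g [^] i, t - of_int i) \<otimes>\<^bsub>centralizer_group G g \<times>\<times> real_group\<^esub> (h' \<otimes> g [^] j, t' - of_int j)"
      by (auto simp: real_group_def)
    then show "p \<in> real_class g h t \<otimes>\<^bsub>Lambda_group G g\<^esub> real_class g h' t'"
      unfolding Lambda_group_def FactGroup_def monoid.simps set_mult_def real_class_def by blast
  qed
  also have "\<dots> = real_class g (h \<otimes> h') (t + t')"
    unfolding e real_class_def
  proof (intro equalityI subsetI)
    fix p assume "p \<in> {(h \<otimes> h' \<otimes> g [^] (i + j), (t - of_int i) + (t' - of_int j)) | i j :: int. True}"
    then obtain i j :: int where "p = (h \<otimes> h' \<otimes> g [^] (i + j), (t - of_int i) + (t' - of_int j))"
      by blast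
    then have "p = (h \<otimes> h' \<otimes> g [^] (i + j), t + t' - of_int (i + j))"
      by simp
    then show "p \<in> {(h \<otimes> h' \<otimes> g [^] k, t + t' - of_int k) | k :: int. True}"
      by blast
  next
    fix p assume "p \<in> {(h \<otimes> h' \<otimes> g [^] k, t + t' - of_int k) | k :: int. True}"
    then obtain k :: int where "p = (h \<otimes> h' \<otimes> g [^] (k + 0), (t - of_int k) + (t' - of_int 0))"
      by auto
    then show "p \<in> {(h \<otimes> h' \<otimes> g [^] (i + j), (t - of_int i) + (t' - of_int j)) | i j :: int. True}"
      by blast
  qed
  finally show ?thesis .
qed

lemma one_Lambda_group: "g \<in> carrier G \<Longrightarrow> \<one>\<^bsub>Lambda_group G g\<^esub> = real_class g \<one> 0"
  by (simp add: Lambda_group_def FactGroup_def Lambda_sub_eq)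

end

lemma quotient_topology_cong:
  assumes "\<And>x. x \<in> topspace T \<Longrightarrow> q x = q' x"
  shows "quotient_topology T q = quotient_topology T q'"
proof -
  have "q ` topspace T = q' ` topspace T" "{x \<in> topspace T. q x \<in> V} = {x \<in> topspace T. q' x \<in> V}" for V
    using assms by auto
  then show ?thesis
    by (simp add: topology_eq openin_quotient_topology)
qed

section \<open>Actions on fixed points and the topology of classes\<close>

locale gspace =
  fixes G :: "('g, 'b) monoid_scheme" (structure) and TG :: "'g topology"
    and TX :: "'x topology" and \<phi> :: "'g \<Rightarrow> 'x \<Rightarrow> 'x"
  assumes topological_group: "topological_group G TG" and G_space: "G_space G TG TX \<phi>"
begin

sublocale group G
  using topological_group by (simp add: topological_group_def)

sublocale gact: group_action G "topspace TX" \<phi>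
  using G_space by (simp add: G_space_def)

abbreviation fixed_space :: "'g \<Rightarrow> 'x topology" where
  "fixed_space g \<equiv> subtopology TX (fixed_points TX \<phi> g)"

lemma topspace_TG: "topspace TG = carrier G"
  using topological_group by (simp add: topological_group_def)

lemma continuous_map_mult:
  assumes "continuous_map X TG f" "continuous_map X TG h"
  shows "continuous_map X TG (\<lambda>x. f x \<otimes> h x)"
proof -
  have "continuous_map (prod_topology TG TG) TG (\<lambda>(x, y). x \<otimes> y)"
    using topological_group by (simp add: topological_group_def)
  from continuous_map_compose[OF _ this, of X "\<lambda>x. (f x, h x)"] assms show ?thesis
    by (simp add: continuous_map_pairwise o_def)
qed

lemma continuous_map_action:
  assumes "continuous_map X TG f" "continuous_map X TX h"
  shows "continuous_map X TX (\<lambda>x. \<phi> (f x) (h x))"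
proof -
  have "continuous_map (prod_topology TG TX) TX (\<lambda>(g, x). \<phi> g x)"
    using G_space by (simp add: G_space_def)
  from continuous_map_compose[OF _ this, of X "\<lambda>x. (f x, h x)"] assms show ?thesis
    by (simp add: continuous_map_pairwise o_def)
qed

lemma action_one: "x \<in> topspace TX \<Longrightarrow> \<phi> \<one> x = x"
  using fun_cong[OF gact.id_eq_one, of x] by simp

lemma action_closed: "g \<in> carrier G \<Longrightarrow> x \<in> topspace TX \<Longrightarrow> \<phi> g x \<in> topspace TX"
  using gact.surj_prop by blast

lemma action_mult:
  "g \<in> carrier G \<Longrightarrow> h \<in> carrier G \<Longrightarrow> x \<in> topspace TX \<Longrightarrow> \<phi> (g \<otimes> h) x = \<phi> g (\<phi> h x)"
  using gact.composition_rule by simp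

lemma fixed_pointsD: "x \<in> fixed_points TX \<phi> g \<Longrightarrow> x \<in> topspace TX" "x \<in> fixed_points TX \<phi> g \<Longrightarrow> \<phi> g x = x"
  by (auto simp: fixed_points_def)

lemma action_transporter:
  assumes "g \<in> carrier G" "g' \<in> carrier G" "\<sigma> \<in> transporter G g g'" "x \<in> fixed_points TX \<phi> g"
  shows "\<phi> \<sigma> x \<in> fixed_points TX \<phi> g'"
proof -
  have \<sigma>: "\<sigma> \<in> carrier G" "g' \<otimes> \<sigma> = \<sigma> \<otimes> g"
    using assms by (auto simp: transporter_def)
  have "\<phi> g' (\<phi> \<sigma> x) = \<phi> (\<sigma> \<otimes> g) x"
    using assms \<sigma> by (simp add: fixed_points_def flip: \<sigma>(2) action_mult)
  also have "\<dots> = \<phi> \<sigma> x"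
    using assms \<sigma> by (simp add: fixed_points_def action_mult)
  finally show ?thesis
    using assms \<sigma> by (simp add: fixed_points_def action_closed)
qed

lemma action_int_pow:
  assumes "g \<in> carrier G" "x \<in> fixed_points TX \<phi> g"
  shows "\<phi> (g [^] (k::int)) x = x"
proof -
  have x: "x \<in> topspace TX" "\<phi> g x = x"
    using assms by (auto simp: fixed_points_def)
  have n: "\<phi> (g [^] (n::nat)) x = x" for n
    by (induction n) (use assms x in \<open>auto simp: action_one action_mult\<close>)
  have "\<phi> (inv (g [^] (n::nat))) x = x" for n
    using action_mult[of "inv (g [^] n)" "g [^] n" x] n[of n] assms x by (simp add: action_one)
  then show ?thesis
    unfolding int_pow_def2[of G g k] by (simp only: n split: if_split) simp
qed

lemma class_act_eq:
  assumes "g \<in> carrier G" "\<sigma> \<in> carrier G" "x \<in> fixed_points TX \<phi> g"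
    and "A \<noteq> {}" "\<And>p. p \<in> A \<Longrightarrow> \<exists>k::int. fst p = \<sigma> \<otimes> g [^] k"
  shows "class_act \<phi> A x = \<phi> \<sigma> x"
proof -
  obtain k :: int where "fst (SOME p. p \<in> A) = \<sigma> \<otimes> g [^] k"
    using assms(4,5) some_in_eq by blast
  then show ?thesis
    using assms(1,2) action_int_pow[OF assms(1,3)] fixed_pointsD(1)[OF assms(3)]
    by (simp add: class_act_def action_mult)
qed

lemma class_act_classes:
  assumes "g \<in> carrier G" "\<sigma> \<in> carrier G" "x \<in> fixed_points TX \<phi> g"
  shows class_act_mor_class: "class_act \<phi> (mor_class g \<sigma> t) x = \<phi> \<sigma> x"
    and class_act_real_class: "class_act \<phi> (real_class g \<sigma> t) x = \<phi> \<sigma> x"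
  by (rule class_act_eq[OF assms]; auto simp: mor_class_eq real_class_def)+

abbreviation pair_space :: "'g \<Rightarrow> 'g \<Rightarrow> ('g \<times> real) topology" where
  "pair_space g g' \<equiv> prod_topology (subtopology TG (transporter G g g')) euclideanreal"

lemma topspace_pair_space [simp]: "p \<in> topspace (pair_space g g') \<longleftrightarrow> fst p \<in> transporter G g g'"
  by (cases p) (auto simp: topspace_TG transporter_def)

text \<open>The morphism space is a quotient in two stages, passing to the circle and then dividing
  by the shifts. The map onto the circle is open, so its product with the transporter is still a
  quotient map, and both stages combine into one quotient of pairs with a real parameter.\<close>

lemma quotient_map_mor_class:
  assumes g: "g \<in> carrier G"
  shows "quotient_map (pair_space g g') (Lambda_mor_top G TG g g') (\<lambda>(\<sigma>, t). mor_class g \<sigma> t)"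
proof -
  let ?l = "ord g" and ?C = "subtopology TG (transporter G g g')"
  have q: "quotient_map euclideanreal (circle_top ?l) (circle_coset ?l)"
    unfolding circle_top_def by (rule quotient_map_quotient_topology)
  have op: "open_map euclideanreal (circle_top ?l) (circle_coset ?l)"
  proof (rule open_map_quotientI[OF q])
    fix U :: "real set" assume "openin euclideanreal U"
    then have U: "open U" by simp
    have "{x \<in> topspace euclideanreal. circle_coset ?l x \<in> circle_coset ?l ` U} = (\<Union>m::int. (\<lambda>x. x + of_int m * of_nat ?l) -` U)"
      by (auto simp: image_iff circle_coset_eq_iff)
    also have "open \<dots>"
      by (intro open_UN ballI open_vimage U continuous_intros)
    finally show "openin euclideanreal {x \<in> topspace euclideanreal. circle_coset ?l x \<in> circle_coset ?l ` U}"
      by simp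
  qed
  have "quotient_map (pair_space g g') (prod_topology ?C (circle_top ?l)) (\<lambda>(\<sigma>, t). (\<sigma>, circle_coset ?l t))"
  proof (rule continuous_open_imp_quotient_map)
    show "continuous_map (pair_space g g') (prod_topology ?C (circle_top ?l)) (\<lambda>(\<sigma>, t). (\<sigma>, circle_coset ?l t))"
      using continuous_map_compose[OF continuous_map_snd quotient_imp_continuous_map[OF q]]
      by (auto simp: continuous_map_pairwise o_def case_prod_unfold continuous_map_fst)
    show "open_map (pair_space g g') (prod_topology ?C (circle_top ?l)) (\<lambda>(\<sigma>, t). (\<sigma>, circle_coset ?l t))"
      by (rule open_map_prod[OF _ op]) (simp add: open_map_def)
    show "(\<lambda>(\<sigma>, t). (\<sigma>, circle_coset ?l t)) ` topspace (pair_space g g') = topspace (prod_topology ?C (circle_top ?l))"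
      by (simp only: topspace_prod_topology image_paired_Times image_ident quotient_imp_surjective_map[OF q])
  qed
  from quotient_map_compose[OF this quotient_map_quotient_topology[of _ "Lambda_class G g"]]
  show ?thesis
    by (simp add: Lambda_mor_top_def o_def case_prod_unfold mor_class_def)
qed

lemma topspace_Lambda_mor_top:
  assumes "g \<in> carrier G"
  shows "A \<in> topspace (Lambda_mor_top G TG g g') \<longleftrightarrow> (\<exists>\<sigma>\<in>transporter G g g'. \<exists>t. A = mor_class g \<sigma> t)"
proof -
  have "topspace (Lambda_mor_top G TG g g') = (\<lambda>(\<sigma>, t). mor_class g \<sigma> t) ` topspace (pair_space g g')"
    using quotient_imp_surjective_map[OF quotient_map_mor_class[OF assms]] by simp
  moreover have "topspace (pair_space g g') = transporter G g g' \<times> UNIV"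
    by (auto simp: topspace_TG transporter_def)
  ultimately show ?thesis
    by auto
qed

text \<open>By \<open>mor_class_eq_iff\<close> the saturation of an open set is the union of its
  preimages under the shifts \<open>sh k\<close>, and right multiplication by a power of
  \<open>g\<close> is continuous and preserves the transporter.\<close>

lemma open_map_mor_class:
  assumes g: "g \<in> carrier G" and g': "g' \<in> carrier G"
  shows "open_map (pair_space g g') (Lambda_mor_top G TG g g') (\<lambda>(\<sigma>, t). mor_class g \<sigma> t)"
proof (rule open_map_quotientI[OF quotient_map_mor_class[OF g]])
  let ?C = "subtopology TG (transporter G g g')"
  fix U assume U: "openin (pair_space g g') U"
  define sh where "sh = (\<lambda>(k::int) (p::'g \<times> real). (fst p \<otimes> g [^] k, snd p - of_int k))"
  have tr: "\<sigma> \<otimes> g [^] k \<in> transporter G g g'" if "\<sigma> \<in> transporter G g g'" for \<sigma> and k :: int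
  proof -
    have "g [^] k \<in> transporter G g g"
      using transporter_int_pow[OF g g, of g k] g by (simp add: transporter_def)
    then show ?thesis
      by (rule transporter_mult[OF g g g' that])
  qed
  have sh: "continuous_map (pair_space g g') (pair_space g g') (sh k)" for k
  proof -
    have "continuous_map (pair_space g g') TG (\<lambda>p. fst p \<otimes> g [^] k)"
      by (intro continuous_map_mult continuous_map_into_fulltopology[OF continuous_map_fst])
        (auto simp: topspace_TG g)
    moreover have "continuous_map (pair_space g g') euclideanreal (\<lambda>p. snd p - of_int k)"
      by (intro continuous_map_diff continuous_map_snd) auto
    ultimately show ?thesis
      using tr by (auto simp: sh_def continuous_map_pairwise o_def continuous_map_in_subtopology)
  qed
  have "{p \<in> topspace (pair_space g g'). (case p of (\<sigma>, t) \<Rightarrow> mor_class g \<sigma> t) \<in> (\<lambda>(\<sigma>, t). mor_class g \<sigma> t) ` U} =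
      (\<Union>k. {p \<in> topspace (pair_space g g'). sh k p \<in> U})"
  proof (intro equalityI subsetI)
    fix p assume p: "p \<in> {p \<in> topspace (pair_space g g'). (case p of (\<sigma>, t) \<Rightarrow> mor_class g \<sigma> t) \<in> (\<lambda>(\<sigma>, t). mor_class g \<sigma> t) ` U}"
    then obtain \<sigma>' t' where u: "(\<sigma>', t') \<in> U" "mor_class g (fst p) (snd p) = mor_class g \<sigma>' t'"
      by auto
    have "\<sigma>' \<in> carrier G" "fst p \<in> carrier G"
      using openin_subset[OF U] u(1) p transporter_carrier by (auto simp: topspace_TG)
    then obtain k :: int where "\<sigma>' = fst p \<otimes> g [^] k" "t' = snd p - of_int k"
      using u(2) mor_class_eq_iff[OF g] by blast
    then have "sh k p \<in> U"
      using u(1) by (simp add: sh_def)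
    then show "p \<in> (\<Union>k. {p \<in> topspace (pair_space g g'). sh k p \<in> U})"
      using p by auto
  next
    fix p assume "p \<in> (\<Union>k. {p \<in> topspace (pair_space g g'). sh k p \<in> U})"
    then obtain k where p: "p \<in> topspace (pair_space g g')" "sh k p \<in> U"
      by blast
    have "fst p \<in> carrier G"
      using p(1)[unfolded topspace_pair_space] by (rule transporter_carrier)
    then have "mor_class g (fst p) (snd p) = mor_class g (fst (sh k p)) (snd (sh k p))"
      using mor_class_eq_iff[OF g, of "fst p" "fst (sh k p)"] g by (auto simp: sh_def)
    then show "p \<in> {p \<in> topspace (pair_space g g'). (case p of (\<sigma>, t) \<Rightarrow> mor_class g \<sigma> t) \<in> (\<lambda>(\<sigma>, t). mor_class g \<sigma> t) ` U}"
      using p by (auto simp: case_prod_unfold image_iff intro!: bexI[of _ "sh k p"])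
  qed
  then show "openin (pair_space g g') {p \<in> topspace (pair_space g g'). (case p of (\<sigma>, t) \<Rightarrow> mor_class g \<sigma> t) \<in> (\<lambda>(\<sigma>, t). mor_class g \<sigma> t) ` U}"
    using openin_continuous_map_preimage[OF sh U] by auto
qed

lemma quotient_map_real_class:
  assumes g: "g \<in> carrier G"
  shows "quotient_map (pair_space g g) (Lambda_top G TG g) (\<lambda>(h, t). real_class g h t)"
proof -
  have "Lambda_top G TG g = quotient_topology (pair_space g g) (\<lambda>(h, t). real_class g h t)"
    unfolding Lambda_top_def carrier_centralizer
    by (rule quotient_topology_cong) (auto simp: Lambda_coset[OF g])
  then show ?thesis
    by (simp add: quotient_map_quotient_topology)
qed

lemma topspace_Lambda_top:
  assumes "g \<in> carrier G"
  shows "A \<in> topspace (Lambda_top G TG g) \<longleftrightarrow> (\<exists>h\<in>transporter G g g. \<exists>t. A = real_class g h t)"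
proof -
  have "topspace (Lambda_top G TG g) = (\<lambda>(h, t). real_class g h t) ` topspace (pair_space g g)"
    using quotient_imp_surjective_map[OF quotient_map_real_class[OF assms]] by simp
  moreover have "topspace (pair_space g g) = transporter G g g \<times> UNIV"
    by (auto simp: topspace_TG transporter_def)
  ultimately show ?thesis
    by auto
qed

end

section \<open>The inertia groupoid\<close>

text \<open>With \<open>P\<close> selecting the indices in one conjugacy class, this gives maps out
  of a piece of the inertia groupoid summand by summand, so a choice made separately for each index
  causes no discontinuity.\<close>

lemma continuous_map_from_sum_sub:
  assumes "\<And>i. i \<in> I \<Longrightarrow> P i \<Longrightarrow> continuous_map (X i) Y (\<lambda>x. f (i, x))"
  shows "continuous_map (subtopology (sum_topology X I) {z. P (fst z)}) Y f"
  unfolding continuous_map_def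
proof (intro conjI allI impI)
  let ?S = "subtopology (sum_topology X I) {z. P (fst z)}"
  show "f \<in> topspace ?S \<rightarrow> topspace Y"
    using continuous_map_mem[OF assms] by auto
  fix V assume V: "openin Y V"
  let ?W = "{z \<in> topspace (sum_topology X I). P (fst z) \<and> f z \<in> V}"
  have "openin (X i) {x. (i, x) \<in> ?W}" if "i \<in> I" for i
  proof (cases "P i")
    case True
    have "{x. (i, x) \<in> ?W} = {x \<in> topspace (X i). f (i, x) \<in> V}"
      using that True by auto
    then show ?thesis
      using openin_continuous_map_preimage[OF assms[OF that True] V] by simp
  qed simp
  then have "openin (sum_topology X I) ?W"
    unfolding openin_sum_topology by auto
  moreover have "{z \<in> topspace ?S. f z \<in> V} = ?W \<inter> {z. P (fst z)}"
    by auto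
  ultimately show "openin ?S {z \<in> topspace ?S. f z \<in> V}"
    unfolding openin_subtopology by blast
qed

lemma continuous_map_from_sum:
  assumes "\<And>i. i \<in> I \<Longrightarrow> continuous_map (X i) Y (\<lambda>x. f (i, x))"
  shows "continuous_map (sum_topology X I) Y f"
  using continuous_map_from_sum_sub[where P = "\<lambda>i. True", OF assms] by simp

lemma continuous_map_into_sum:
  assumes "i \<in> I" "continuous_map T (X i) f"
  shows "continuous_map T (sum_topology X I) (\<lambda>x. (i, f x))"
  using continuous_map_compose[OF assms(2) continuous_map_component_injection[OF assms(1), of X]] by (simp add: o_def)

context gspace
begin

abbreviation inertia :: "('g \<times> 'x, ('g \<times> 'g) \<times> (('g \<times> real set) set \<times> 'x)) tgroupoid" where
  "inertia \<equiv> Lambda_groupoid G TG TX \<phi>"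

abbreviation local_gpd :: "'g \<Rightarrow> ('x, ('g \<times> real) set \<times> 'x) tgroupoid" where
  "local_gpd \<equiv> Lambda_action_groupoid G TG TX \<phi>"

lemma inertia_simps [simp]:
  "Ob inertia = sum_topology fixed_space (tors G)"
  "Mor inertia = sum_topology (\<lambda>(g, g'). prod_topology (Lambda_mor_top G TG g g') (fixed_space g)) (tors G \<times> tors G)"
  "src inertia ((g, g'), (A, x)) = (g, x)" "tgt inertia ((g, g'), (A, x)) = (g', class_act \<phi> A x)"
  "cmp inertia ((g1, g2), (A, y)) ((g0, g1'), (B, x)) = ((g0, g2), (Lambda_comp G A B, x))"
  "idm inertia (g, x) = ((g, g), (mor_class g \<one> 0, x))"
  by (simp_all add: Lambda_groupoid_def mor_class_def)

lemma local_gpd_simps [simp]: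
  "Ob (local_gpd g) = fixed_space g" "Mor (local_gpd g) = prod_topology (Lambda_top G TG g) (fixed_space g)"
  "src (local_gpd g) = snd" "tgt (local_gpd g) = (\<lambda>(A, x). class_act \<phi> A x)"
  "cmp (local_gpd g) = (\<lambda>(A, y) (B, x). (A \<otimes>\<^bsub>Lambda_group G g\<^esub> B, x))"
  "idm (local_gpd g) = (\<lambda>x. (\<one>\<^bsub>Lambda_group G g\<^esub>, x))"
  by (simp_all add: action_groupoid_def)

lemma mor_inertiaE:
  assumes "m \<in> topspace (Mor inertia)"
  obtains g g' \<sigma> t x where "m = ((g, g'), (mor_class g \<sigma> t, x))" "g \<in> tors G" "g' \<in> tors G"
    "\<sigma> \<in> transporter G g g'" "x \<in> fixed_points TX \<phi> g"
  using assms that topspace_Lambda_mor_top tors_carrier by fastforce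

lemma mor_local_gpdE:
  assumes "m \<in> topspace (Mor (local_gpd g))" "g \<in> carrier G"
  obtains h t x where "m = (real_class g h t, x)" "h \<in> transporter G g g" "x \<in> fixed_points TX \<phi> g"
  using assms that topspace_Lambda_top by fastforce

lemma continuous_map_mor_class:
  assumes "g \<in> carrier G" "continuous_map T TG s" "continuous_map T euclideanreal t"
    "\<And>z. z \<in> topspace T \<Longrightarrow> s z \<in> transporter G g g'"
  shows "continuous_map T (Lambda_mor_top G TG g g') (\<lambda>z. mor_class g (s z) (t z))"
proof -
  have "continuous_map T (pair_space g g') (\<lambda>z. (s z, t z))"
    using assms by (auto simp: continuous_map_pairwise o_def continuous_map_in_subtopology)
  from continuous_map_compose[OF this quotient_imp_continuous_map[OF quotient_map_mor_class[OF assms(1)]]]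
  show ?thesis by (simp add: o_def)
qed

lemma continuous_map_real_class:
  assumes "g \<in> carrier G" "continuous_map T TG s" "continuous_map T euclideanreal t"
    "\<And>z. z \<in> topspace T \<Longrightarrow> s z \<in> transporter G g g"
  shows "continuous_map T (Lambda_top G TG g) (\<lambda>z. real_class g (s z) (t z))"
proof -
  have "continuous_map T (pair_space g g) (\<lambda>z. (s z, t z))"
    using assms by (auto simp: continuous_map_pairwise o_def continuous_map_in_subtopology)
  from continuous_map_compose[OF this quotient_imp_continuous_map[OF quotient_map_real_class[OF assms(1)]]]
  show ?thesis by (simp add: o_def)
qed

lemma continuous_map_pair_space:
  "continuous_map (pair_space g g') TG fst" "continuous_map (pair_space g g') euclideanreal snd"
  by (auto intro: continuous_map_into_fulltopology[OF continuous_map_fst] continuous_map_snd)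

lemma continuous_map_from_mor_class:
  assumes "g \<in> carrier G" "continuous_map (pair_space g g') Y (\<lambda>p. f (mor_class g (fst p) (snd p)))"
  shows "continuous_map (Lambda_mor_top G TG g g') Y f"
  using assms(2) continuous_compose_quotient_map_eq[OF quotient_map_mor_class[OF assms(1)], of g' Y f]
  by (simp add: o_def case_prod_unfold)

lemma continuous_map_from_real_class:
  assumes "g \<in> carrier G" "continuous_map (pair_space g g) Y (\<lambda>p. f (real_class g (fst p) (snd p)))"
  shows "continuous_map (Lambda_top G TG g) Y f"
  using assms(2) continuous_compose_quotient_map_eq[OF quotient_map_real_class[OF assms(1)], of Y f]
  by (simp add: o_def case_prod_unfold)

lemma continuous_map_action_fixed:
  assumes "g \<in> carrier G" "g' \<in> carrier G" "\<sigma> \<in> transporter G g g'"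
  shows "continuous_map (fixed_space g) (fixed_space g') (\<phi> \<sigma>)"
proof -
  have "continuous_map (fixed_space g) TX (\<lambda>x. \<phi> \<sigma> x)"
    by (rule continuous_map_action)
      (use transporter_carrier[OF assms(3)] in \<open>auto simp: topspace_TG intro: continuous_map_from_subtopology\<close>)
  then show ?thesis
    using action_transporter[OF assms] by (auto simp: continuous_map_in_subtopology)
qed

text \<open>Before passing to classes the map is the restricted group action, with the real
  parameter ignored. It descends because the quotient map is open and thus stays a quotient map
  after multiplication with the fixed point space.\<close>

lemma continuous_map_class_act:
  assumes g: "g \<in> carrier G" and g': "g' \<in> carrier G"
  shows "continuous_map (prod_topology (Lambda_mor_top G TG g g') (fixed_space g)) (fixed_space g')
    (\<lambda>(A, x). class_act \<phi> A x)"
proof -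
  let ?P = "prod_topology (pair_space g g') (fixed_space g)"
  have "continuous_map ?P TG (\<lambda>p. fst (fst p))" "continuous_map ?P TX snd"
    using continuous_map_compose[OF continuous_map_fst continuous_map_pair_space(1)]
    by (auto simp: o_def intro: continuous_map_into_fulltopology[OF continuous_map_snd])
  then have "continuous_map ?P TX (\<lambda>p. \<phi> (fst (fst p)) (snd p))"
    by (rule continuous_map_action)
  then have "continuous_map ?P (fixed_space g') (\<lambda>p. \<phi> (fst (fst p)) (snd p))"
    using action_transporter[OF g g'] by (auto simp: continuous_map_in_subtopology)
  then have "continuous_map ?P (fixed_space g') ((\<lambda>(A, x). class_act \<phi> A x) \<circ> (\<lambda>(p, x). (case p of (\<sigma>, t) \<Rightarrow> mor_class g \<sigma> t, x)))"
    by (rule continuous_map_eq) (auto simp: class_act_mor_class[OF g] transporter_carrier)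
  then show ?thesis
    using continuous_compose_quotient_map_eq[OF quotient_map_prod_open[OF quotient_map_mor_class[OF g] open_map_mor_class[OF g g']]]
    by blast
qed

lemma pregroupoid_inertia: "pregroupoid inertia"
proof
  show "continuous_map (Mor inertia) (Ob inertia) (src inertia)"
    unfolding inertia_simps
  proof (rule continuous_map_from_sum)
    fix i assume "i \<in> tors G \<times> tors G"
    then obtain g g' where i: "i = (g, g')" "g \<in> tors G"
      by auto
    show "continuous_map ((\<lambda>(g, g'). prod_topology (Lambda_mor_top G TG g g') (fixed_space g)) i)
        (sum_topology fixed_space (tors G)) (\<lambda>z. src inertia (i, z))"
      using continuous_map_into_sum[OF i(2) continuous_map_snd, of _ fixed_space]
      by (simp add: Lambda_groupoid_def case_prod_unfold i)
  qed
  show "continuous_map (Mor inertia) (Ob inertia) (tgt inertia)"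
    unfolding inertia_simps
  proof (rule continuous_map_from_sum)
    fix i assume "i \<in> tors G \<times> tors G"
    then obtain g g' where i: "i = (g, g')" and g: "g \<in> tors G" "g' \<in> tors G"
      by auto
    show "continuous_map ((\<lambda>(g, g'). prod_topology (Lambda_mor_top G TG g g') (fixed_space g)) i)
        (sum_topology fixed_space (tors G)) (\<lambda>z. tgt inertia (i, z))"
      using continuous_map_into_sum[where X = fixed_space, OF g(2) continuous_map_class_act[OF tors_carrier[OF g(1)] tors_carrier[OF g(2)]]]
      by (simp add: Lambda_groupoid_def case_prod_unfold i)
  qed
  show "src inertia (idm inertia x) = x" for x
    by (cases x) simp
  show "src inertia (cmp inertia m k) = src inertia k" for m k
    by (cases m; cases k) (auto simp: Lambda_groupoid_def)
qed

lemma component_functor_simps [simp]: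
  "fst (component_functor G g) x = (g, x)"
  "snd (component_functor G g) (real_class g h t, x) = ((g, g), (mor_class g h t, x))"
  by (simp_all add: component_functor_def image_real_class)

lemma continuous_map_circle_classes:
  assumes g: "g \<in> carrier G"
  shows "continuous_map (Mor (local_gpd g)) (prod_topology (Lambda_mor_top G TG g g) (fixed_space g))
    (\<lambda>z. ((\<lambda>(h, t). (h, circle_coset (ord g) t)) ` fst z, snd z))"
proof -
  have "continuous_map (Lambda_top G TG g) (Lambda_mor_top G TG g g) (\<lambda>A. (\<lambda>(h, t). (h, circle_coset (ord g) t)) ` A)"
    by (rule continuous_map_from_real_class[OF g])
      (auto simp: image_real_class intro: continuous_map_mor_class[OF g] continuous_map_pair_space)
  from continuous_map_compose[OF continuous_map_fst this] show ?thesis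
    by (auto simp: continuous_map_pairwise o_def intro: continuous_map_snd)
qed

lemma continuous_component_morphisms:
  assumes g: "g \<in> tors G"
  shows "continuous_map (Mor (local_gpd g)) (Mor inertia) (snd (component_functor G g))"
proof -
  have gc: "g \<in> carrier G" using g by (rule tors_carrier)
  show ?thesis
    using continuous_map_circle_classes[OF gc] g continuous_map_into_sum[of "(g, g)" "tors G \<times> tors G" _ "\<lambda>(g, g'). prod_topology (Lambda_mor_top G TG g g') (fixed_space g)"]
    by (simp add: component_functor_def case_prod_unfold)
qed

lemma pregroupoid_local_gpd:
  assumes g: "g \<in> tors G"
  shows "pregroupoid (local_gpd g)"
proof
  have gc: "g \<in> carrier G" using g by (rule tors_carrier)
  \<comment> \<open>Reducing the real parameter to the circle does not affect the action on points,
    so continuity of the target map is inherited from the morphism space from \<open>g\<close> to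
    itself.\<close>
  let ?im = "\<lambda>A. (\<lambda>(h, t). (h, circle_coset (ord g) t)) ` A"
  from continuous_map_compose[OF continuous_map_circle_classes[OF gc] continuous_map_class_act[OF gc gc]]
  have "continuous_map (Mor (local_gpd g)) (fixed_space g) (\<lambda>z. class_act \<phi> (?im (fst z)) (snd z))"
    by (simp add: o_def)
  then show "continuous_map (Mor (local_gpd g)) (Ob (local_gpd g)) (tgt (local_gpd g))"
    unfolding local_gpd_simps(1)
  proof (rule continuous_map_eq)
    fix m assume "m \<in> topspace (Mor (local_gpd g))"
    then obtain h t x where "m = (real_class g h t, x)" "h \<in> transporter G g g" "x \<in> fixed_points TX \<phi> g"
      using gc by (rule mor_local_gpdE)
    then show "class_act \<phi> (?im (fst m)) (snd m) = tgt (local_gpd g) m"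
      using gc by (simp add: image_real_class class_act_mor_class class_act_real_class transporter_carrier)
  qed
qed (auto simp: continuous_map_snd)

lemma continuous_functor_component:
  assumes g: "g \<in> tors G"
  shows "continuous_functor (local_gpd g) inertia (component_functor G g)"
  unfolding continuous_functor_def
proof (intro conjI ballI impI)
  have gc: "g \<in> carrier G" using g by (rule tors_carrier)
  show "continuous_map (Ob (local_gpd g)) (Ob inertia) (fst (component_functor G g))"
    using continuous_map_component_injection[OF g, of fixed_space] by (simp add: component_functor_def)
  show "continuous_map (Mor (local_gpd g)) (Mor inertia) (snd (component_functor G g))"
    by (rule continuous_component_morphisms[OF g])
  fix m assume "m \<in> topspace (Mor (local_gpd g))"
  then obtain h t x where m: "m = (real_class g h t, x)" "h \<in> transporter G g g" "x \<in> fixed_points TX \<phi> g"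
    using gc by (rule mor_local_gpdE)
  show "src inertia (snd (component_functor G g) m) = fst (component_functor G g) (src (local_gpd g) m)"
    by (simp add: m)
  show "tgt inertia (snd (component_functor G g) m) = fst (component_functor G g) (tgt (local_gpd g) m)"
    using m gc by (simp add: class_act_mor_class class_act_real_class transporter_carrier)
  fix k assume "k \<in> topspace (Mor (local_gpd g))"
  then obtain h' t' x' where k: "k = (real_class g h' t', x')" "h' \<in> transporter G g g" "x' \<in> fixed_points TX \<phi> g"
    using gc by (rule mor_local_gpdE)
  show "snd (component_functor G g) (cmp (local_gpd g) m k) =
      cmp inertia (snd (component_functor G g) m) (snd (component_functor G g) k)"
    using m k gc by (simp add: mult_Lambda_group Lambda_comp_mor_class transporter_carrier)
next
  fix x
  show "snd (component_functor G g) (idm (local_gpd g) x) = idm inertia (fst (component_functor G g) x)"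
    using tors_carrier[OF g] by (simp add: one_Lambda_group)
qed

section \<open>Conjugation functors and the arrows relating them\<close>

lemma conj_functor_simps:
  assumes "h \<in> carrier G" "g \<in> carrier G" "u \<in> carrier G"
  shows "fst (conj_functor G \<phi> h) x = \<phi> h x"
    and "snd (conj_functor G \<phi> h) (real_class g u t, x) = (real_class (conj_by G h g) (conj_by G h u) t, \<phi> h x)"
  using assms by (simp_all add: conj_functor_def conj_real_class)

lemma conj_transporter_self:
  assumes "h \<in> carrier G" "g \<in> carrier G" "u \<in> transporter G g g"
  shows "conj_by G h u \<in> transporter G (conj_by G h g) (conj_by G h g)"
  using assms by (auto simp: transporter_def simp flip: conj_by_mult)

lemma continuous_functor_conj:
  assumes h: "h \<in> carrier G" and g: "g \<in> tors G"
  shows "continuous_functor (local_gpd g) (local_gpd (conj_by G h g)) (conj_functor G \<phi> h)"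
  unfolding continuous_functor_def
proof (intro conjI ballI impI)
  let ?g = "conj_by G h g"
  have gc: "g \<in> carrier G" using g by (rule tors_carrier)
  then have gc': "?g \<in> carrier G" using h by simp
  have ht: "h \<in> transporter G g ?g"
    using h gc by (rule conj_by_transporter)
  have ob: "continuous_map (fixed_space g) (fixed_space ?g) (\<phi> h)"
    by (rule continuous_map_action_fixed[OF gc gc' ht])
  then show "continuous_map (Ob (local_gpd g)) (Ob (local_gpd ?g)) (fst (conj_functor G \<phi> h))"
    by (simp add: conj_functor_def)
  let ?im = "\<lambda>A. (\<lambda>(u, t). (conj_by G h u, t)) ` A"
  have "continuous_map (pair_space g g) TG (\<lambda>p. conj_by G h (fst p))"
    unfolding conj_by_def using h
    by (intro continuous_map_mult continuous_map_pair_space) (auto simp: topspace_TG)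
  then have "continuous_map (pair_space g g) (Lambda_top G TG ?g) (\<lambda>p. real_class ?g (conj_by G h (fst p)) (snd p))"
    using conj_transporter_self[OF h gc] by (intro continuous_map_real_class[OF gc'] continuous_map_pair_space) auto
  then have "continuous_map (pair_space g g) (Lambda_top G TG ?g) (\<lambda>p. ?im (real_class g (fst p) (snd p)))"
  proof (rule continuous_map_eq)
    fix p assume "p \<in> topspace (pair_space g g)"
    then have "fst p \<in> carrier G"
      unfolding topspace_pair_space by (rule transporter_carrier)
    from conj_real_class[OF h gc this, of "snd p"]
    show "real_class ?g (conj_by G h (fst p)) (snd p) = ?im (real_class g (fst p) (snd p))"
      by (rule sym)
  qed
  then have "continuous_map (Lambda_top G TG g) (Lambda_top G TG ?g) ?im"
    by (rule continuous_map_from_real_class[OF gc])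
  from continuous_map_compose[OF continuous_map_fst this] continuous_map_compose[OF continuous_map_snd ob]
  show "continuous_map (Mor (local_gpd g)) (Mor (local_gpd ?g)) (snd (conj_functor G \<phi> h))"
    by (auto simp: conj_functor_def continuous_map_pairwise o_def case_prod_unfold)
  fix m assume "m \<in> topspace (Mor (local_gpd g))"
  then obtain u t x where m: "m = (real_class g u t, x)" "u \<in> transporter G g g" "x \<in> fixed_points TX \<phi> g"
    using gc by (rule mor_local_gpdE)
  have uc: "u \<in> carrier G"
    using m(2) by (rule transporter_carrier)
  have x: "x \<in> topspace TX"
    using m(3) by (rule fixed_pointsD)
  note s = conj_functor_simps[OF h gc]
  show "src (local_gpd ?g) (snd (conj_functor G \<phi> h) m) = fst (conj_functor G \<phi> h) (src (local_gpd g) m)"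
    using uc by (simp add: m s)
  have "conj_by G h u \<otimes> h = h \<otimes> u"
    using h uc by (simp add: conj_by_def m_assoc)
  then have "\<phi> (conj_by G h u) (\<phi> h x) = \<phi> h (\<phi> u x)"
    using h uc x action_mult[of "conj_by G h u" h x] action_mult[of h u x] by simp
  then show "tgt (local_gpd ?g) (snd (conj_functor G \<phi> h) m) = fst (conj_functor G \<phi> h) (tgt (local_gpd g) m)"
    using uc m h gc gc' action_transporter[OF gc gc' ht m(3)] by (simp add: s class_act_real_class)
  fix k assume "k \<in> topspace (Mor (local_gpd g))"
  then obtain u' t' x' where k: "k = (real_class g u' t', x')" "u' \<in> transporter G g g" "x' \<in> fixed_points TX \<phi> g"
    using gc by (rule mor_local_gpdE)
  have uc': "u' \<in> carrier G"
    using k(2) by (rule transporter_carrier)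
  show "snd (conj_functor G \<phi> h) (cmp (local_gpd g) m k) =
      cmp (local_gpd ?g) (snd (conj_functor G \<phi> h) m) (snd (conj_functor G \<phi> h) k)"
    using m k gc gc' uc uc' h conj_transporter_self[OF h gc]
    by (simp add: s mult_Lambda_group conj_by_mult)
next
  fix x
  have "conj_by G h \<one> = \<one>"
    using h by (simp add: conj_by_def)
  then show "snd (conj_functor G \<phi> h) (idm (local_gpd g) x) = idm (local_gpd (conj_by G h g)) (fst (conj_functor G \<phi> h) x)"
    using tors_carrier[OF g] h by (simp add: one_Lambda_group conj_functor_simps)
qed

text \<open>These arrows are the components of the natural isomorphisms between functors into
  \<open>\<Lambda>(X // G)\<close>.\<close>

definition shift_mor :: "'g \<Rightarrow> 'g \<Rightarrow> 'g \<Rightarrow> 'x \<Rightarrow> ('g \<times> 'g) \<times> (('g \<times> real set) set \<times> 'x)" where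
  "shift_mor g g' \<sigma> x = ((g, g'), (mor_class g \<sigma> 0, x))"

lemma continuous_map_shift_mor:
  assumes "g \<in> tors G" "g' \<in> tors G" "\<sigma> \<in> transporter G g g'" "continuous_map T (fixed_space g) f"
  shows "continuous_map T (Mor inertia) (\<lambda>x. shift_mor g g' \<sigma> (f x))"
proof -
  have "mor_class g \<sigma> 0 \<in> topspace (Lambda_mor_top G TG g g')"
    using topspace_Lambda_mor_top[OF tors_carrier[OF assms(1)]] assms(3) by blast
  then have "continuous_map T (prod_topology (Lambda_mor_top G TG g g') (fixed_space g)) (\<lambda>x. (mor_class g \<sigma> 0, f x))"
    using assms(4) by (simp add: continuous_map_pairwise o_def)
  then show ?thesis
    using continuous_map_into_sum[of "(g, g')" "tors G \<times> tors G" T "\<lambda>(g, g'). prod_topology (Lambda_mor_top G TG g g') (fixed_space g)"]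
      assms(1,2) by (simp add: shift_mor_def)
qed

lemma nat_iso_conj_component:
  assumes h: "h \<in> carrier G" and g: "g \<in> tors G"
  shows "nat_iso (local_gpd g) inertia (functor_comp (component_functor G (conj_by G h g)) (conj_functor G \<phi> h))
    (component_functor G g)"
proof -
  let ?g = "conj_by G h g"
  have gc: "g \<in> carrier G" using g by (rule tors_carrier)
  have g': "?g \<in> tors G" using h g by (rule conj_by_tors)
  then have gc': "?g \<in> carrier G" by (rule tors_carrier)
  have ht: "h \<in> transporter G g ?g"
    using h gc by (rule conj_by_transporter)
  have hi: "inv h \<in> transporter G ?g g"
    by (rule transporter_inv[OF gc gc' ht])
  note s = conj_functor_simps[OF h gc]
  show ?thesis
    unfolding nat_iso_def
  proof (intro exI conjI ballI)
    show "continuous_map (Ob (local_gpd g)) (Mor inertia) (\<lambda>x. shift_mor ?g g (inv h) (\<phi> h x))"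
      using continuous_map_shift_mor[OF g' g hi continuous_map_action_fixed[OF gc gc' ht]] by simp
    show "continuous_map (Ob (local_gpd g)) (Mor inertia) (\<lambda>x. shift_mor g ?g h x)"
      using continuous_map_shift_mor[OF g g' ht continuous_map_id[unfolded id_def]] by simp
  next
    fix x assume "x \<in> topspace (Ob (local_gpd g))"
    then have x: "x \<in> fixed_points TX \<phi> g" by simp
    have hx: "\<phi> h x \<in> fixed_points TX \<phi> ?g"
      by (rule action_transporter[OF gc gc' ht x])
    have inv_act: "\<phi> (inv h) (\<phi> h x) = x"
      using h fixed_pointsD(1)[OF x] by (simp add: action_one flip: action_mult)
    show "src inertia (shift_mor ?g g (inv h) (\<phi> h x)) =
        fst (functor_comp (component_functor G ?g) (conj_functor G \<phi> h)) x"
      by (simp add: shift_mor_def conj_functor_def)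
    show "tgt inertia (shift_mor ?g g (inv h) (\<phi> h x)) = fst (component_functor G g) x"
      using hx h gc' inv_act by (simp add: shift_mor_def class_act_mor_class)
    show "src inertia (shift_mor g ?g h x) = fst (component_functor G g) x"
      by (simp add: shift_mor_def)
    show "tgt inertia (shift_mor g ?g h x) = fst (functor_comp (component_functor G ?g) (conj_functor G \<phi> h)) x"
      using h x gc by (simp add: shift_mor_def class_act_mor_class conj_functor_def)
    show "cmp inertia (shift_mor g ?g h x) (shift_mor ?g g (inv h) (\<phi> h x)) =
        idm inertia (fst (functor_comp (component_functor G ?g) (conj_functor G \<phi> h)) x)"
      using h gc gc' hi by (simp add: shift_mor_def conj_functor_def Lambda_comp_mor_class)
    show "cmp inertia (shift_mor ?g g (inv h) (\<phi> h x)) (shift_mor g ?g h x) = idm inertia (fst (component_functor G g) x)"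
      using h gc gc' ht by (simp add: shift_mor_def Lambda_comp_mor_class)
  next
    fix m assume "m \<in> topspace (Mor (local_gpd g))"
    then obtain u t x where m: "m = (real_class g u t, x)" "u \<in> transporter G g g" "x \<in> fixed_points TX \<phi> g"
      using gc by (rule mor_local_gpdE)
    have uc: "u \<in> carrier G"
      using m(2) by (rule transporter_carrier)
    \<comment> \<open>Naturality comes down to this identity in the group:
      \<open>h\<inverse> (h u h\<inverse>) = u h\<inverse>\<close>.\<close>
    have "inv h \<otimes> conj_by G h u = u \<otimes> inv h"
      using h uc by (simp add: conj_by_def m_assoc inv_cancel)
    then show "cmp inertia (shift_mor ?g g (inv h) (\<phi> h (tgt (local_gpd g) m)))
          (snd (functor_comp (component_functor G ?g) (conj_functor G \<phi> h)) m) =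
        cmp inertia (snd (component_functor G g) m) (shift_mor ?g g (inv h) (\<phi> h (src (local_gpd g) m)))"
      using m uc h gc gc' hi conj_transporter_self[OF h gc m(2)] by (simp add: shift_mor_def s Lambda_comp_mor_class)
  qed
qed

end

section \<open>Retraction onto representatives of conjugacy classes\<close>

locale gspace_reps = gspace +
  fixes R :: "'a set"
  assumes reps: "tors_conj_reps G R"
begin

definition rep :: "'a \<Rightarrow> 'a" where
  "rep g = (THE r. r \<in> R \<and> (\<exists>h\<in>carrier G. r = conj_by G h g))"

text \<open>For a representative \<open>r\<close> itself the chosen element centralises
  \<open>r\<close> but need not be trivial. Hence the retraction restricts to the identity on the
  component of \<open>r\<close> only up to isomorphism.\<close>

definition to_rep :: "'a \<Rightarrow> 'a" where
  "to_rep g = (SOME h. h \<in> carrier G \<and> rep g = conj_by G h g)"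

lemma R_tors: "r \<in> R \<Longrightarrow> r \<in> tors G"
  using reps by (auto simp: tors_conj_reps_def)

lemma rep_unique:
  assumes "g \<in> tors G" "r \<in> R" "h \<in> carrier G" "r = conj_by G h g"
  shows "rep g = r"
  using assms reps unfolding rep_def tors_conj_reps_def by (intro the1_equality) auto

lemma rep_props:
  assumes g: "g \<in> tors G"
  shows "rep g \<in> R" "to_rep g \<in> carrier G" "conj_by G (to_rep g) g = rep g"
proof -
  obtain r h where r: "r \<in> R" "h \<in> carrier G" "r = conj_by G h g"
    using reps g unfolding tors_conj_reps_def by blast
  have "rep g = r"
    by (rule rep_unique[OF g r])
  then show "rep g \<in> R"
    using r by simp
  have "\<exists>h. h \<in> carrier G \<and> rep g = conj_by G h g"
    using r \<open>rep g = r\<close> by blast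
  then have "to_rep g \<in> carrier G \<and> rep g = conj_by G (to_rep g) g"
    unfolding to_rep_def by (rule someI_ex)
  then show "to_rep g \<in> carrier G" "conj_by G (to_rep g) g = rep g"
    by auto
qed

lemma rep_tors: "g \<in> tors G \<Longrightarrow> rep g \<in> tors G"
  using rep_props(1) R_tors by blast

lemma to_rep_transporter: "g \<in> tors G \<Longrightarrow> to_rep g \<in> transporter G g (rep g)"
  using conj_by_transporter[OF rep_props(2) tors_carrier] rep_props(3) by metis

lemma rep_R: "r \<in> R \<Longrightarrow> rep r = r"
  using rep_unique[of r r \<one>] R_tors tors_carrier by (auto simp: conj_by_one)

lemma rep_transporter:
  assumes "g \<in> tors G" "g' \<in> tors G" "\<sigma> \<in> transporter G g g'"
  shows "rep g' = rep g"
proof -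
  have \<sigma>: "\<sigma> \<in> carrier G" "g' = conj_by G \<sigma> g"
    using assms transporter_iff tors_carrier by auto
  have "rep g' = conj_by G (to_rep g' \<otimes> \<sigma>) g"
    using rep_props(2,3)[OF assms(2)] \<sigma> tors_carrier[OF assms(1)] by (simp flip: conj_by_conj_by)
  then show ?thesis
    using rep_unique[OF assms(1) rep_props(1)[OF assms(2)], of "to_rep g' \<otimes> \<sigma>"] rep_props(2)[OF assms(2)] \<sigma>
    by simp
qed

text \<open>The element transports along the loop from \<open>rep g\<close> to \<open>g\<close>,
  then to \<open>g'\<close>, and back to \<open>rep g'\<close>, which is \<open>rep g\<close>
  again.\<close>

lemma conjugate_to_rep:
  assumes "g \<in> tors G" "g' \<in> tors G" "\<sigma> \<in> transporter G g g'"
  shows "to_rep g' \<otimes> \<sigma> \<otimes> inv (to_rep g) \<in> transporter G (rep g) (rep g)"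
proof -
  have c: "g \<in> carrier G" "g' \<in> carrier G" "rep g \<in> carrier G"
    using assms rep_tors tors_carrier by auto
  have "to_rep g' \<in> transporter G g' (rep g)"
    using to_rep_transporter[OF assms(2)] rep_transporter[OF assms] by simp
  moreover have "inv (to_rep g) \<in> transporter G (rep g) g"
    by (rule transporter_inv[OF c(1,3) to_rep_transporter[OF assms(1)]])
  ultimately show ?thesis
    using c assms(3) by (meson transporter_mult)
qed

lemma src_inertia: "src inertia m = (fst (fst m), snd (snd m))"
  by (cases m) (auto simp: Lambda_groupoid_def)

sublocale decomposed_pregroupoid inertia "\<lambda>z. rep (fst z)" R
proof (intro decomposed_pregroupoid.intro pregroupoid_inertia decomposed_pregroupoid_axioms.intro)
  fix j
  let ?U = "{x \<in> topspace (Ob inertia). rep (fst x) = j}"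
  \<comment> \<open>A piece contains each summand of the coproduct either entirely or not at
    all.\<close>
  have U: "{x. (i, x) \<in> ?U} = (if rep i = j then topspace (fixed_space i) else {})" if "i \<in> tors G" for i
    using that by auto
  have "openin (fixed_space i) {x. (i, x) \<in> ?U}" if "i \<in> tors G" for i
    unfolding U[OF that] using openin_topspace[of "fixed_space i"] by (simp only: openin_empty split: if_split) simp
  then show "openin (Ob inertia) ?U"
    unfolding inertia_simps(1) openin_sum_topology by auto
next
  fix x assume "x \<in> topspace (Ob inertia)"
  then show "rep (fst x) \<in> R"
    using rep_props(1) by auto
next
  fix m assume "m \<in> topspace (Mor inertia)"
  then show "rep (fst (tgt inertia m)) = rep (fst (src inertia m))"
    by (rule mor_inertiaE) (simp add: rep_transporter)
qed

lemma mor_pieceE: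
  assumes "m \<in> topspace (Mor (piece r))"
  obtains g g' \<sigma> t x where "m = ((g, g'), (mor_class g \<sigma> t, x))" "g \<in> tors G" "g' \<in> tors G"
    "\<sigma> \<in> transporter G g g'" "x \<in> fixed_points TX \<phi> g" "rep g = r" "rep g' = r"
proof -
  have "m \<in> topspace (Mor inertia)" and r: "rep (fst (src inertia m)) = r"
    using assms by auto
  then show thesis
    using that rep_transporter by (elim mor_inertiaE) simp
qed

definition retraction :: "('a \<times> 'c, ('a \<times> 'a) \<times> (('a \<times> real set) set \<times> 'c), 'c, ('a \<times> real) set \<times> 'c) gfunctor" where
  "retraction = ((\<lambda>(g, x). \<phi> (to_rep g) x),
     (\<lambda>((g, g'), (A, x)). (retract_class (to_rep g) (to_rep g') A, \<phi> (to_rep g) x)))"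

lemma retraction_simps:
  shows "fst retraction (g, x) = \<phi> (to_rep g) x"
    and "g \<in> tors G \<Longrightarrow> g' \<in> tors G \<Longrightarrow> \<sigma> \<in> carrier G \<Longrightarrow>
      snd retraction ((g, g'), (mor_class g \<sigma> t, x)) =
      (real_class (rep g) (to_rep g' \<otimes> \<sigma> \<otimes> inv (to_rep g)) t, \<phi> (to_rep g) x)"
  by (simp_all add: retraction_def retract_mor_class rep_props tors_carrier)

lemma continuous_functor_retraction:
  assumes r: "r \<in> R"
  shows "continuous_functor (piece r) (local_gpd r) retraction"
  unfolding continuous_functor_def
proof (intro conjI ballI impI)
  have rt: "r \<in> tors G" and rc: "r \<in> carrier G"
    using r R_tors tors_carrier by auto
  have ob: "continuous_map (fixed_space g) (fixed_space r) (\<phi> (to_rep g))" if "g \<in> tors G" "rep g = r" for g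
    using continuous_map_action_fixed[OF tors_carrier[OF that(1)] rc] to_rep_transporter[OF that(1)] that(2) by simp
  have "continuous_map (subtopology (sum_topology fixed_space (tors G)) {z. rep (fst z) = r}) (fixed_space r) (fst retraction)"
    by (rule continuous_map_from_sum_sub) (use ob in \<open>simp add: retraction_def\<close>)
  then show "continuous_map (Ob (piece r)) (Ob (local_gpd r)) (fst retraction)"
    by simp
  let ?X = "\<lambda>(g, g'). prod_topology (Lambda_mor_top G TG g g') (fixed_space g)"
  have "continuous_map (subtopology (sum_topology ?X (tors G \<times> tors G)) {m. (\<lambda>i. rep (fst i) = r) (fst m)})
      (Mor (local_gpd r)) (snd retraction)"
  proof (rule continuous_map_from_sum_sub)
    fix i assume "i \<in> tors G \<times> tors G" "rep (fst i) = r"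
    then obtain g g' where i: "i = (g, g')" and g: "g \<in> tors G" "g' \<in> tors G" "rep g = r"
      by auto
    have gc: "g \<in> carrier G"
      using g by (simp add: tors_carrier)
    have "continuous_map (Lambda_mor_top G TG g g') (Lambda_top G TG r) (retract_class (to_rep g) (to_rep g'))"
    proof (rule continuous_map_from_mor_class[OF gc])
      have "continuous_map (pair_space g g') TG (\<lambda>p. to_rep g' \<otimes> fst p \<otimes> inv (to_rep g))"
        using rep_props(2)[OF g(1)] rep_props(2)[OF g(2)]
        by (intro continuous_map_mult continuous_map_pair_space) (auto simp: topspace_TG)
      then have "continuous_map (pair_space g g') (Lambda_top G TG r)
          (\<lambda>p. real_class r (to_rep g' \<otimes> fst p \<otimes> inv (to_rep g)) (snd p))"
        using conjugate_to_rep[OF g(1,2)] unfolding g(3)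
        by (intro continuous_map_real_class[OF rc] continuous_map_pair_space) auto
      then show "continuous_map (pair_space g g') (Lambda_top G TG r)
          (\<lambda>p. retract_class (to_rep g) (to_rep g') (mor_class g (fst p) (snd p)))"
      proof (rule continuous_map_eq)
        fix p assume "p \<in> topspace (pair_space g g')"
        then have "fst p \<in> carrier G"
          unfolding topspace_pair_space by (rule transporter_carrier)
        then show "real_class r (to_rep g' \<otimes> fst p \<otimes> inv (to_rep g)) (snd p) =
            retract_class (to_rep g) (to_rep g') (mor_class g (fst p) (snd p))"
          using retract_mor_class[OF gc rep_props(2)[OF g(1)] rep_props(2)[OF g(2)]] rep_props(3)[OF g(1)] g(3)
          by simp
      qed
    qed
    from continuous_map_compose[OF continuous_map_fst this]
      continuous_map_compose[OF continuous_map_snd ob[OF g(1,3)]]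
    show "continuous_map (?X i) (Mor (local_gpd r)) (\<lambda>z. snd retraction (i, z))"
      by (auto simp: i retraction_def case_prod_unfold continuous_map_pairwise o_def)
  qed
  then show "continuous_map (Mor (piece r)) (Mor (local_gpd r)) (snd retraction)"
    by (simp add: src_inertia)
  fix m assume "m \<in> topspace (Mor (piece r))"
  then obtain g g' \<sigma> t x where m: "m = ((g, g'), (mor_class g \<sigma> t, x))" "g \<in> tors G" "g' \<in> tors G"
    "\<sigma> \<in> transporter G g g'" "x \<in> fixed_points TX \<phi> g" "rep g = r" "rep g' = r"
    by (rule mor_pieceE)
  have c: "g \<in> carrier G" "g' \<in> carrier G" "\<sigma> \<in> carrier G" "to_rep g \<in> carrier G" "to_rep g' \<in> carrier G"
    using m transporter_carrier by (auto simp: tors_carrier rep_props)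
  have x: "x \<in> topspace TX"
    by (rule fixed_pointsD[OF m(5)])
  have hx: "\<phi> (to_rep g) x \<in> fixed_points TX \<phi> r"
    using action_transporter[OF c(1) rc _ m(5)] to_rep_transporter[OF m(2)] m(6) by simp
  show "src (local_gpd r) (snd retraction m) = fst retraction (src (piece r) m)"
    using m c by (simp add: retraction_simps)
  have "\<phi> (to_rep g' \<otimes> \<sigma> \<otimes> inv (to_rep g)) (\<phi> (to_rep g) x) = \<phi> (to_rep g') (\<phi> \<sigma> x)"
    using c x action_closed by (simp add: m_assoc flip: action_mult)
  then show "tgt (local_gpd r) (snd retraction m) = fst retraction (tgt (piece r) m)"
    using m c rc hx by (simp add: retraction_simps class_act_real_class class_act_mor_class)
  fix k assume "k \<in> topspace (Mor (piece r))" and mk: "src (piece r) m = tgt (piece r) k"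
  then obtain k0 k1 \<tau> s y where k: "k = ((k0, k1), (mor_class k0 \<tau> s, y))" "k0 \<in> tors G" "k1 \<in> tors G"
    "\<tau> \<in> transporter G k0 k1" "y \<in> fixed_points TX \<phi> k0" "rep k0 = r" "rep k1 = r"
    by (elim mor_pieceE)
  have k1: "k1 = g"
    using mk by (simp add: m k)
  have ck: "k0 \<in> carrier G" "\<tau> \<in> carrier G" "to_rep k0 \<in> carrier G"
    using k transporter_carrier by (auto simp: tors_carrier rep_props)
  \<comment> \<open>The factors \<open>to_rep g\<close> and its inverse cancel at the middle object,
    so the chosen conjugators disappear from composites.\<close>
  have "to_rep g' \<otimes> (\<sigma> \<otimes> \<tau>) \<otimes> inv (to_rep k0) =
      (to_rep g' \<otimes> \<sigma> \<otimes> inv (to_rep g)) \<otimes> (to_rep g \<otimes> \<tau> \<otimes> inv (to_rep k0))"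
    using c ck by (simp add: m_assoc inv_cancel)
  then show "snd retraction (cmp (piece r) m k) = cmp (local_gpd r) (snd retraction m) (snd retraction k)"
    using m k k1 c ck rc conjugate_to_rep[OF m(2-4)] conjugate_to_rep[OF k(2-4)]
    by (simp add: retraction_simps Lambda_comp_mor_class mult_Lambda_group)
next
  fix z assume "z \<in> topspace (Ob (piece r))"
  then obtain g x where z: "z = (g, x)" "g \<in> tors G" "rep g = r"
    by auto
  then show "snd retraction (idm (piece r) z) = idm (local_gpd r) (fst retraction z)"
    using rep_props(2)[OF z(2)] tors_carrier[OF R_tors[OF r]] by (simp add: retraction_simps one_Lambda_group)
qed

lemma continuous_functor_component_piece:
  assumes r: "r \<in> R"
  shows "continuous_functor (local_gpd r) (piece r) (component_functor G r)"
proof -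
  have F: "continuous_functor (local_gpd r) inertia (component_functor G r)"
    by (rule continuous_functor_component[OF R_tors[OF r]])
  have "rep (fst (src inertia (snd (component_functor G r) m))) = r" for m
    by (cases m) (simp add: component_functor_def rep_R[OF r])
  with F show ?thesis
    unfolding continuous_functor_def
    by (auto simp: continuous_map_in_subtopology rep_R[OF r] simp del: inertia_simps(1,2) local_gpd_simps(1,2))
qed

text \<open>The composite is conjugation by \<open>h = to_rep r\<close>, which is inner in
  \<open>\<Lambda>\<^sub>G(r)\<close>; the arrows \<open>[h\<inverse>, 0]\<close> trivialise
  it.\<close>

lemma nat_iso_retraction_component:
  assumes r: "r \<in> R"
  shows "nat_iso (local_gpd r) (local_gpd r) (functor_comp retraction (component_functor G r)) (id, id)"
proof -
  have rt: "r \<in> tors G" and rc: "r \<in> carrier G"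
    using r R_tors tors_carrier by auto
  define h where "h = to_rep r"
  have h: "h \<in> transporter G r r" and hc: "h \<in> carrier G"
    using to_rep_transporter[OF rt] rep_props(2)[OF rt] rep_R[OF r] by (auto simp: h_def)
  have hi: "inv h \<in> transporter G r r"
    by (rule transporter_inv[OF rc rc h])
  have const: "continuous_map (fixed_space r) (Mor (local_gpd r)) (\<lambda>x. (real_class r u 0, f x))"
    if "u \<in> transporter G r r" "continuous_map (fixed_space r) (fixed_space r) f" for u f
  proof -
    have "real_class r u 0 \<in> topspace (Lambda_top G TG r)"
      using topspace_Lambda_top[OF rc] that(1) by blast
    then show ?thesis
      using that(2) by (simp add: continuous_map_pairwise o_def)
  qed
  show ?thesis
    unfolding nat_iso_def
  proof (intro exI conjI ballI)
    show "continuous_map (Ob (local_gpd r)) (Mor (local_gpd r)) (\<lambda>x. (real_class r (inv h) 0, \<phi> h x))"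
      using const[OF hi continuous_map_action_fixed[OF rc rc h]] by simp
    show "continuous_map (Ob (local_gpd r)) (Mor (local_gpd r)) (\<lambda>x. (real_class r h 0, x))"
      using const[OF h continuous_map_id[unfolded id_def]] by simp
  next
    fix x assume "x \<in> topspace (Ob (local_gpd r))"
    then have x: "x \<in> fixed_points TX \<phi> r" by simp
    have hx: "\<phi> h x \<in> fixed_points TX \<phi> r"
      by (rule action_transporter[OF rc rc h x])
    have inv_act: "\<phi> (inv h) (\<phi> h x) = x"
      using hc fixed_pointsD(1)[OF x] by (simp add: action_one flip: action_mult)
    let ?e = "(real_class r (inv h) 0, \<phi> h x)" and ?e' = "(real_class r h 0, x)"
    show "src (local_gpd r) ?e = fst (functor_comp retraction (component_functor G r)) x"
      "tgt (local_gpd r) ?e' = fst (functor_comp retraction (component_functor G r)) x"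
      "src (local_gpd r) ?e' = fst (id, id) x"
      "tgt (local_gpd r) ?e = fst (id, id) x"
      using x hx hc rc inv_act by (auto simp: retraction_simps class_act_real_class h_def)
    show "cmp (local_gpd r) ?e' ?e = idm (local_gpd r) (fst (functor_comp retraction (component_functor G r)) x)"
      using h hi hc rc by (simp add: mult_Lambda_group one_Lambda_group retraction_simps h_def)
    show "cmp (local_gpd r) ?e ?e' = idm (local_gpd r) (fst (id, id) x)"
      using h hi hc rc by (simp add: mult_Lambda_group one_Lambda_group)
  next
    fix m assume "m \<in> topspace (Mor (local_gpd r))"
    then obtain u t x where m: "m = (real_class r u t, x)" "u \<in> transporter G r r" "x \<in> fixed_points TX \<phi> r"
      using rc by (rule mor_local_gpdE)
    have uc: "u \<in> carrier G"
      using m(2) by (rule transporter_carrier)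
    have "h \<otimes> u \<otimes> inv h \<in> transporter G r r"
      using conjugate_to_rep[OF rt rt m(2)] rep_R[OF r] by (simp add: h_def)
    moreover have "inv h \<otimes> (h \<otimes> u \<otimes> inv h) = u \<otimes> inv h"
      using hc uc by (simp add: m_assoc inv_cancel)
    ultimately show "cmp (local_gpd r) (real_class r (inv h) 0, \<phi> h (tgt (local_gpd r) m))
          (snd (functor_comp retraction (component_functor G r)) m) =
        cmp (local_gpd r) (snd (id, id) m) (real_class r (inv h) 0, \<phi> h (src (local_gpd r) m))"
      using m uc hi rc rt rep_R[OF r] by (simp add: retraction_simps mult_Lambda_group flip: h_def)
  qed
qed

text \<open>The component at \<open>(g, x)\<close> is the arrow given by the inverse of
  \<open>to_rep g\<close>, leading from the image of \<open>x\<close> in \<open>X\<^sup>r\<close>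
  back to \<open>x\<close>. Its continuity is checked on each \<open>X\<^sup>g\<close> separately,
  where the conjugator is constant.\<close>

lemma nat_iso_component_retraction:
  assumes r: "r \<in> R"
  shows "nat_iso (piece r) (piece r) (functor_comp (component_functor G r) retraction) (id, id)"
proof -
  have rt: "r \<in> tors G" and rc: "r \<in> carrier G" and rr: "rep r = r"
    using r R_tors tors_carrier rep_R by auto
  define \<eta> where "\<eta> = (\<lambda>z. shift_mor r (fst z) (inv (to_rep (fst z))) (\<phi> (to_rep (fst z)) (snd z)))"
  define \<eta>' where "\<eta>' = (\<lambda>z. shift_mor (fst z) r (to_rep (fst z)) (snd z))"
  have tr: "to_rep g \<in> carrier G" "to_rep g \<in> transporter G g r" "inv (to_rep g) \<in> transporter G r g"
    if "g \<in> tors G" "rep g = r" for g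
    using that to_rep_transporter[OF that(1)] rep_props(2)[OF that(1)] transporter_inv[OF _ rc] tors_carrier by auto
  have src_shift: "src inertia (shift_mor g g' \<sigma> x) = (g, x)" for g g' \<sigma> x
    by (simp add: shift_mor_def)
  show ?thesis
    unfolding nat_iso_def
  proof (intro exI conjI ballI)
    have "continuous_map (subtopology (sum_topology fixed_space (tors G)) {z. rep (fst z) = r}) (Mor inertia) \<eta>"
    proof (rule continuous_map_from_sum_sub)
      fix g assume g: "g \<in> tors G" "rep g = r"
      show "continuous_map (fixed_space g) (Mor inertia) (\<lambda>x. \<eta> (g, x))"
        unfolding \<eta>_def fst_conv snd_conv
        by (rule continuous_map_shift_mor[OF rt g(1) tr(3)[OF g]
              continuous_map_action_fixed[OF tors_carrier[OF g(1)] rc tr(2)[OF g]]])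
    qed
    then show "continuous_map (Ob (piece r)) (Mor (piece r)) \<eta>"
      unfolding restrict_gpd_simps inertia_simps(1) continuous_map_in_subtopology
      by (auto simp: \<eta>_def src_shift rr)
    have "continuous_map (subtopology (sum_topology fixed_space (tors G)) {z. rep (fst z) = r}) (Mor inertia) \<eta>'"
      by (rule continuous_map_from_sum_sub)
        (use tr rt continuous_map_shift_mor[OF _ rt _ continuous_map_id[unfolded id_def]] in \<open>simp add: \<eta>'_def del: inertia_simps\<close>)
    then show "continuous_map (Ob (piece r)) (Mor (piece r)) \<eta>'"
      unfolding restrict_gpd_simps inertia_simps(1) continuous_map_in_subtopology
      by (auto simp: \<eta>'_def src_shift)
  next
    fix z assume "z \<in> topspace (Ob (piece r))"
    then obtain g x where z: "z = (g, x)" "g \<in> tors G" "rep g = r" "x \<in> fixed_points TX \<phi> g"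
      by auto
    note t = tr[OF z(2,3)]
    have gc: "g \<in> carrier G"
      using z by (simp add: tors_carrier)
    have hx: "\<phi> (to_rep g) x \<in> fixed_points TX \<phi> r"
      by (rule action_transporter[OF gc rc t(2) z(4)])
    have inv_act: "\<phi> (inv (to_rep g)) (\<phi> (to_rep g) x) = x"
      using t fixed_pointsD(1)[OF z(4)] by (simp add: action_one flip: action_mult)
    show "src (piece r) (\<eta> z) = fst (functor_comp (component_functor G r) retraction) z"
      "tgt (piece r) (\<eta>' z) = fst (functor_comp (component_functor G r) retraction) z"
      "src (piece r) (\<eta>' z) = fst (id, id) z" "tgt (piece r) (\<eta> z) = fst (id, id) z"
      using z t gc rc hx inv_act
      by (auto simp: \<eta>_def \<eta>'_def shift_mor_def retraction_simps class_act_mor_class)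
    show "cmp (piece r) (\<eta>' z) (\<eta> z) = idm (piece r) (fst (functor_comp (component_functor G r) retraction) z)"
      "cmp (piece r) (\<eta> z) (\<eta>' z) = idm (piece r) (fst (id, id) z)"
      using z t gc rc by (auto simp: \<eta>_def \<eta>'_def shift_mor_def retraction_simps Lambda_comp_mor_class)
  next
    fix m assume "m \<in> topspace (Mor (piece r))"
    then obtain g g' \<sigma> t x where m: "m = ((g, g'), (mor_class g \<sigma> t, x))" "g \<in> tors G" "g' \<in> tors G"
      "\<sigma> \<in> transporter G g g'" "x \<in> fixed_points TX \<phi> g" "rep g = r" "rep g' = r"
      by (rule mor_pieceE)
    note t = tr[OF m(2,6)] and t' = tr[OF m(3,7)]
    have c: "g \<in> carrier G" "g' \<in> carrier G" "\<sigma> \<in> carrier G"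
      using m transporter_carrier by (auto simp: tors_carrier)
    have x: "x \<in> topspace TX"
      by (rule fixed_pointsD[OF m(5)])
    have "inv (to_rep g') \<otimes> (to_rep g' \<otimes> \<sigma> \<otimes> inv (to_rep g)) = \<sigma> \<otimes> inv (to_rep g)"
      using t t' c by (simp add: m_assoc inv_cancel)
    then show "cmp (piece r) (\<eta> (tgt (piece r) m)) (snd (functor_comp (component_functor G r) retraction) m) =
        cmp (piece r) (snd (id, id) m) (\<eta> (src (piece r) m))"
      using m t t' c rc x conjugate_to_rep[OF m(2-4)]
      by (simp add: \<eta>_def shift_mor_def retraction_simps Lambda_comp_mor_class)
  qed
qed

lemma gpd_equivalence_component:
  "r \<in> R \<Longrightarrow> gpd_equivalence (local_gpd r) (piece r) (component_functor G r) retraction"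
  by (simp add: gpd_equivalence_def continuous_functor_component_piece continuous_functor_retraction
      nat_iso_retraction_component nat_iso_component_retraction del: inertia_simps local_gpd_simps restrict_gpd_simps)

end

section \<open>The product decomposition and the description by invariants\<close>

theorem proposition3p12:
  fixes G :: "('g, 'b) monoid_scheme" and TG :: "'g topology"
    and TX :: "'x topology" and \<phi> :: "'g \<Rightarrow> 'x \<Rightarrow> 'x" and R :: "'g set" and n :: int
  assumes "compact_lie_group G TG"
    and "G_space G TG TX \<phi>"
    and "tors_conj_reps G R"
  shows "(\<lambda>\<xi>. \<lambda>g\<in>R. QEll_restrict n G TG TX \<phi> g \<xi>)
           \<in> iso (QEll n G TG TX \<phi>) (product_group R (K_Lambda n G TG TX \<phi>))
       \<and> (\<lambda>\<xi>. \<lambda>g\<in>tors G. QEll_restrict n G TG TX \<phi> g \<xi>)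
           \<in> iso (QEll n G TG TX \<phi>) (K_invariants n G TG TX \<phi>)"
proof -
  interpret gspace_reps G TG TX \<phi> R
    using assms by unfold_locales (auto simp: compact_lie_group_def lie_group_def)
  let ?Q = "QEll n G TG TX \<phi>" and ?K = "K_Lambda n G TG TX \<phi>"
  let ?res = "QEll_restrict n G TG TX \<phi>"
  let ?conj = "\<lambda>h k. K_orb_map n (local_gpd k) (conj_functor G \<phi> h)"
  note F = continuous_functor_component
  have closed: "?res g \<xi> \<in> carrier (?K g)" if "g \<in> tors G" "\<xi> \<in> carrier ?Q" for g \<xi>
    unfolding QEll_restrict_def by (rule K_orb_map_closed[OF pregroupoid_local_gpd[OF that(1)] pregroupoid_inertia F[OF that(1)] that(2)])
  have mult: "?res g (\<xi> \<otimes>\<^bsub>?Q\<^esub> \<zeta>) = ?res g \<xi> \<otimes>\<^bsub>?K g\<^esub> ?res g \<zeta>"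
    if "g \<in> tors G" "\<xi> \<in> carrier ?Q" "\<zeta> \<in> carrier ?Q" for g \<xi> \<zeta>
    unfolding QEll_restrict_def
    by (rule K_orb_map_mult[OF pregroupoid_local_gpd[OF that(1)] pregroupoid_inertia F[OF that(1)] that(2,3)])
  have bij: "bij_betw (\<lambda>\<xi>. \<lambda>g\<in>R. ?res g \<xi>) (carrier ?Q) (\<Pi>\<^sub>E g\<in>R. carrier (?K g))"
    unfolding QEll_restrict_def
    by (rule bij_betw_K_orb_equivalences[where p = "\<lambda>r. retraction"])
      (use R_tors in \<open>auto intro: pregroupoid_local_gpd gpd_equivalence_component simp del: local_gpd_simps restrict_gpd_simps\<close>)
  \<comment> \<open>By functoriality the left-hand side is induced by the conjugation functor
    followed by the inclusion at the conjugate of \<open>k\<close>; this composite is naturally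
    isomorphic to the inclusion at \<open>k\<close>.\<close>
  have invariant: "?conj h k (?res (conj_by G h k) \<xi>) = ?res k \<xi>"
    if h: "h \<in> carrier G" and k: "k \<in> tors G" and \<xi>: "\<xi> \<in> carrier ?Q" for h k \<xi>
  proof -
    have k': "conj_by G h k \<in> tors G"
      by (rule conj_by_tors[OF h k])
    have C: "continuous_functor (local_gpd k) (local_gpd (conj_by G h k)) (conj_functor G \<phi> h)"
      by (rule continuous_functor_conj[OF h k])
    show ?thesis
      unfolding QEll_restrict_def K_orb_map_comp[OF pregroupoid_local_gpd[OF k] pregroupoid_local_gpd[OF k'] C F[OF k'] \<xi>]
      by (rule K_orb_map_nat_iso[OF pregroupoid_local_gpd[OF k] pregroupoid_inertia
            continuous_functor_comp[OF C F[OF k'] pregroupoid_local_gpd[OF k]] F[OF k] nat_iso_conj_component[OF h k] \<xi>])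
  qed
  have family_act: "K_family_act n G TG TX \<phi> h \<xi> k = ?conj (inv\<^bsub>G\<^esub> h) k (\<xi> (conj_by G (inv\<^bsub>G\<^esub> h) k))"
    if "k \<in> tors G" for h \<xi> k
    using that by (simp add: K_family_act_def)
  have mem_inv: "\<xi> \<in> carrier (K_invariants n G TG TX \<phi>) \<longleftrightarrow> \<xi> \<in> (\<Pi>\<^sub>E g\<in>tors G. carrier (?K g)) \<and>
      (\<forall>h\<in>carrier G. K_family_act n G TG TX \<phi> h \<xi> = \<xi>)" for \<xi>
    by (simp add: K_invariants_def Let_def)
  have res_inv: "(\<lambda>g\<in>tors G. ?res g \<xi>) \<in> carrier (K_invariants n G TG TX \<phi>)" if \<xi>: "\<xi> \<in> carrier ?Q" for \<xi>
    unfolding mem_inv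
  proof (intro conjI ballI ext)
    show "(\<lambda>g\<in>tors G. ?res g \<xi>) \<in> (\<Pi>\<^sub>E g\<in>tors G. carrier (?K g))"
      using closed \<xi> by simp
    fix h k assume h: "h \<in> carrier G"
    show "K_family_act n G TG TX \<phi> h (\<lambda>g\<in>tors G. ?res g \<xi>) k = (\<lambda>g\<in>tors G. ?res g \<xi>) k"
    proof (cases "k \<in> tors G")
      case True
      have "conj_by G (inv\<^bsub>G\<^esub> h) k \<in> tors G"
        using h True by (intro conj_by_tors) auto
      then show ?thesis
        using invariant[of "inv\<^bsub>G\<^esub> h" k \<xi>] h True \<xi> by (simp add: family_act)
    qed (simp add: K_family_act_def)
  qed
  \<comment> \<open>An invariant family is determined by its components at representatives, since
    each other component is a pullback of one of these.\<close>
  have inv_eq: "\<xi> = \<zeta>" if \<xi>: "\<xi> \<in> carrier (K_invariants n G TG TX \<phi>)" and \<zeta>: "\<zeta> \<in> carrier (K_invariants n G TG TX \<phi>)"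
    and eq: "\<And>r. r \<in> R \<Longrightarrow> \<xi> r = \<zeta> r" for \<xi> \<zeta>
  proof (rule PiE_ext)
    show "\<xi> \<in> (\<Pi>\<^sub>E g\<in>tors G. carrier (?K g))" "\<zeta> \<in> (\<Pi>\<^sub>E g\<in>tors G. carrier (?K g))"
      using \<xi> \<zeta> by (auto simp: mem_inv)
    fix k assume k: "k \<in> tors G"
    \<comment> \<open>The family action of \<open>h\<close> conjugates by
      \<open>h\<inverse>\<close>. Taking for \<open>h\<close> the inverse of \<open>to_rep k\<close>
      therefore expresses the component at \<open>k\<close> through the one at
      \<open>rep k\<close>.\<close>
    define h where "h = inv\<^bsub>G\<^esub> (to_rep k)"
    have h: "h \<in> carrier G" "inv\<^bsub>G\<^esub> h = to_rep k"
      using rep_props(2)[OF k] by (auto simp: h_def)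
    have "\<xi> k = K_family_act n G TG TX \<phi> h \<xi> k" "\<zeta> k = K_family_act n G TG TX \<phi> h \<zeta> k"
      using \<xi> \<zeta> h(1) by (auto simp: mem_inv)
    then show "\<xi> k = \<zeta> k"
      using eq[OF rep_props(1)[OF k]] by (simp add: family_act[OF k] h(2) rep_props(3)[OF k])
  qed
  have "(\<lambda>\<xi>. \<lambda>g\<in>R. ?res g \<xi>) \<in> iso ?Q (product_group R ?K)"
    using bij closed mult R_tors by (auto simp: iso_def hom_def product_group_def fun_eq_iff)
  moreover have "bij_betw (\<lambda>\<xi>. \<lambda>g\<in>tors G. ?res g \<xi>) (carrier ?Q) (carrier (K_invariants n G TG TX \<phi>))"
  proof (rule bij_betw_imageI)
    \<comment> \<open>Families over the representatives are restrictions of families over all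
      torsion elements, so injectivity carries over from the first isomorphism.\<close>
    have restrict_R: "(\<lambda>g\<in>R. ?res g \<xi>) = restrict (\<lambda>g\<in>tors G. ?res g \<xi>) R" for \<xi>
      using R_tors by (auto simp: fun_eq_iff)
    show "inj_on (\<lambda>\<xi>. \<lambda>g\<in>tors G. ?res g \<xi>) (carrier ?Q)"
      using bij_betw_imp_inj_on[OF bij] unfolding restrict_R inj_on_def by metis
    show "(\<lambda>\<xi>. \<lambda>g\<in>tors G. ?res g \<xi>) ` carrier ?Q = carrier (K_invariants n G TG TX \<phi>)"
    proof (intro equalityI subsetI)
      fix \<eta> assume \<eta>: "\<eta> \<in> carrier (K_invariants n G TG TX \<phi>)"
      \<comment> \<open>Only the components of \<eta> at representatives are realised by the first
        isomorphism; the others then agree by invariance of both families.\<close>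
      then have "restrict \<eta> R \<in> (\<Pi>\<^sub>E g\<in>R. carrier (?K g))"
        using R_tors by (auto simp: mem_inv)
      then have "restrict \<eta> R \<in> (\<lambda>\<xi>. \<lambda>g\<in>R. ?res g \<xi>) ` carrier ?Q"
        unfolding bij_betw_imp_surj_on[OF bij] .
      then obtain \<xi> where \<xi>: "\<xi> \<in> carrier ?Q" "restrict \<eta> R = (\<lambda>g\<in>R. ?res g \<xi>)"
        by blast
      have "\<eta> = (\<lambda>g\<in>tors G. ?res g \<xi>)"
      proof (rule inv_eq[OF \<eta> res_inv[OF \<xi>(1)]])
        fix r assume "r \<in> R"
        then show "\<eta> r = (\<lambda>g\<in>tors G. ?res g \<xi>) r"
          using fun_cong[OF \<xi>(2), of r] R_tors by simp
      qed
      then show "\<eta> \<in> (\<lambda>\<xi>. \<lambda>g\<in>tors G. ?res g \<xi>) ` carrier ?Q"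
        using \<xi>(1) by blast
    qed (use res_inv in blast)
  qed
  then have "(\<lambda>\<xi>. \<lambda>g\<in>tors G. ?res g \<xi>) \<in> iso ?Q (K_invariants n G TG TX \<phi>)"
    using res_inv mult by (auto simp: iso_def hom_def K_invariants_def Let_def product_group_def fun_eq_iff)
  ultimately show ?thesis
    by blast
qed

end
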